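(* Let $P,Q\subset\mathbb{R}^2$ be Lebesgue measurable sets of finite Lebesgue measure whose boundaries have Lebesgue measure zero. For $\tau,\rho>0$ define $P_\tau=\{(\tau x_1,x_2):(x_1,x_2)\in P\}$ and $Q_\rho=\{(x_1,\rho x_2):(x_1,x_2)\in Q\}$. Let $\mathcal{T}_{P_\tau}f=\mathds{1}_{P_\tau}f$ and $\mathcal{B}_{Q_\rho}f=\mathcal{F}^{-1}\mathds{1}_{Q_\rho}\mathcal{F}f$ on $L^2(\mathbb{R}^2)$. For $0<\epsilon<1$, let $N_{\tau,\rho}(\epsilon)$ be the number of eigenvalues (counted with multiplicity) of the operator $\mathcal{T}_{P_\tau}\mathcal{B}_{Q_\rho}\mathcal{T}_{P_\tau}$ that are not smaller than $\epsilon$. Then $$N_{\tau,\rho}(\epsilon)=(2\pi)^{-2}\,m(P)\,m(Q)\,\tau\rho+o(\tau\rho)\quad\text{as }\tau,\rho\to\infty.$$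
   Context: $m(\cdot)$ denotes Lebesgue measure and $\mathds{1}_S$ the indicator function of a set $S$. The Fourier transform on $L^2(\mathbb{R}^2)$ is $\mathcal{F}f(\mathbf{u})=\int_{\mathbb{R}^2}f(\mathbf{x})e^{-i\mathbf{x}\cdot\mathbf{u}}\,d\mathbf{x}$ (extended to $L^2$ in the usual way). The operator $\mathcal{T}_{P_\tau}\mathcal{B}_{Q_\rho}\mathcal{T}_{P_\tau}$ is positive, self-adjoint, compact and bounded by one, so its eigenvalues form a countable set in $[0,1]$. *)

theory Defs
  imports "HOL-Analysis.Analysis"
begin

text \<open>R^2 is modelled as real \<times> real (a euclidean_space with inner product
  (a,b)\<bullet>(c,d) = a c + b d); functions in L^2(R^2) are complex-valued functions
  that are Lebesgue measurable and square integrable; identities are taken almost everywhere.\<close>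

type_synonym r2 = "real \<times> real"

definition L2 :: "(r2 \<Rightarrow> complex) \<Rightarrow> bool" where
  "L2 f \<longleftrightarrow> f \<in> borel_measurable lebesgue \<and> integrable lebesgue (\<lambda>x. (cmod (f x))\<^sup>2)"

definition fourier_int :: "(r2 \<Rightarrow> complex) \<Rightarrow> r2 \<Rightarrow> complex" where
  "fourier_int f u = (\<integral>x. f x * exp (- \<i> * complex_of_real (x \<bullet> u)) \<partial>lebesgue)"

definition inv_fourier_int :: "(r2 \<Rightarrow> complex) \<Rightarrow> r2 \<Rightarrow> complex" where
  "inv_fourier_int g x = complex_of_real ((2 * pi) powr (-2)) *
     (\<integral>u. g u * exp (\<i> * complex_of_real (x \<bullet> u)) \<partial>lebesgue)"

definition L2_fourier :: "(r2 \<Rightarrow> complex) \<Rightarrow> (r2 \<Rightarrow> complex) \<Rightarrow> bool" where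
  "L2_fourier f g \<longleftrightarrow> L2 f \<and> L2 g \<and>
     ((\<lambda>R. \<integral>\<^sup>+u. ennreal ((cmod (fourier_int (\<lambda>x. indicator (cball 0 R) x * f x) u - g u))\<^sup>2)
        \<partial>lebesgue) \<longlongrightarrow> 0) at_top"

definition L2_inv_fourier :: "(r2 \<Rightarrow> complex) \<Rightarrow> (r2 \<Rightarrow> complex) \<Rightarrow> bool" where
  "L2_inv_fourier g h \<longleftrightarrow> L2 g \<and> L2 h \<and>
     ((\<lambda>R. \<integral>\<^sup>+x. ennreal ((cmod (inv_fourier_int (\<lambda>u. indicator (cball 0 R) u * g u) x - h x))\<^sup>2)
        \<partial>lebesgue) \<longlongrightarrow> 0) at_top"

definition is_eigenfun :: "r2 set \<Rightarrow> r2 set \<Rightarrow> real \<Rightarrow> (r2 \<Rightarrow> complex) \<Rightarrow> bool" where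
  "is_eigenfun P Q lam f \<longleftrightarrow> L2 f \<and>
     (\<exists>g h. L2_fourier (\<lambda>x. indicator P x * f x) g \<and>
            L2_inv_fourier (\<lambda>u. indicator Q u * g u) h \<and>
            (AE x in lebesgue. indicator P x * h x = complex_of_real lam * f x))"

definition L2_inner :: "(r2 \<Rightarrow> complex) \<Rightarrow> (r2 \<Rightarrow> complex) \<Rightarrow> complex" where
  "L2_inner f g = (\<integral>x. f x * cnj (g x) \<partial>lebesgue)"

text \<open>Number of eigenvalues \<ge> eps counted with multiplicity = maximal size of an
  orthonormal family of eigenfunctions whose eigenvalues are \<ge> eps (since the operator
  is self-adjoint, eigenspaces for distinct eigenvalues are orthogonal).\<close>

definition eig_count :: "r2 set \<Rightarrow> r2 set \<Rightarrow> real \<Rightarrow> nat" where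
  "eig_count P Q eps = Sup {n. \<exists>fs :: nat \<Rightarrow> r2 \<Rightarrow> complex. \<exists>lams :: nat \<Rightarrow> real.
      (\<forall>i<n. eps \<le> lams i \<and> is_eigenfun P Q (lams i) (fs i)) \<and>
      (\<forall>i<n. \<forall>j<n. L2_inner (fs i) (fs j) = (if i = j then 1 else 0))}"

definition dil1 :: "real \<Rightarrow> r2 set \<Rightarrow> r2 set" where
  "dil1 t P = (\<lambda>(x1, x2). (t * x1, x2)) ` P"

definition dil2 :: "real \<Rightarrow> r2 set \<Rightarrow> r2 set" where
  "dil2 r Q = (\<lambda>(x1, x2). (x1, r * x2)) ` Q"

end

theory Submission
  imports Defs "HOL-Probability.Characteristic_Functions" "HOL-Complex_Analysis.Great_Picard"
begin

text \<open>Write \<open>A = T\<^sub>P B\<^sub>Q T\<^sub>P\<close>, so that \<open>tr A = (2\<pi>)\<^sup>-\<^sup>2 m(P) m(Q)\<close>, and let \<open>\<delta> = tr (A - A\<^sup>2)\<close>. Eigenvalues lie in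
  \<open>[0, 1]\<close>, and \<open>1 \<le> \<lambda> + \<lambda> (1 - \<lambda>) / \<epsilon>\<close> for \<open>\<lambda> \<ge> \<epsilon>\<close>, so at most \<open>tr A + \<delta> / \<epsilon>\<close> of them are not smaller than \<open>\<epsilon>\<close>.
  Conversely, if \<open>N\<close> of them are, then \<open>A \<le> \<epsilon>\<close> off the corresponding eigenspaces, hence
  \<open>tr A\<^sup>2 \<le> (1 - \<epsilon>) N + \<epsilon> tr A\<close>, i.e. \<open>N \<ge> tr A - \<delta> / (1 - \<epsilon>)\<close>. All traces are expressed through the plane waves
  \<open>e\<^sub>u\<close> restricted to \<open>P\<close>, since \<open>A = (2\<pi>)\<^sup>-\<^sup>2 \<integral>\<^sub>Q e\<^sub>u \<otimes> e\<^sub>u du\<close>; Bessel's inequality for finite families of eigenfunctions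
  and Plancherel's identity then suffice, and no orthonormal basis is needed.

  Finally, with \<open>D\<close> the Fourier transform of the indicator function of \<open>P\<close>,
  \<open>\<delta> = (2\<pi>)\<^sup>-\<^sup>4 \<integral> |D(w)|\<^sup>2 m(Q - (Q - w)) dw\<close>. For the dilated sets this is \<open>\<tau> \<rho>\<close> times the same integral with
  \<open>m(Q - (Q - w'))\<close>, \<open>w' = (w\<^sub>1 / \<tau>, w\<^sub>2 / \<rho>)\<close>, which tends to \<open>0\<close> by dominated convergence.\<close>

subsection \<open>The semi-inner product of square-integrable functions\<close>

text \<open>The count is a supremum of a set of natural numbers, so it is informative only once that
  set is known to be finite. The upper estimate supplies this, and then a family of maximal size
  exists. That \<open>A \<le> eps\<close> holds off its span is not read off a spectral theorem: if
  the quadratic form of \<open>A\<close> exceeded \<open>eps\<close> somewhere on the orthogonal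
  complement, its supremum there would be attained and would give one more eigenfunction. Attainment
  is where compactness enters, through equicontinuity of the functions \<open>A f\<close>.

  Plane waves replace a basis because tr A is \<open>c\<close> times the integral over
  \<open>Q\<close> of the squared norm of the wave on \<open>P\<close>, and tr A^2 is
  \<open>c\<close> times the integral over \<open>Q\<close> of the quadratic form of
  \<open>A\<close> at the wave. Plancherel shows that this second integral, taken over the whole
  plane, gives tr A again; hence \<delta> is an integral over the complement of \<open>Q\<close>,
  where nonnegativity and Bessel's inequality can be used.

  The limits in the definition of the Fourier transform on \<open>L2\<close> turn into honest
  integrals because a square-integrable function on a set of finite measure is integrable.\<close>

definition sq_int :: "'a measure \<Rightarrow> ('a \<Rightarrow> complex) \<Rightarrow> bool" where
  "sq_int M f \<longleftrightarrow> f \<in> borel_measurable M \<and> integrable M (\<lambda>x. (cmod (f x))\<^sup>2)"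

text \<open>The measure is a parameter because the form is used over \<open>lborel\<close>,
  \<open>lebesgue\<close> and the restrictions to \<open>P\<close> and \<open>Q\<close>. Functions
  are not identified up to null sets, so \<open>ip\<close> is only semi-definite.\<close>

definition ip :: "'a measure \<Rightarrow> ('a \<Rightarrow> complex) \<Rightarrow> ('a \<Rightarrow> complex) \<Rightarrow> complex" where
  "ip M f g = (\<integral>x. f x * cnj (g x) \<partial>M)"

definition nsq :: "'a measure \<Rightarrow> ('a \<Rightarrow> complex) \<Rightarrow> real" where
  "nsq M f = (\<integral>x. (cmod (f x))\<^sup>2 \<partial>M)"

lemma borel_measurable_cnj [measurable (raw)]:
  assumes "f \<in> borel_measurable M"
  shows "(\<lambda>x. cnj (f x)) \<in> borel_measurable M"
  by (rule borel_measurable_continuous_on[OF _ assms]) (intro continuous_intros)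

lemma sq_int_integrable_mult:
  assumes "sq_int M f" "sq_int M g"
  shows "integrable M (\<lambda>x. f x * cnj (g x))"
proof (rule Bochner_Integration.integrable_bound)
  have [measurable]: "f \<in> borel_measurable M" "g \<in> borel_measurable M"
    using assms by (auto simp: sq_int_def)
  show "integrable M (\<lambda>x. (cmod (f x))\<^sup>2 + (cmod (g x))\<^sup>2)"
    using assms by (auto simp: sq_int_def)
  show "(\<lambda>x. f x * cnj (g x)) \<in> borel_measurable M" by measurable
  have "a * b \<le> a\<^sup>2 + b\<^sup>2" if "0 \<le> a" "0 \<le> b" for a b :: real
    using sum_squares_bound[of a b] that mult_nonneg_nonneg[of a b] by linarith
  then show "AE x in M. norm (f x * cnj (g x)) \<le> norm ((cmod (f x))\<^sup>2 + (cmod (g x))\<^sup>2)"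
    by (auto simp: norm_mult)
qed

lemma norm_add_sq_le: "(norm (a + b))\<^sup>2 \<le> 2 * (norm a)\<^sup>2 + 2 * (norm (b :: 'a :: real_normed_vector))\<^sup>2"
proof -
  have "(norm (a + b))\<^sup>2 \<le> (norm a + norm b)\<^sup>2"
    by (intro power_mono norm_triangle_ineq) auto
  also have "\<dots> \<le> 2 * (norm a)\<^sup>2 + 2 * (norm b)\<^sup>2"
    using sum_squares_bound[of "norm a" "norm b"] by (simp add: power2_sum)
  finally show ?thesis .
qed

lemma sq_int_add:
  assumes "sq_int M f" "sq_int M g"
  shows "sq_int M (\<lambda>x. f x + g x)"
  unfolding sq_int_def
proof (intro conjI)
  have [measurable]: "f \<in> borel_measurable M" "g \<in> borel_measurable M"
    using assms by (auto simp: sq_int_def)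
  show "(\<lambda>x. f x + g x) \<in> borel_measurable M" by measurable
  show "integrable M (\<lambda>x. (cmod (f x + g x))\<^sup>2)"
  proof (rule Bochner_Integration.integrable_bound)
    show "integrable M (\<lambda>x. 2 * (cmod (f x))\<^sup>2 + 2 * (cmod (g x))\<^sup>2)"
      using assms by (auto simp: sq_int_def)
    show "AE x in M. norm ((cmod (f x + g x))\<^sup>2) \<le> norm (2 * (cmod (f x))\<^sup>2 + 2 * (cmod (g x))\<^sup>2)"
      using norm_add_sq_le by (auto simp: abs_of_nonneg)
  qed measurable
qed

lemma sq_int_cmult: "sq_int M f \<Longrightarrow> sq_int M (\<lambda>x. c * f x)"
  by (auto simp: sq_int_def norm_mult power_mult_distrib)

lemma sq_int_diff:
  assumes "sq_int M f" "sq_int M g"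
  shows "sq_int M (\<lambda>x. f x - g x)"
  using sq_int_add[OF assms(1) sq_int_cmult[OF assms(2), of "-1"]] by simp

lemma sq_int_sum:
  assumes "finite I" "\<And>i. i \<in> I \<Longrightarrow> sq_int M (f i)"
  shows "sq_int M (\<lambda>x. \<Sum>i\<in>I. f i x)"
  using assms
proof (induction I rule: finite_induct)
  case empty
  then show ?case by (simp add: sq_int_def)
next
  case (insert i I)
  then show ?case using sq_int_add[of M "f i" "\<lambda>x. \<Sum>i\<in>I. f i x"] by auto
qed

lemma sq_int_cong_AE:
  assumes "AE x in M. f x = g x" "sq_int M f" "g \<in> borel_measurable M"
  shows "sq_int M g"
proof -
  have [measurable]: "f \<in> borel_measurable M" using assms by (simp add: sq_int_def)
  note [measurable] = assms(3)
  have "integrable M (\<lambda>x. (cmod (g x))\<^sup>2) \<longleftrightarrow> integrable M (\<lambda>x. (cmod (f x))\<^sup>2)"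
    using assms by (intro integrable_cong_AE) auto
  then show ?thesis using assms by (simp add: sq_int_def)
qed

lemma (in finite_measure) sq_int_bounded:
  assumes "f \<in> borel_measurable M" "\<And>x. x \<in> space M \<Longrightarrow> cmod (f x) \<le> B"
  shows "sq_int M f"
  unfolding sq_int_def
proof (intro conjI assms integrable_const_bound[where B="B\<^sup>2"])
  show "AE x in M. norm ((cmod (f x))\<^sup>2) \<le> B\<^sup>2"
    using assms by (intro AE_I2) (auto intro!: power_mono)
qed (use assms in measurable)

lemma (in finite_measure) sq_int_integrable:
  assumes "sq_int M f"
  shows "integrable M f"
  using sq_int_integrable_mult[OF assms sq_int_bounded[of "\<lambda>_. 1" 1]] by simp

lemma ip_cmult_left: "ip M (\<lambda>x. c * f x) h = c * ip M f h"
  unfolding ip_def by (simp add: mult.assoc)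

lemma ip_diff_left: "sq_int M f \<Longrightarrow> sq_int M g \<Longrightarrow> sq_int M h \<Longrightarrow>
    ip M (\<lambda>x. f x - g x) h = ip M f h - ip M g h"
  unfolding ip_def by (simp add: left_diff_distrib sq_int_integrable_mult)

lemma ip_sum_left:
  assumes "finite I" "\<And>i. i \<in> I \<Longrightarrow> sq_int M (f i)" "sq_int M h"
  shows "ip M (\<lambda>x. \<Sum>i\<in>I. f i x) h = (\<Sum>i\<in>I. ip M (f i) h)"
  unfolding ip_def using assms by (simp add: sum_distrib_right sq_int_integrable_mult)

lemma ip_commute: "ip M g f = cnj (ip M f g)"
  unfolding ip_def by (subst Bochner_Integration.integral_cnj[symmetric]) (simp add: mult.commute)

lemma ip_cmult_right: "ip M f (\<lambda>x. c * h x) = cnj c * ip M f h"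
  by (subst ip_commute) (simp add: ip_cmult_left ip_commute[of M f h])

lemma ip_self: "ip M f f = complex_of_real (nsq M f)"
  unfolding ip_def nsq_def
  by (subst integral_complex_of_real[symmetric])
     (auto simp: complex_norm_square[symmetric] intro!: Bochner_Integration.integral_cong)

lemma ip_cong_AE:
  assumes "AE x in M. f x = f' x" "AE x in M. g x = g' x"
    and "f \<in> borel_measurable M" "f' \<in> borel_measurable M"
        "g \<in> borel_measurable M" "g' \<in> borel_measurable M"
  shows "ip M f g = ip M f' g'"
  unfolding ip_def by (rule integral_cong_AE) (use assms in auto)

lemma nsq_nonneg: "0 \<le> nsq M f"
  unfolding nsq_def by simp

lemma nsq_cmult: "nsq M (\<lambda>x. c * f x) = (cmod c)\<^sup>2 * nsq M f"
  unfolding nsq_def by (simp add: norm_mult power_mult_distrib)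

lemma nsq_diff_commute: "nsq M (\<lambda>x. f x - g x) = nsq M (\<lambda>x. g x - f x)"
  unfolding nsq_def by (simp add: norm_minus_commute)

lemma nsq_diff:
  assumes "sq_int M f" "sq_int M g"
  shows "nsq M (\<lambda>x. f x - g x) = nsq M f - 2 * Re (ip M f g) + nsq M g"
proof -
  have d: "sq_int M (\<lambda>x. f x - g x)" by (rule sq_int_diff) fact+
  have 1: "ip M (\<lambda>x. f x - g x) h = ip M f h - ip M g h" if "sq_int M h" for h
    using assms that by (rule ip_diff_left)
  have "complex_of_real (nsq M (\<lambda>x. f x - g x))
      = cnj (ip M (\<lambda>x. f x - g x) f) - cnj (ip M (\<lambda>x. f x - g x) g)"
    unfolding ip_self[symmetric] by (subst 1[OF d]) (simp only: ip_commute[symmetric])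
  also have "\<dots> = complex_of_real (nsq M f) - (ip M f g + cnj (ip M f g)) + complex_of_real (nsq M g)"
    unfolding 1[OF assms(1)] 1[OF assms(2)] ip_self
    by (simp add: ip_commute[of M g f])
  finally have "complex_of_real (nsq M (\<lambda>x. f x - g x)) =
     complex_of_real (nsq M f - 2 * Re (ip M f g) + nsq M g)"
    by (simp add: complex_add_cnj)
  then show ?thesis using of_real_eq_iff by blast
qed

lemma nsq_add_le:
  assumes "sq_int M f" "sq_int M g"
  shows "nsq M (\<lambda>x. f x + g x) \<le> 2 * nsq M f + 2 * nsq M g"
proof -
  have "nsq M (\<lambda>x. f x + g x) \<le> (\<integral>x. 2 * (cmod (f x))\<^sup>2 + 2 * (cmod (g x))\<^sup>2 \<partial>M)"
    unfolding nsq_def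
    using assms sq_int_add[OF assms] norm_add_sq_le
    by (intro integral_mono) (auto simp: sq_int_def)
  also have "\<dots> = 2 * nsq M f + 2 * nsq M g"
    using assms by (simp add: nsq_def sq_int_def)
  finally show ?thesis .
qed

text \<open>Pythagoras for the projection onto a finite orthonormal family. The exact size of the
  residual matters, not only Bessel's inequality: \<open>fam_wave_estimate\<close> compares it for a
  plane wave and for the transform of that wave.\<close>

lemma nsq_residual:
  fixes \<phi> :: "nat \<Rightarrow> 'a \<Rightarrow> complex"
  assumes f: "sq_int M f" and \<phi>: "\<And>i. i < n \<Longrightarrow> sq_int M (\<phi> i)"
    and on: "\<And>i j. i < n \<Longrightarrow> j < n \<Longrightarrow> ip M (\<phi> i) (\<phi> j) = (if i = j then 1 else 0)"
  shows "nsq M (\<lambda>x. f x - (\<Sum>i<n. ip M f (\<phi> i) * \<phi> i x)) = nsq M f - (\<Sum>i<n. (cmod (ip M f (\<phi> i)))\<^sup>2)"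
    and "j < n \<Longrightarrow> ip M (\<lambda>x. f x - (\<Sum>i<n. ip M f (\<phi> i) * \<phi> i x)) (\<phi> j) = 0"
proof -
  let ?s = "\<lambda>x. \<Sum>i<n. ip M f (\<phi> i) * \<phi> i x"
  have s: "sq_int M ?s" using \<phi> by (intro sq_int_sum sq_int_cmult) auto
  have ip_s: "ip M ?s h = (\<Sum>i<n. ip M f (\<phi> i) * ip M (\<phi> i) h)" if "sq_int M h" for h
    using \<phi> that by (subst ip_sum_left) (auto intro: sq_int_cmult simp: ip_cmult_left)
  have s_phi: "ip M ?s (\<phi> j) = ip M f (\<phi> j)" if "j < n" for j
  proof -
    have "ip M ?s (\<phi> j) = (\<Sum>i<n. if i = j then ip M f (\<phi> j) else 0)"
      unfolding ip_s[OF \<phi>[OF that]] using on that by (intro sum.cong) auto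
    then show ?thesis using that by simp
  qed
  show "j < n \<Longrightarrow> ip M (\<lambda>x. f x - ?s x) (\<phi> j) = 0"
    using f s \<phi> s_phi by (simp add: ip_diff_left)
  have sf: "ip M ?s f = complex_of_real (\<Sum>i<n. (cmod (ip M f (\<phi> i)))\<^sup>2)"
    unfolding ip_s[OF f] by (simp add: complex_norm_square ip_commute[of M _ f] mult.commute del: of_real_power)
  have "ip M ?s ?s = (\<Sum>i<n. ip M f (\<phi> i) * cnj (ip M ?s (\<phi> i)))"
    unfolding ip_s[OF s] by (subst ip_commute) simp
  also have "\<dots> = complex_of_real (\<Sum>i<n. (cmod (ip M f (\<phi> i)))\<^sup>2)"
    by (simp add: s_phi complex_norm_square del: of_real_power)
  finally have ss: "nsq M ?s = (\<Sum>i<n. (cmod (ip M f (\<phi> i)))\<^sup>2)"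
    unfolding ip_self using of_real_eq_iff by blast
  have "Re (ip M f ?s) = Re (ip M ?s f)" by (subst ip_commute) simp
  then show "nsq M (\<lambda>x. f x - ?s x) = nsq M f - (\<Sum>i<n. (cmod (ip M f (\<phi> i)))\<^sup>2)"
    unfolding nsq_diff[OF f s] sf ss by simp
qed

lemma bessel:
  fixes \<phi> :: "nat \<Rightarrow> 'a \<Rightarrow> complex"
  assumes "sq_int M f" "\<And>i. i < n \<Longrightarrow> sq_int M (\<phi> i)"
    and "\<And>i j. i < n \<Longrightarrow> j < n \<Longrightarrow> ip M (\<phi> i) (\<phi> j) = (if i = j then 1 else 0)"
  shows "(\<Sum>i<n. (cmod (ip M f (\<phi> i)))\<^sup>2) \<le> nsq M f"
  using nsq_residual(1)[OF assms] nsq_nonneg[of M "\<lambda>x. f x - (\<Sum>i<n. ip M f (\<phi> i) * \<phi> i x)"] by simp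

text \<open>Bessel's inequality for the single normalised function \<open>g\<close>. In the
  degenerate case \<open>g\<close> vanishes almost everywhere and both sides are zero.\<close>

lemma ip_Cauchy_Schwarz:
  assumes f: "sq_int M f" and g: "sq_int M g"
  shows "(cmod (ip M f g))\<^sup>2 \<le> nsq M f * nsq M g"
proof (cases "nsq M g = 0")
  case True
  have [measurable]: "f \<in> borel_measurable M" "g \<in> borel_measurable M"
    using assms by (auto simp: sq_int_def)
  have "AE x in M. (cmod (g x))\<^sup>2 = 0"
    using True g unfolding nsq_def sq_int_def
    by (subst (asm) integral_nonneg_eq_0_iff_AE) auto
  then have "ip M f g = (\<integral>x. 0 \<partial>M)"
    unfolding ip_def by (intro integral_cong_AE) auto
  then show ?thesis by (simp add: True)
next
  case False
  then have pos: "nsq M g > 0" using nsq_nonneg[of M g] by simp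
  define h where "h = (\<lambda>x. complex_of_real (1 / sqrt (nsq M g)) * g x)"
  have h: "sq_int M h" unfolding h_def by (rule sq_int_cmult) fact
  have hh: "ip M h h = 1"
    unfolding ip_self h_def nsq_cmult using pos by (simp add: norm_divide power_divide)
  have "(\<Sum>i<1::nat. (cmod (ip M f ((\<lambda>_. h) i)))\<^sup>2) \<le> nsq M f"
    by (rule bessel) (use f h hh in auto)
  moreover have "(cmod (ip M f h))\<^sup>2 = (cmod (ip M f g))\<^sup>2 / nsq M g"
    unfolding h_def ip_cmult_right using pos by (simp add: norm_mult norm_divide power_divide)
  ultimately show ?thesis using pos by (simp add: field_simps)
qed

subsection \<open>Continuity of translations\<close>

lemma nn_integral_lborel_shift:
  fixes f :: "'a::euclidean_space \<Rightarrow> ennreal"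
  assumes [measurable]: "f \<in> borel_measurable borel"
  shows "(\<integral>\<^sup>+x. f (x + z) \<partial>lborel) = (\<integral>\<^sup>+x. f x \<partial>lborel)"
  by (subst (2) lborel_distr_plus[of z, symmetric]) (simp add: nn_integral_distr add.commute)

lemma integral_lborel_shift:
  fixes f :: "'a::euclidean_space \<Rightarrow> 'b::{banach, second_countable_topology}"
  assumes [measurable]: "f \<in> borel_measurable borel"
  shows "(\<integral>x. f (x + z) \<partial>lborel) = (\<integral>x. f x \<partial>lborel)"
  by (subst (2) lborel_distr_plus[of z, symmetric]) (simp add: integral_distr add.commute)

lemma integrable_lborel_shift:
  fixes f :: "'a::euclidean_space \<Rightarrow> 'b::{banach, second_countable_topology}"
  assumes "integrable lborel f"
  shows "integrable lborel (\<lambda>x. f (x + z))"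
proof -
  have [measurable]: "f \<in> borel_measurable borel" using assms by auto
  have "integrable (distr lborel borel ((+) z)) f" using assms by (simp add: lborel_distr_plus)
  then show ?thesis by (simp add: integrable_distr_eq add.commute)
qed

text \<open>A point of \<open>A\<close> stays in an open \<open>U\<close> containing
  \<open>A\<close> under small shifts, so dominated convergence handles \<open>U\<close>; outer
  regularity makes \<open>U - A\<close> small.\<close>

lemma indicator_translation_continuous:
  fixes A :: "'a::euclidean_space set"
  assumes A[measurable]: "A \<in> sets borel" and fin: "emeasure lborel A < \<infinity>" and Z: "Z \<longlonglongrightarrow> 0"
  shows "(\<lambda>n. \<integral>x. \<bar>indicator A (x + Z n) - indicator A x\<bar> \<partial>lborel) \<longlonglongrightarrow> (0::real)"
proof -
  let ?I = "indicator :: 'a set \<Rightarrow> 'a \<Rightarrow> real"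
  have iA: "integrable lborel (?I A)" using A fin by (intro integrable_real_indicator) auto
  have iA': "integrable lborel (\<lambda>x. ?I A (x + z))" for z
    using integrable_lborel_shift[OF iA] .
  have bnd: "integrable lborel (\<lambda>x. ?I A x * (1 - ?I B (x + z)))" if [measurable]: "B \<in> sets borel" for z B
    by (rule Bochner_Integration.integrable_bound[OF iA]) (auto split: split_indicator)
  have "\<exists>N. \<forall>n\<ge>N. \<bar>\<integral>x. \<bar>?I A (x + Z n) - ?I A x\<bar> \<partial>lborel\<bar> < e" if e: "e > 0" for e
  proof -
    obtain U where U: "open U" "A \<subseteq> U" "emeasure lborel (U - A) < ennreal (e/4)"
      using outer_regular_lborel[of A "e/4"] A e by auto
    have [measurable]: "U \<in> sets borel" using U by auto
    have iUA: "integrable lborel (?I (U - A))"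
      using U by (intro integrable_real_indicator) (auto intro: less_trans)
    have mUA: "(\<integral>x. ?I (U - A) x \<partial>lborel) < e/4"
    proof -
      have "ennreal (measure lborel (U - A)) < ennreal (e/4)"
        using U(3) emeasure_eq_ennreal_measure[of lborel "U - A"] order.strict_trans[OF U(3) ennreal_less_top]
        by simp
      then show ?thesis using e by (simp add: ennreal_less_iff)
    qed
    have "(\<lambda>n. \<integral>x. ?I A x * (1 - ?I U (x + Z n)) \<partial>lborel) \<longlonglongrightarrow> (\<integral>x. (0::real) \<partial>(lborel :: 'a measure))"
    proof (rule integral_dominated_convergence[OF _ _ iA])
      show "AE x in lborel. (\<lambda>n. ?I A x * (1 - ?I U (x + Z n))) \<longlonglongrightarrow> 0"
      proof (rule AE_I2)
        fix x :: 'a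
        show "(\<lambda>n. ?I A x * (1 - ?I U (x + Z n))) \<longlonglongrightarrow> 0"
        proof (cases "x \<in> A")
          case True
          have "(\<lambda>n. x + Z n) \<longlonglongrightarrow> x + 0" by (intro tendsto_intros Z)
          then have "eventually (\<lambda>n. x + Z n \<in> U) sequentially"
            using U True topological_tendstoD[of "\<lambda>n. x + Z n" x sequentially U] by auto
          then show ?thesis
            by (intro tendsto_eventually) (erule eventually_mono, simp)
        qed simp
      qed
    qed (auto split: split_indicator)
    then have "eventually (\<lambda>n. (\<integral>x. ?I A x * (1 - ?I U (x + Z n)) \<partial>lborel) < e/4) sequentially"
      using e by (intro order_tendstoD) auto
    then obtain N where N: "\<And>n. n \<ge> N \<Longrightarrow> (\<integral>x. ?I A x * (1 - ?I U (x + Z n)) \<partial>lborel) < e/4"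
      by (auto simp: eventually_sequentially)
    show ?thesis
    proof (intro exI[of _ N] allI impI)
      fix n assume n: "n \<ge> N"
      have iU': "integrable lborel (\<lambda>x. ?I (U - A) (x + Z n))"
        using integrable_lborel_shift[OF iUA] .
      \<comment> \<open>For indicator values \<open>a\<close>, \<open>b\<close> the distance is
        \<open>a - b + 2 * (b * (1 - a))\<close>, and \<open>a - b\<close> integrates to zero by
        translation invariance. The remaining factor 2 is why both errors were taken below
        \<open>e/4\<close>.\<close>
      have "(\<integral>x. \<bar>?I A (x + Z n) - ?I A x\<bar> \<partial>lborel)
          = (\<integral>x. ?I A (x + Z n) - ?I A x + 2 * (?I A x * (1 - ?I A (x + Z n))) \<partial>lborel)"
        by (intro Bochner_Integration.integral_cong refl) (auto split: split_indicator)
      also have "\<dots> = 2 * (\<integral>x. ?I A x * (1 - ?I A (x + Z n)) \<partial>lborel)"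
        using iA iA' bnd[OF A] integral_lborel_shift[of "?I A"] by simp
      also have "(\<integral>x. ?I A x * (1 - ?I A (x + Z n)) \<partial>lborel)
          \<le> (\<integral>x. ?I A x * (1 - ?I U (x + Z n)) + ?I (U - A) (x + Z n) \<partial>lborel)"
        using bnd iU' U(2) by (intro integral_mono) (auto split: split_indicator)
      also have "\<dots> = (\<integral>x. ?I A x * (1 - ?I U (x + Z n)) \<partial>lborel) + (\<integral>x. ?I (U - A) x \<partial>lborel)"
        using bnd iU' integral_lborel_shift[of "?I (U - A)"] by simp
      also have "\<dots> < e/4 + e/4" using N[OF n] mUA by linarith
      finally have "(\<integral>x. \<bar>?I A (x + Z n) - ?I A x\<bar> \<partial>lborel) < e" by simp
      then show "\<bar>\<integral>x. \<bar>?I A (x + Z n) - ?I A x\<bar> \<partial>lborel\<bar> < e"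
        by simp
    qed
  qed
  then show ?thesis by (simp add: LIMSEQ_iff)
qed

text \<open>The property passes from indicators to sums by the triangle inequality, and to limits
  because a shift leaves the L1 distance to an approximant unchanged.\<close>

lemma translation_continuous_L1:
  fixes f :: "'a::euclidean_space \<Rightarrow> 'b::{banach, second_countable_topology}"
  assumes "integrable lborel f" and Z: "Z \<longlonglongrightarrow> 0"
  shows "(\<lambda>n. \<integral>x. norm (f (x + Z n) - f x) \<partial>lborel) \<longlonglongrightarrow> 0"
  using assms(1)
proof (induction rule: integrable_induct)
  case (base A c)
  have "norm (indicator A (x + z) *\<^sub>R c - indicator A x *\<^sub>R c) = \<bar>indicator A (x + z) - indicator A x\<bar> * norm c"
    for x z by (simp add: scaleR_left_diff_distrib[symmetric])
  moreover have "(\<lambda>n. (\<integral>x. \<bar>indicator A (x + Z n) - indicator A x\<bar> \<partial>lborel) * norm c) \<longlonglongrightarrow> 0 * norm c"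
    using base Z by (intro tendsto_mult tendsto_const indicator_translation_continuous) auto
  ultimately show ?case by simp
next
  case (add f g)
  show ?case
  proof (rule tendsto_sandwich[OF _ _ tendsto_const])
    show "\<forall>\<^sub>F n in sequentially. (\<integral>x. norm (f (x + Z n) + g (x + Z n) - (f x + g x)) \<partial>lborel)
       \<le> (\<integral>x. norm (f (x + Z n) - f x) \<partial>lborel) + (\<integral>x. norm (g (x + Z n) - g x) \<partial>lborel)"
    proof (rule always_eventually, rule allI)
      fix n
      note i = integrable_lborel_shift[OF add.hyps(1), of "Z n"] integrable_lborel_shift[OF add.hyps(2), of "Z n"]
      have "(\<integral>x. norm (f (x + Z n) + g (x + Z n) - (f x + g x)) \<partial>lborel)
        \<le> (\<integral>x. norm (f (x + Z n) - f x) + norm (g (x + Z n) - g x) \<partial>lborel)"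
        using add i by (intro integral_mono) (auto simp: norm_diff_triangle_ineq)
      then show "(\<integral>x. norm (f (x + Z n) + g (x + Z n) - (f x + g x)) \<partial>lborel)
       \<le> (\<integral>x. norm (f (x + Z n) - f x) \<partial>lborel) + (\<integral>x. norm (g (x + Z n) - g x) \<partial>lborel)"
        using add i by simp
    qed
    show "(\<lambda>n. (\<integral>x. norm (f (x + Z n) - f x) \<partial>lborel) + (\<integral>x. norm (g (x + Z n) - g x) \<partial>lborel)) \<longlonglongrightarrow> 0"
      using tendsto_add[OF add.IH] by simp
  qed auto
next
  case (lim f s)
  have [measurable]: "f \<in> borel_measurable borel" "\<And>i. s i \<in> borel_measurable borel"
    using lim by auto
  have "(\<lambda>i. \<integral>x. norm (s i x - f x) \<partial>lborel) \<longlonglongrightarrow> (\<integral>x. (0::real) \<partial>(lborel :: 'a measure))"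
  proof (rule integral_dominated_convergence)
    \<comment> \<open>The approximants given by the induction rule satisfy
      \<open>norm (s i x) \<le> 2 * norm (f x)\<close>.\<close>
    show "integrable lborel (\<lambda>x. 3 * norm (f x))" using lim by simp
    show "AE x in lborel. (\<lambda>i. norm (s i x - f x)) \<longlonglongrightarrow> 0"
      using lim.hyps(2) by (auto intro!: AE_I2 tendsto_norm_zero simp: LIM_zero)
    show "AE x in lborel. norm (norm (s i x - f x)) \<le> 3 * norm (f x)" for i
    proof (intro AE_I2)
      fix x
      show "norm (norm (s i x - f x)) \<le> 3 * norm (f x)"
        using lim.hyps(3)[of x i] norm_triangle_ineq4[of "s i x" "f x"] by simp
    qed
  qed auto
  then have conv: "(\<lambda>i. \<integral>x. norm (s i x - f x) \<partial>lborel) \<longlonglongrightarrow> 0" by simp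
  have key: "(\<integral>x. norm (f (x + z) - f x) \<partial>lborel)
      \<le> (\<integral>x. norm (s i (x + z) - s i x) \<partial>lborel) + 2 * (\<integral>x. norm (s i x - f x) \<partial>lborel)" for i z
  proof -
    note i = integrable_lborel_shift[OF lim.hyps(4), of z] integrable_lborel_shift[OF lim.hyps(1)[of i], of z]
    have "(\<integral>x. norm (f (x + z) - f x) \<partial>lborel)
        \<le> (\<integral>x. norm (s i (x + z) - s i x) + norm (s i (x + z) - f (x + z)) + norm (s i x - f x) \<partial>lborel)"
    proof (rule integral_mono)
      fix x
      have "f (x + z) - f x = (s i (x + z) - s i x) - (s i (x + z) - f (x + z)) + (s i x - f x)" by simp
      then show "norm (f (x + z) - f x)
         \<le> norm (s i (x + z) - s i x) + norm (s i (x + z) - f (x + z)) + norm (s i x - f x)"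
        by (metis norm_triangle_le norm_triangle_le_diff order_refl add_mono)
    qed (use lim i in auto)
    also have "\<dots> = (\<integral>x. norm (s i (x + z) - s i x) \<partial>lborel)
        + (\<integral>x. norm (s i (x + z) - f (x + z)) \<partial>lborel) + (\<integral>x. norm (s i x - f x) \<partial>lborel)"
      using lim i by simp
    also have "(\<integral>x. norm (s i (x + z) - f (x + z)) \<partial>lborel) = (\<integral>x. norm (s i x - f x) \<partial>lborel)"
      by (rule integral_lborel_shift[of "\<lambda>x. norm (s i x - f x)"]) auto
    finally show ?thesis by simp
  qed
  show ?case
  proof (rule LIMSEQ_I)
    fix e :: real assume e: "0 < e"
    obtain i where i: "(\<integral>x. norm (s i x - f x) \<partial>lborel) < e/4"
      using order_tendstoD(2)[OF conv, of "e/4"] e by (auto simp: eventually_sequentially)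
    obtain N where N: "\<And>n. n \<ge> N \<Longrightarrow> (\<integral>x. norm (s i (x + Z n) - s i x) \<partial>lborel) < e/2"
      using order_tendstoD(2)[OF lim.IH[of i], of "e/2"] e by (auto simp: eventually_sequentially)
    show "\<exists>no. \<forall>n\<ge>no. norm ((\<integral>x. norm (f (x + Z n) - f x) \<partial>lborel) - 0) < e"
    proof (intro exI[of _ N] allI impI)
      fix n assume "n \<ge> N"
      then show "norm ((\<integral>x. norm (f (x + Z n) - f x) \<partial>lborel) - 0) < e"
        using key[of "Z n" i] i N[of n] by simp
    qed
  qed
qed

text \<open>The map \<open>w \<mapsto> |w| w\<close> sends L2 to L1, and its inverse is Hoelder continuous of exponent 1/2.\<close>

lemma norm_diff_sq_le_diff_norm_mult:
  fixes a b :: "'a::real_inner"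
  shows "(norm (a - b))\<^sup>2 \<le> 3 * norm (norm a *\<^sub>R a - norm b *\<^sub>R b)"
proof (rule power2_le_imp_le)
  define r s p where "r = norm a" and "s = norm b" and "p = a \<bullet> b"
  have rs: "r \<ge> 0" "s \<ge> 0" by (auto simp: r_def s_def)
  have p: "\<bar>p\<bar> \<le> r * s" unfolding r_def s_def p_def by (rule Cauchy_Schwarz_ineq2)
  have aa: "a \<bullet> a = r\<^sup>2" "b \<bullet> b = s\<^sup>2" by (auto simp: r_def s_def power2_norm_eq_inner)
  have 1: "(norm (a - b))\<^sup>2 = (r - s)\<^sup>2 + 2 * (r * s - p)"
    unfolding power2_norm_eq_inner
    by (simp add: inner_diff_left inner_diff_right aa inner_commute[of b a] p_def[symmetric] power2_diff)
  have 2: "(norm (norm a *\<^sub>R a - norm b *\<^sub>R b))\<^sup>2 = (r\<^sup>2 - s\<^sup>2)\<^sup>2 + 2 * (r * s) * (r * s - p)"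
    unfolding power2_norm_eq_inner r_def[symmetric] s_def[symmetric]
    by (simp add: inner_diff_left inner_diff_right aa inner_commute[of b a] p_def[symmetric])
       (simp add: algebra_simps power2_eq_square)
  \<comment> \<open>Both squared norms are now expressed through \<open>r\<close>, \<open>s\<close>
    and \<open>k\<close>, where \<open>0 \<le> k \<le> 2 * (r * s)\<close> by Cauchy-Schwarz. Hence
    \<open>k * k\<close> is at most \<open>2 * (r * s) * k\<close>, and the coefficients 2 and 16
    that arise fit under 9 and 18, the square of the constant 3.\<close>
  define k where "k = r * s - p"
  have k: "0 \<le> k" "k \<le> 2 * (r * s)" using p by (auto simp: k_def)
  have "((r - s)\<^sup>2 + 2 * k)\<^sup>2 \<le> 2 * ((r - s)\<^sup>2)\<^sup>2 + 8 * (k * k)"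
    using norm_add_sq_le[of "(r-s)\<^sup>2" "2 * k"] by (simp add: power2_eq_square)
  also have "k * k \<le> 2 * (r * s) * k" using k by (intro mult_right_mono) auto
  also have "((r - s)\<^sup>2)\<^sup>2 \<le> (r\<^sup>2 - s\<^sup>2)\<^sup>2"
  proof -
    have "(r - s)\<^sup>2 \<le> (r + s)\<^sup>2" using rs mult_nonneg_nonneg[OF rs] by (simp add: power2_diff power2_sum)
    then have "(r - s)\<^sup>2 * (r - s)\<^sup>2 \<le> (r - s)\<^sup>2 * (r + s)\<^sup>2" by (intro mult_left_mono) auto
    also have "\<dots> = (r\<^sup>2 - s\<^sup>2)\<^sup>2" by (simp add: power2_eq_square algebra_simps)
    finally show ?thesis by (simp add: power2_eq_square)
  qed
  finally have "((r - s)\<^sup>2 + 2 * k)\<^sup>2 \<le> 2 * (r\<^sup>2 - s\<^sup>2)\<^sup>2 + 8 * (2 * (r * s) * k)" by simp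
  also have "\<dots> \<le> 9 * ((r\<^sup>2 - s\<^sup>2)\<^sup>2 + 2 * (r * s) * k)"
    using mult_nonneg_nonneg[of "r * s" k] k rs by simp
  finally show "((norm (a - b))\<^sup>2)\<^sup>2 \<le> (3 * norm (norm a *\<^sub>R a - norm b *\<^sub>R b))\<^sup>2"
    unfolding 1 power_mult_distrib 2 k_def by simp
qed simp

lemma sq_int_lborel_shift:
  fixes f :: "'a::euclidean_space \<Rightarrow> complex"
  assumes "sq_int lborel f"
  shows "sq_int lborel (\<lambda>x. f (x + z))"
proof -
  have [measurable]: "f \<in> borel_measurable borel" using assms by (auto simp: sq_int_def)
  show ?thesis using assms integrable_lborel_shift[of "\<lambda>x. (cmod (f x))\<^sup>2" z] by (auto simp: sq_int_def)
qed

lemma nsq_lborel_shift: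
  fixes f :: "'a::euclidean_space \<Rightarrow> complex"
  assumes [measurable]: "f \<in> borel_measurable borel"
  shows "nsq lborel (\<lambda>x. f (x + z)) = nsq lborel f"
  unfolding nsq_def by (rule integral_lborel_shift[of "\<lambda>x. (cmod (f x))\<^sup>2"]) auto

text \<open>Reduced to the L1 case for \<open>cmod (f x) *\<^sub>R f x\<close>, so that no second
  approximation argument in L2 is required.\<close>

lemma translation_continuous_L2:
  fixes f :: "'a::euclidean_space \<Rightarrow> complex"
  assumes f: "sq_int lborel f" and Z: "Z \<longlonglongrightarrow> 0"
  shows "(\<lambda>n. nsq lborel (\<lambda>x. f (x + Z n) - f x)) \<longlonglongrightarrow> 0"
proof -
  have [measurable]: "f \<in> borel_measurable borel" using f by (auto simp: sq_int_def)
  define g where "g x = cmod (f x) *\<^sub>R f x" for x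
  have g: "integrable lborel g"
  proof -
    have "integrable lborel (\<lambda>x. norm (g x))"
      using f by (simp add: g_def sq_int_def power2_eq_square)
    then show ?thesis by (subst (asm) integrable_norm_iff) (auto simp: g_def[abs_def])
  qed
  show ?thesis
  proof (rule tendsto_sandwich[OF _ _ tendsto_const])
    show "(\<lambda>n. 3 * (\<integral>x. norm (g (x + Z n) - g x) \<partial>lborel)) \<longlonglongrightarrow> 0"
      using tendsto_mult_left[OF translation_continuous_L1[OF g Z], of 3] by simp
    have "nsq lborel (\<lambda>x. f (x + z) - f x) \<le> (\<integral>x. 3 * norm (g (x + z) - g x) \<partial>lborel)" for z
      unfolding nsq_def
    proof (rule integral_mono)
      show "integrable lborel (\<lambda>x. (cmod (f (x + z) - f x))\<^sup>2)"
        using sq_int_diff[OF sq_int_lborel_shift[OF f, of z] f] by (simp add: sq_int_def)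
      show "integrable lborel (\<lambda>x. 3 * norm (g (x + z) - g x))"
        using g integrable_lborel_shift[OF g, of z] by auto
    qed (use norm_diff_sq_le_diff_norm_mult in \<open>auto simp: g_def\<close>)
    then show "\<forall>\<^sub>F n in sequentially. nsq lborel (\<lambda>x. f (x + Z n) - f x)
        \<le> 3 * (\<integral>x. norm (g (x + Z n) - g x) \<partial>lborel)" by simp
  qed (simp add: nsq_nonneg)
qed

subsection \<open>Plancherel's identity\<close>

text \<open>The cut-off is carried by the measure: over \<open>lebesgue_on P\<close> this is the
  transform of the restriction to \<open>P\<close>, and the inverse transform is obtained by
  evaluating at \<open>- x\<close>.\<close>

definition fourier :: "r2 measure \<Rightarrow> (r2 \<Rightarrow> complex) \<Rightarrow> r2 \<Rightarrow> complex" where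
  "fourier M f u = (\<integral>x. f x * cis (- (x \<bullet> u)) \<partial>M)"

abbreviation ft :: "(r2 \<Rightarrow> complex) \<Rightarrow> r2 \<Rightarrow> complex" where
  "ft \<equiv> fourier lborel"

lemma borel_measurable_cis [measurable (raw)]:
  assumes "f \<in> borel_measurable M"
  shows "(\<lambda>x. cis (f x)) \<in> borel_measurable M"
  by (rule borel_measurable_continuous_on[OF _ assms]) (intro continuous_intros)

lemma borel_measurable_ft [measurable]:
  assumes [measurable]: "f \<in> borel_measurable borel"
  shows "ft f \<in> borel_measurable borel"
  unfolding fourier_def[abs_def] by measurable

lemma norm_ft_le: "cmod (ft f u) \<le> (\<integral>x. cmod (f x) \<partial>lborel)"
  unfolding fourier_def using integral_norm_bound[of lborel "\<lambda>x. f x * cis (- (x \<bullet> u))"]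
  by (simp add: norm_mult)

section \<open>Rescaling, and the Gaussian as a summability kernel\<close>

lemma integral_lborel_scaleR:
  fixes f :: "'a::euclidean_space \<Rightarrow> 'b::{banach, second_countable_topology}"
  assumes [measurable]: "f \<in> borel_measurable borel" and c: "c > 0"
  shows "(\<integral>x. f x \<partial>lborel) = c ^ DIM('a) *\<^sub>R (\<integral>x. f (c *\<^sub>R x) \<partial>lborel)"
  by (subst lborel_affine[of c 0]) (use c in \<open>simp_all add: integral_density integral_distr\<close>)

lemma integrable_lborel_scaleR:
  fixes f :: "'a::euclidean_space \<Rightarrow> 'b::{banach, second_countable_topology}"
  assumes f: "integrable lborel f" and c: "c > 0"
  shows "integrable lborel (\<lambda>x. f (c *\<^sub>R x))"
proof -
  have [measurable]: "f \<in> borel_measurable borel" using f by auto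
  have "integrable (density (distr lborel borel (\<lambda>x. 0 + c *\<^sub>R x)) (\<lambda>_. \<bar>c\<bar> ^ DIM('a))) f"
    using f c by (subst lborel_affine[of c 0, symmetric]) auto
  then have "integrable lborel (\<lambda>x. c ^ DIM('a) *\<^sub>R f (c *\<^sub>R x))"
    using c by (simp add: integrable_density integrable_distr_eq)
  from integrable_scaleR_right[OF this, of "inverse (c ^ DIM('a))"] show ?thesis using c by simp
qed

definition gauss :: "r2 \<Rightarrow> real" where
  "gauss u = exp (- (norm u)\<^sup>2 / 2)"

lemma gauss_measurable [measurable]: "gauss \<in> borel_measurable borel"
  unfolding gauss_def[abs_def] by measurable

lemma gauss_Pair: "gauss (x, y) = 2 * pi * (std_normal_density x * std_normal_density y)"
  unfolding gauss_def std_normal_density_def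
  by (simp add: norm_Pair exp_add[symmetric] real_sqrt_mult[symmetric] add_divide_distrib field_simps)

lemma integrable_gauss: "integrable lborel gauss"
proof -
  have "integrable (lborel \<Otimes>\<^sub>M lborel) (\<lambda>(x, y). std_normal_density x * std_normal_density y)"
    by (rule lborel_pair.Fubini_integrable) (auto simp: abs_mult)
  then show ?thesis
    unfolding lborel_prod by (subst Bochner_Integration.integrable_cong[OF refl,
      where g="\<lambda>z. 2 * pi * (case z of (x, y) \<Rightarrow> std_normal_density x * std_normal_density y)"])
      (auto simp: gauss_Pair)
qed

text \<open>The Gaussian factors into two standard normal densities, so Fubini reduces the claim to
  the characteristic function of the normal distribution, evaluated at \<open>- a\<close> and
  \<open>- b\<close>.\<close>

lemma ft_gauss: "ft (\<lambda>u. complex_of_real (gauss u)) z = complex_of_real (2 * pi * gauss z)"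
proof -
  obtain a b where z: "z = (a, b)" by (cases z)
  have char1: "(\<integral>x. complex_of_real (std_normal_density x) * cis (- (x * t)) \<partial>lborel) = complex_of_real (exp (- (t\<^sup>2) / 2))" for t
  proof -
    have "(\<integral>x. complex_of_real (std_normal_density x) * cis (- (x * t)) \<partial>lborel) = char std_normal_distribution (- t)"
      unfolding char_def by (subst integral_density) (auto simp: cis_conv_exp scaleR_conv_of_real mult.commute)
    then show ?thesis by (simp add: char_std_normal_distribution)
  qed
  let ?k = "\<lambda>w. complex_of_real (gauss w) * cis (- (w \<bullet> (a, b)))"
  have "?k \<in> borel_measurable borel" by measurable
  then have i: "integrable (lborel \<Otimes>\<^sub>M lborel) ?k"
    unfolding lborel_prod
    by (intro Bochner_Integration.integrable_bound[OF integrable_gauss]) (auto simp: norm_mult)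
  have "ft (\<lambda>u. complex_of_real (gauss u)) z = integral\<^sup>L (lborel \<Otimes>\<^sub>M lborel) ?k"
    unfolding fourier_def z lborel_prod ..
  also have "\<dots> = (\<integral>x. \<integral>y. ?k (x, y) \<partial>lborel \<partial>lborel)"
    using lborel_pair.integral_fst'[OF i] by simp
  also have "\<dots> = (\<integral>x. \<integral>y. (complex_of_real (2 * pi) * (complex_of_real (std_normal_density x) * cis (- (x * a)))) *
       (complex_of_real (std_normal_density y) * cis (- (y * b))) \<partial>lborel \<partial>lborel)"
    by (intro Bochner_Integration.integral_cong refl) (simp add: gauss_Pair cis_mult)
  also have "\<dots> = complex_of_real (2 * pi * gauss z)"
    by (simp add: char1 z gauss_def norm_Pair add_divide_distrib exp_add[symmetric] diff_divide_distrib
       flip: of_real_mult)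
  finally show ?thesis .
qed

lemma integral_gauss: "(\<integral>u. gauss u \<partial>lborel) = 2 * pi"
proof -
  have "complex_of_real (\<integral>u. gauss u \<partial>lborel) = complex_of_real (2 * pi)"
    using ft_gauss[of 0] by (simp add: fourier_def gauss_def[of 0])
  then show ?thesis using of_real_eq_iff by blast
qed

lemma ft_gauss_scaled:
  assumes "n > 0"
  shows "ft (\<lambda>u. complex_of_real (gauss ((1 / n) *\<^sub>R u))) z = complex_of_real (n\<^sup>2 * (2 * pi * gauss (n *\<^sub>R z)))"
  unfolding fourier_def
  by (subst integral_lborel_scaleR[of _ n]) (use assms ft_gauss[of "n *\<^sub>R z"] in
     \<open>auto simp: fourier_def scaleR_conv_of_real power2_eq_square\<close>)

text \<open>Multiplication formula: both sides are one double integral, whose kernel is symmetric in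
  \<open>x\<close> and \<open>u\<close>.\<close>

lemma integral_ft_mult:
  assumes f: "integrable lborel f" and g: "integrable lborel g"
  shows "(\<integral>u. ft f u * g u \<partial>lborel) = (\<integral>x. f x * ft g x \<partial>lborel)"
proof -
  have [measurable]: "f \<in> borel_measurable borel" "g \<in> borel_measurable borel" using f g by auto
  have i: "integrable (lborel \<Otimes>\<^sub>M lborel) (\<lambda>(u, x). f x * cis (- (x \<bullet> u)) * g u)"
  proof (rule lborel_pair.Fubini_integrable)
    have "integrable lborel (\<lambda>x. f x * cis (- (x \<bullet> u)))" for u
      by (rule Bochner_Integration.integrable_bound[OF f]) (auto simp: norm_mult)
    then show "AE u in lborel. integrable lborel (\<lambda>x. case (u, x) of (u, x) \<Rightarrow> f x * cis (- (x \<bullet> u)) * g u)"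
      by simp
  qed (use f g in \<open>auto simp: norm_mult\<close>)
  have "(\<integral>u. ft f u * g u \<partial>lborel) = (\<integral>u. \<integral>x. f x * cis (- (x \<bullet> u)) * g u \<partial>lborel \<partial>lborel)"
    unfolding fourier_def by simp
  also have "\<dots> = (\<integral>x. \<integral>u. f x * cis (- (x \<bullet> u)) * g u \<partial>lborel \<partial>lborel)"
    using lborel_pair.Fubini_integral[OF i] by simp
  also have "\<dots> = (\<integral>x. f x * ft g x \<partial>lborel)"
    unfolding fourier_def by (simp add: mult_ac inner_commute flip: integral_mult_right_zero)
  finally show ?thesis .
qed

text \<open>The autocorrelation of \<open>f\<close>. Its transform is
  \<open>(cmod (ft f u))\<^sup>2\<close> and its value at 0 is the squared norm, so Plancherel's
  identity is Fourier inversion for it at the origin.\<close>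

definition autocorr :: "(r2 \<Rightarrow> complex) \<Rightarrow> r2 \<Rightarrow> complex" where
  "autocorr f z = ip lborel (\<lambda>y. f (y + z)) f"

lemma borel_measurable_autocorr [measurable]:
  assumes [measurable]: "f \<in> borel_measurable borel"
  shows "autocorr f \<in> borel_measurable borel"
  unfolding autocorr_def[abs_def] ip_def by measurable

text \<open>Translation invariance makes the double integral absolutely convergent; writing the
  character at \<open>z\<close> through \<open>z + y\<close> and \<open>y\<close> then separates it
  into \<open>ft f u\<close> and its conjugate.\<close>

lemma
  assumes f: "integrable lborel f"
  shows integrable_autocorr: "integrable lborel (autocorr f)"
    and ft_autocorr: "ft (autocorr f) u = complex_of_real ((cmod (ft f u))\<^sup>2)"
proof -
  have [measurable]: "f \<in> borel_measurable borel" using f by auto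
  have i: "integrable (lborel \<Otimes>\<^sub>M lborel) (\<lambda>(y, z). f (y + z) * cnj (f y) * cis (- (z \<bullet> u)))" for u
  proof (rule lborel_pair.Fubini_integrable)
    have sh: "(\<integral>z. cmod (f (y + z)) \<partial>lborel) = (\<integral>z. cmod (f z) \<partial>lborel)" for y
      using integral_lborel_shift[of "\<lambda>x. cmod (f x)" y] by (simp add: add.commute)
    show "integrable lborel (\<lambda>y. \<integral>z. norm (case (y, z) of (y, z) \<Rightarrow> f (y + z) * cnj (f y) * cis (- (z \<bullet> u))) \<partial>lborel)"
      using f by (simp add: norm_mult sh)
    have "integrable lborel (\<lambda>z. f (y + z) * cnj (f y) * cis (- (z \<bullet> u)))" for y
      by (rule Bochner_Integration.integrable_bound[where f="\<lambda>z. f (z + y) * cnj (f y)"])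
         (use integrable_lborel_shift[OF f, of y] in \<open>auto simp: norm_mult add.commute\<close>)
    then show "AE y in lborel. integrable lborel (\<lambda>z. case (y, z) of (y, z) \<Rightarrow> f (y + z) * cnj (f y) * cis (- (z \<bullet> u)))"
      by simp
  qed measurable
  show "integrable lborel (autocorr f)"
    using lborel_pair.integrable_snd[OF i[of 0]] by (simp add: autocorr_def[abs_def] ip_def)
  have "ft (autocorr f) u = (\<integral>z. \<integral>y. f (y + z) * cnj (f y) * cis (- (z \<bullet> u)) \<partial>lborel \<partial>lborel)"
    unfolding fourier_def autocorr_def ip_def by simp
  also have "\<dots> = (\<integral>y. \<integral>z. f (y + z) * cnj (f y) * cis (- (z \<bullet> u)) \<partial>lborel \<partial>lborel)"
    using lborel_pair.Fubini_integral[OF i] by simp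
  also have "\<dots> = (\<integral>y. cnj (f y * cis (- (y \<bullet> u))) * ft f u \<partial>lborel)"
  proof (rule Bochner_Integration.integral_cong[OF refl])
    fix y
    have "(\<integral>z. f (y + z) * cnj (f y) * cis (- (z \<bullet> u)) \<partial>lborel)
        = (\<integral>z. cnj (f y * cis (- (y \<bullet> u))) * (f (z + y) * cis (- ((z + y) \<bullet> u))) \<partial>lborel)"
    proof (rule Bochner_Integration.integral_cong[OF refl])
      fix z
      have "cis (- (z \<bullet> u)) = cis (y \<bullet> u) * cis (- ((z + y) \<bullet> u))"
        by (simp add: cis_mult inner_add_left)
      then show "f (y + z) * cnj (f y) * cis (- (z \<bullet> u))
        = cnj (f y * cis (- (y \<bullet> u))) * (f (z + y) * cis (- ((z + y) \<bullet> u)))"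
        by (simp add: cis_cnj add.commute)
    qed
    also have "\<dots> = cnj (f y * cis (- (y \<bullet> u))) * (\<integral>z. f (z + y) * cis (- ((z + y) \<bullet> u)) \<partial>lborel)"
      by simp
    also have "(\<integral>z. f (z + y) * cis (- ((z + y) \<bullet> u)) \<partial>lborel) = ft f u"
      unfolding fourier_def by (rule integral_lborel_shift[of "\<lambda>z. f z * cis (- (z \<bullet> u))"]) measurable
    finally show "(\<integral>z. f (y + z) * cnj (f y) * cis (- (z \<bullet> u)) \<partial>lborel) = cnj (f y * cis (- (y \<bullet> u))) * ft f u" .
  qed
  also have "\<dots> = cnj (ft f u) * ft f u"
    unfolding fourier_def[of _ f] by (subst Bochner_Integration.integral_cnj[symmetric]) simp
  also have "\<dots> = complex_of_real ((cmod (ft f u))\<^sup>2)"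
    by (simp only: complex_norm_square mult.commute)
  finally show "ft (autocorr f) u = complex_of_real ((cmod (ft f u))\<^sup>2)" .
qed

lemma autocorr_0: "autocorr f 0 = complex_of_real (nsq lborel f)"
  by (simp add: autocorr_def ip_self)

lemma autocorr_tendsto:
  assumes f: "sq_int lborel f" and Z: "Z \<longlonglongrightarrow> 0"
  shows "(\<lambda>n. autocorr f (Z n)) \<longlonglongrightarrow> autocorr f 0"
proof (rule LIM_zero_cancel, rule tendsto_norm_zero_cancel)
  have "(\<lambda>n. sqrt (nsq lborel (\<lambda>x. f (x + Z n) - f x) * nsq lborel f)) \<longlonglongrightarrow> sqrt (0 * nsq lborel f)"
    by (intro tendsto_intros translation_continuous_L2 f Z)
  then have lim: "(\<lambda>n. sqrt (nsq lborel (\<lambda>x. f (x + Z n) - f x) * nsq lborel f)) \<longlonglongrightarrow> 0" by simp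
  have "norm (autocorr f z - autocorr f 0) \<le> sqrt (nsq lborel (\<lambda>x. f (x + z) - f x) * nsq lborel f)" for z
  proof -
    note fz = sq_int_lborel_shift[OF f, of z]
    have "autocorr f z - autocorr f 0 = ip lborel (\<lambda>x. f (x + z) - f x) f"
      unfolding autocorr_def by (simp add: ip_diff_left[OF fz f f])
    then show ?thesis
      using ip_Cauchy_Schwarz[OF sq_int_diff[OF fz f] f] by (simp add: real_le_rsqrt)
  qed
  then show "(\<lambda>n. norm (autocorr f (Z n) - autocorr f 0)) \<longlonglongrightarrow> 0"
    by (intro tendsto_sandwich[OF _ _ tendsto_const lim]) auto
qed

lemma norm_autocorr_le:
  assumes f: "sq_int lborel f"
  shows "cmod (autocorr f z) \<le> nsq lborel f"
proof -
  have [measurable]: "f \<in> borel_measurable borel" using f by (auto simp: sq_int_def)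
  have "(cmod (autocorr f z))\<^sup>2 \<le> (nsq lborel f)\<^sup>2"
    using ip_Cauchy_Schwarz[OF sq_int_lborel_shift[OF f, of z] f]
    by (simp add: nsq_lborel_shift autocorr_def power2_eq_square)
  then show ?thesis by (rule power2_le_imp_le) (rule nsq_nonneg)
qed

text \<open>A Gaussian factor makes the left side converge. The multiplication formula moves it onto
  \<open>autocorr f\<close>, where it acts as an approximate identity at 0. One factor
  \<open>2 * pi\<close> comes from \<open>ft_gauss\<close>, the other from
  \<open>integral_gauss\<close>. The nonnegative integral on the left makes square integrability of
  \<open>ft f\<close> part of the conclusion.\<close>

theorem plancherel_lborel:
  assumes f1: "integrable lborel f" and f2: "sq_int lborel f"
  shows "(\<integral>\<^sup>+u. ennreal ((cmod (ft f u))\<^sup>2) \<partial>lborel) = ennreal ((2 * pi)\<^sup>2 * nsq lborel f)"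
proof -
  have [measurable]: "f \<in> borel_measurable borel" using f1 by auto
  define I where "I n = (\<integral>u. (cmod (ft f u))\<^sup>2 * gauss ((1 / real (Suc n)) *\<^sub>R u) \<partial>lborel)" for n
  have ig: "integrable lborel (\<lambda>u. gauss ((1 / real (Suc n)) *\<^sub>R u))" for n
    by (rule integrable_lborel_scaleR[OF integrable_gauss]) simp
  have ii: "integrable lborel (\<lambda>u. (cmod (ft f u))\<^sup>2 * gauss ((1 / real (Suc n)) *\<^sub>R u))" for n
  proof (rule Bochner_Integration.integrable_bound)
    show "integrable lborel (\<lambda>u. (\<integral>x. cmod (f x) \<partial>lborel)\<^sup>2 * gauss ((1 / real (Suc n)) *\<^sub>R u))"
      by (intro integrable_mult_right ig)
    show "AE u in lborel. norm ((cmod (ft f u))\<^sup>2 * gauss ((1 / real (Suc n)) *\<^sub>R u))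
        \<le> norm ((\<integral>x. cmod (f x) \<partial>lborel)\<^sup>2 * gauss ((1 / real (Suc n)) *\<^sub>R u))"
      using norm_ft_le[of f] by (intro AE_I2) (auto simp: abs_mult gauss_def intro!: power_mono)
  qed measurable
  have I_eq: "complex_of_real (I n)
      = (\<integral>z. autocorr f ((1 / real (Suc n)) *\<^sub>R z) * complex_of_real (2 * pi * gauss z) \<partial>lborel)" for n
  proof -
    let ?c = "real (Suc n)"
    have "complex_of_real (I n)
        = (\<integral>u. ft (autocorr f) u * complex_of_real (gauss ((1 / ?c) *\<^sub>R u)) \<partial>lborel)"
      unfolding I_def ft_autocorr[OF f1] by (subst integral_complex_of_real[symmetric]) simp
    also have "\<dots> = (\<integral>z. autocorr f z * complex_of_real (?c\<^sup>2 * (2 * pi * gauss (?c *\<^sub>R z))) \<partial>lborel)"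
      using ig[of n] by (subst integral_ft_mult[OF integrable_autocorr[OF f1]])
        (simp_all only: integrable_of_real ft_gauss_scaled of_nat_0_less_iff zero_less_Suc)
    \<comment> \<open>The substitution moves the scaling from the Gaussian to the autocorrelation,
      so the limit can be taken with a fixed integrable majorant; the Jacobian cancels the square of
      \<open>?c\<close>.\<close>
    also have "\<dots> = ((1 / ?c) ^ DIM(r2)) *\<^sub>R (\<integral>z. autocorr f ((1 / ?c) *\<^sub>R z) *
        complex_of_real (?c\<^sup>2 * (2 * pi * gauss (?c *\<^sub>R (1 / ?c) *\<^sub>R z))) \<partial>lborel)"
      by (rule integral_lborel_scaleR) auto
    also have "\<dots> = (\<integral>z. ((1 / ?c) ^ DIM(r2)) *\<^sub>R (autocorr f ((1 / ?c) *\<^sub>R z) *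
        complex_of_real (?c\<^sup>2 * (2 * pi * gauss (?c *\<^sub>R (1 / ?c) *\<^sub>R z)))) \<partial>lborel)"
      by (rule integral_scaleR_right[symmetric])
    also have "\<dots> = (\<integral>z. autocorr f ((1 / ?c) *\<^sub>R z) * complex_of_real (2 * pi * gauss z) \<partial>lborel)"
      by (intro Bochner_Integration.integral_cong refl)
         (simp add: scaleR_conv_of_real power2_eq_square field_simps del: of_nat_Suc)
    finally show ?thesis .
  qed
  have "(\<lambda>n. complex_of_real (I n)) \<longlonglongrightarrow> (\<integral>z. autocorr f 0 * complex_of_real (2 * pi * gauss z) \<partial>lborel)"
    unfolding I_eq
  proof (rule integral_dominated_convergence)
    show "integrable lborel (\<lambda>z. nsq lborel f * (2 * pi * gauss z))"
      by (intro integrable_mult_right integrable_gauss)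
    show "AE z in lborel. (\<lambda>n. autocorr f ((1 / real (Suc n)) *\<^sub>R z) * complex_of_real (2 * pi * gauss z))
        \<longlonglongrightarrow> autocorr f 0 * complex_of_real (2 * pi * gauss z)"
    proof (intro AE_I2 tendsto_mult tendsto_const autocorr_tendsto f2)
      fix z :: r2
      have "(\<lambda>n. (1 / real (Suc n)) *\<^sub>R z) \<longlonglongrightarrow> 0 *\<^sub>R z"
        by (intro tendsto_scaleR tendsto_const LIMSEQ_Suc lim_1_over_n)
      then show "(\<lambda>n. (1 / real (Suc n)) *\<^sub>R z) \<longlonglongrightarrow> 0" by simp
    qed
    show "AE z in lborel. norm (autocorr f ((1 / real (Suc n)) *\<^sub>R z) * complex_of_real (2 * pi * gauss z))
        \<le> nsq lborel f * (2 * pi * gauss z)" for n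
      using norm_autocorr_le[OF f2] by (intro AE_I2) (auto simp: norm_mult gauss_def)
  qed measurable
  also have "(\<integral>z. autocorr f 0 * complex_of_real (2 * pi * gauss z) \<partial>lborel)
      = complex_of_real ((2 * pi)\<^sup>2 * nsq lborel f)"
    by (simp add: autocorr_0 integral_gauss power2_eq_square)
  finally have "I \<longlonglongrightarrow> (2 * pi)\<^sup>2 * nsq lborel f"
    using tendsto_of_real_iff by blast
  then have 1: "(\<lambda>n. ennreal (I n)) \<longlonglongrightarrow> ennreal ((2 * pi)\<^sup>2 * nsq lborel f)"
    by (rule tendsto_ennrealI)
  \<comment> \<open>On the other side the Gaussian factors increase to 1, so monotone convergence
    applies without knowing that the limit is finite.\<close>
  have "(\<lambda>n. \<integral>\<^sup>+u. ennreal ((cmod (ft f u))\<^sup>2 * gauss ((1 / real (Suc n)) *\<^sub>R u)) \<partial>lborel)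
      \<longlonglongrightarrow> (\<integral>\<^sup>+u. ennreal ((cmod (ft f u))\<^sup>2) \<partial>lborel)"
  proof (rule nn_integral_LIMSEQ)
    show "incseq (\<lambda>n u. ennreal ((cmod (ft f u))\<^sup>2 * gauss ((1 / real (Suc n)) *\<^sub>R u)))"
      unfolding incseq_Suc_iff le_fun_def gauss_def
      by (auto intro!: ennreal_leI mult_left_mono power_mono mult_right_mono divide_left_mono)
    fix u :: r2
    have "(\<lambda>n. (cmod (ft f u))\<^sup>2 * gauss ((1 / real (Suc n)) *\<^sub>R u)) \<longlonglongrightarrow> (cmod (ft f u))\<^sup>2 * gauss (0 *\<^sub>R u)"
      unfolding gauss_def by (intro tendsto_intros LIMSEQ_Suc lim_1_over_n) auto
    then show "(\<lambda>n. ennreal ((cmod (ft f u))\<^sup>2 * gauss ((1 / real (Suc n)) *\<^sub>R u))) \<longlonglongrightarrow> ennreal ((cmod (ft f u))\<^sup>2)"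
      by (intro tendsto_ennrealI) (simp add: gauss_def)
  qed measurable
  also have "(\<lambda>n. \<integral>\<^sup>+u. ennreal ((cmod (ft f u))\<^sup>2 * gauss ((1 / real (Suc n)) *\<^sub>R u)) \<partial>lborel) = (\<lambda>n. ennreal (I n))"
    unfolding I_def by (intro ext nn_integral_eq_integral ii AE_I2) (simp add: gauss_def)
  finally show ?thesis using 1 by (rule LIMSEQ_unique)
qed

subsection \<open>The time-frequency limiting operator\<close>

text \<open>Two abstract finite measures keep the operator theory symmetric: exchanging them, or
  taking them equal, gives further instances. The identity is required to be measurable so that
  Borel functions of the point are measurable for \<open>M\<close> and \<open>N\<close>.\<close>

locale fourier_pair = M: finite_measure M + N: finite_measure N for M N :: "r2 measure" +
  fixes c :: real
  assumes idM: "(\<lambda>x. x) \<in> borel_measurable M" and idN: "(\<lambda>x. x) \<in> borel_measurable N"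
    and c_pos: "c > 0"
begin

sublocale pair_sigma_finite M N ..

definition mM :: real where "mM = measure M (space M)"
definition mN :: real where "mN = measure N (space N)"

text \<open>For \<open>M\<close>, \<open>N\<close> the Lebesgue measures on \<open>P\<close>, \<open>Q\<close> and \<open>c = (2\<pi>)\<^sup>-\<^sup>2\<close>, this is \<open>T\<^sub>P B\<^sub>Q T\<^sub>P\<close>
  acting on functions on \<open>P\<close>.\<close>

definition lim_op :: "(r2 \<Rightarrow> complex) \<Rightarrow> r2 \<Rightarrow> complex" where
  "lim_op f x = complex_of_real c * fourier N (fourier M f) (- x)"

definition wave :: "r2 \<Rightarrow> r2 \<Rightarrow> complex" where
  "wave u x = cis (x \<bullet> u)"

lemma mM_nonneg: "mM \<ge> 0" and mN_nonneg: "mN \<ge> 0"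
  by (auto simp: mM_def mN_def)

lemma borel_measurable_id_comp:
  assumes "g \<in> borel_measurable borel"
  shows "g \<in> borel_measurable M" "g \<in> borel_measurable N"
  using measurable_compose[OF idM assms] measurable_compose[OF idN assms] by auto

lemma wave_measurable: "wave u \<in> borel_measurable borel"
  unfolding wave_def[abs_def] by measurable

lemma wave_sq_int: "sq_int M (wave u)" "sq_int N (wave u)"
proof -
  show "sq_int M (wave u)"
    by (rule M.sq_int_bounded[where B=1]) (simp_all add: borel_measurable_id_comp[OF wave_measurable] wave_def[of u])
  show "sq_int N (wave u)"
    by (rule N.sq_int_bounded[where B=1]) (simp_all add: borel_measurable_id_comp[OF wave_measurable] wave_def[of u])
qed

lemma nsq_wave: "nsq M (wave u) = mM"
  by (simp add: nsq_def wave_def mM_def)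

lemma fourier_eq_ip: "fourier M' f u = ip M' f (wave u)"
  by (simp add: fourier_def ip_def wave_def cis_cnj)

lemma fourier_measurable_borel:
  assumes "f \<in> borel_measurable M"
  shows "fourier M f \<in> borel_measurable borel"
  unfolding fourier_def[abs_def]
proof (rule M.borel_measurable_lebesgue_integral)
  have [measurable]: "f \<in> borel_measurable M" "(\<lambda>x. x) \<in> borel_measurable M"
    by (fact assms idM)+
  have [measurable]: "(\<lambda>z. snd z) \<in> borel \<Otimes>\<^sub>M M \<rightarrow>\<^sub>M borel"
    using measurable_compose[OF measurable_snd idM] by simp
  show "(\<lambda>(u, x). f x * cis (- (x \<bullet> u))) \<in> borel_measurable (borel \<Otimes>\<^sub>M M)"
    unfolding split_beta' by (intro borel_measurable_times borel_measurable_cis borel_measurable_uminus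
       borel_measurable_inner measurable_compose[OF measurable_snd assms] measurable_compose[OF measurable_snd idM]
       measurable_compose[OF measurable_fst]) auto
qed

lemma norm_fourier_sq_le:
  assumes "sq_int M f"
  shows "(cmod (fourier M f u))\<^sup>2 \<le> mM * nsq M f"
  using ip_Cauchy_Schwarz[OF assms wave_sq_int(1)[of u]]
  by (simp add: fourier_eq_ip nsq_wave mult.commute)

lemma norm_fourier_le:
  assumes "sq_int M f"
  shows "cmod (fourier M f u) \<le> sqrt (mM * nsq M f)"
  by (rule real_le_rsqrt) (rule norm_fourier_sq_le[OF assms])

lemma fourier_sq_int:
  assumes "sq_int M f"
  shows "sq_int N (fourier M f)"
  by (rule N.sq_int_bounded[OF borel_measurable_id_comp(2)[OF fourier_measurable_borel]])
     (use assms norm_fourier_le in \<open>auto simp: sq_int_def\<close>)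

lemma nsq_fourier_le:
  assumes "sq_int M f"
  shows "nsq N (fourier M f) \<le> mN * mM * nsq M f"
proof -
  have "nsq N (fourier M f) \<le> (\<integral>u. mM * nsq M f \<partial>N)"
    unfolding nsq_def[of N] using fourier_sq_int[OF assms] norm_fourier_sq_le[OF assms]
    by (intro integral_mono) (auto simp: sq_int_def)
  then show ?thesis by (simp add: mN_def)
qed

lemma fourier_diff:
  assumes "sq_int M f" "sq_int M g"
  shows "fourier M (\<lambda>x. f x - g x) u = fourier M f u - fourier M g u"
  unfolding fourier_eq_ip using assms wave_sq_int by (intro ip_diff_left)

lemma fourier_cmult: "fourier M (\<lambda>x. a * f x) u = a * fourier M f u"
  unfolding fourier_eq_ip by (rule ip_cmult_left)

lemma fourier_sum:
  assumes "finite I" "\<And>i. i \<in> I \<Longrightarrow> sq_int M (f i)"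
  shows "fourier M (\<lambda>x. \<Sum>i\<in>I. f i x) u = (\<Sum>i\<in>I. fourier M (f i) u)"
  unfolding fourier_eq_ip using assms wave_sq_int by (intro ip_sum_left)

lemma lim_op_measurable:
  assumes "sq_int M f"
  shows "lim_op f \<in> borel_measurable borel"
proof -
  \<comment> \<open>The outer transform integrates over \<open>N\<close>, so its measurability is
    the fact proved for \<open>M\<close> with the measures exchanged.\<close>
  interpret swap: fourier_pair N M c
    using idM idN c_pos by unfold_locales
  have [measurable]: "fourier N (fourier M f) \<in> borel_measurable borel"
    by (rule swap.fourier_measurable_borel) (use fourier_sq_int[OF assms] in \<open>simp add: sq_int_def\<close>)
  show ?thesis unfolding lim_op_def[abs_def] by measurable
qed

text \<open>A bound at every point, not only in norm. It gives the uniform bound on the images of a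
  maximising sequence and later identifies their limit pointwise.\<close>

lemma norm_lim_op_le:
  assumes "sq_int M f"
  shows "cmod (lim_op f x) \<le> c * mN * sqrt mM * sqrt (nsq M f)"
proof -
  have "cmod (fourier N (fourier M f) (- x)) \<le> (\<integral>u. cmod (fourier M f u * cis (- (u \<bullet> - x))) \<partial>N)"
    unfolding fourier_def[of N] by (rule integral_norm_bound)
  also have "\<dots> \<le> (\<integral>u. sqrt (mM * nsq M f) \<partial>N)"
    using fourier_sq_int[OF assms] norm_fourier_le[OF assms]
    by (intro integral_mono) (auto simp: norm_mult intro!: integrable_norm N.sq_int_integrable)
  also have "\<dots> = mN * (sqrt mM * sqrt (nsq M f))" by (simp add: mN_def real_sqrt_mult)
  finally show ?thesis using c_pos by (simp add: lim_op_def norm_mult mult.assoc)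
qed

lemma lim_op_sq_int:
  assumes "sq_int M f"
  shows "sq_int M (lim_op f)"
  using M.sq_int_bounded[OF borel_measurable_id_comp(1)[OF lim_op_measurable] norm_lim_op_le] assms by blast

lemma lim_op_diff:
  assumes "sq_int M f" "sq_int M g"
  shows "lim_op (\<lambda>x. f x - g x) x = lim_op f x - lim_op g x"
proof -
  have "fourier M (\<lambda>x. f x - g x) = (\<lambda>u. fourier M f u - fourier M g u)"
    using assms by (intro ext fourier_diff)
  then have "fourier N (fourier M (\<lambda>x. f x - g x)) (- x) = fourier N (fourier M f) (- x) - fourier N (fourier M g) (- x)"
    unfolding fourier_eq_ip[of N] using assms by (simp add: ip_diff_left fourier_sq_int wave_sq_int)
  then show ?thesis by (simp add: lim_op_def right_diff_distrib)
qed

text \<open>By Fubini the operator is \<open>c\<close> times the adjoint of the transform composed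
  with the transform. Hence it is symmetric and positive, and its quadratic form at \<open>f\<close>
  is \<open>c * nsq N (fourier M f)\<close>.\<close>

lemma lim_op_form:
  assumes f: "sq_int M f" and h: "sq_int M h"
  shows "ip M (lim_op f) h = complex_of_real c * ip N (fourier M f) (fourier M h)"
proof -
  let ?k = "\<lambda>x u. h x * cis (- (x \<bullet> u)) * cnj (fourier M f u)"
  have hm: "h \<in> borel_measurable M" using h by (simp add: sq_int_def)
  have Fm: "fourier M f \<in> borel_measurable N" using fourier_sq_int[OF f] by (simp add: sq_int_def)
  have meas: "case_prod ?k \<in> borel_measurable (M \<Otimes>\<^sub>M N)"
    unfolding split_beta' by (intro borel_measurable_times borel_measurable_cis borel_measurable_uminus borel_measurable_cnj
       borel_measurable_inner measurable_compose[OF measurable_fst hm] measurable_compose[OF measurable_fst idM]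
       measurable_compose[OF measurable_snd idN] measurable_compose[OF measurable_snd Fm])
  have iF: "integrable N (\<lambda>u. cmod (fourier M f u))"
    by (intro integrable_norm N.sq_int_integrable fourier_sq_int f)
  have ik: "integrable (M \<Otimes>\<^sub>M N) (case_prod ?k)"
  proof (rule Fubini_integrable)
    show "integrable M (\<lambda>x. \<integral>u. norm (case (x, u) of (x, u) \<Rightarrow> ?k x u) \<partial>N)"
      using M.sq_int_integrable[OF h] by (simp add: norm_mult)
    have "integrable N (\<lambda>u. cis (- (x \<bullet> u)) * cnj (fourier M f u))" for x
      by (rule Bochner_Integration.integrable_bound[OF iF])
         (auto simp: norm_mult intro!: borel_measurable_times borel_measurable_cis borel_measurable_uminus
            borel_measurable_inner borel_measurable_cnj idN Fm)
    then show "AE x in M. integrable N (\<lambda>u. case (x, u) of (x, u) \<Rightarrow> ?k x u)"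
      by (simp add: mult.assoc)
  qed (fact meas)
  have "ip N (fourier M h) (fourier M f) = (\<integral>u. \<integral>x. ?k x u \<partial>M \<partial>N)"
    unfolding ip_def fourier_def[of M h] by simp
  also have "\<dots> = (\<integral>x. \<integral>u. ?k x u \<partial>N \<partial>M)"
    by (rule Fubini_integral[OF ik])
  also have "\<dots> = (\<integral>x. h x * cnj (fourier N (fourier M f) (- x)) \<partial>M)"
  proof (rule Bochner_Integration.integral_cong[OF refl])
    fix x
    have "cnj (fourier N (fourier M f) (- x)) = (\<integral>u. cis (- (x \<bullet> u)) * cnj (fourier M f u) \<partial>N)"
      unfolding fourier_def[of N] by (subst Bochner_Integration.integral_cnj[symmetric])
        (simp add: cis_cnj inner_commute mult.commute)
    then show "(\<integral>u. ?k x u \<partial>N) = h x * cnj (fourier N (fourier M f) (- x))"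
      by (simp add: mult.assoc)
  qed
  finally have *: "ip N (fourier M h) (fourier M f) = (\<integral>x. h x * cnj (fourier N (fourier M f) (- x)) \<partial>M)" .
  have "ip M h (lim_op f) = complex_of_real c * (\<integral>x. h x * cnj (fourier N (fourier M f) (- x)) \<partial>M)"
    unfolding ip_def lim_op_def by (simp add: mult_ac flip: integral_mult_right_zero)
  also note *[symmetric]
  finally have "ip M h (lim_op f) = complex_of_real c * ip N (fourier M h) (fourier M f)" .
  then show ?thesis by (metis complex_cnj_complex_of_real complex_cnj_mult ip_commute)
qed

lemma fourier_wave: "fourier M (wave u) v = fourier M (\<lambda>_. 1) (v - u)"
  by (simp add: fourier_def wave_def cis_mult inner_diff_right)

lemma fourier_1_measurable: "fourier M (\<lambda>_. 1) \<in> borel_measurable borel"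
  by (rule fourier_measurable_borel) simp

text \<open>By \<open>fourier_wave\<close> the frequency \<open>u\<close> only shifts the transform
  of the constant 1, so this is a parameter integral of one Borel function.\<close>

lemma nsq_fourier_wave_measurable: "(\<lambda>u. nsq N (fourier M (wave u))) \<in> borel_measurable borel"
  unfolding nsq_def fourier_wave
proof (rule N.borel_measurable_lebesgue_integral)
  have sqm: "(\<lambda>w. (cmod (fourier M (\<lambda>_. 1) w))\<^sup>2) \<in> borel_measurable borel"
    using fourier_1_measurable by measurable
  show "(\<lambda>(u, v). (cmod (fourier M (\<lambda>_. 1) (v - u)))\<^sup>2) \<in> borel_measurable (borel \<Otimes>\<^sub>M N)"
    using measurable_compose[OF borel_measurable_diff[OF measurable_compose[OF measurable_snd idN] measurable_fst] sqm]
    unfolding split_beta' .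
qed

lemma nsq_fourier_wave_integrable: "integrable N (\<lambda>u. nsq N (fourier M (wave u)))"
proof (rule N.integrable_const_bound[where B="mN * mM * mM"])
  show "AE u in N. norm (nsq N (fourier M (wave u))) \<le> mN * mM * mM"
    using nsq_fourier_le[OF wave_sq_int(1)] by (intro AE_I2) (simp add: nsq_wave nsq_nonneg)
  show "(\<lambda>u. nsq N (fourier M (wave u))) \<in> borel_measurable N"
    by (rule borel_measurable_id_comp(2)[OF nsq_fourier_wave_measurable])
qed

section \<open>Orthonormal families of eigenfunctions\<close>

definition eig_family :: "real \<Rightarrow> nat \<Rightarrow> (nat \<Rightarrow> r2 \<Rightarrow> complex) \<Rightarrow> (nat \<Rightarrow> real) \<Rightarrow> bool" where
  "eig_family eps n \<phi> lam \<longleftrightarrow>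
     (\<forall>i<n. eps \<le> lam i \<and> sq_int M (\<phi> i) \<and> (AE x in M. lim_op (\<phi> i) x = complex_of_real (lam i) * \<phi> i x)) \<and>
     (\<forall>i<n. \<forall>j<n. ip M (\<phi> i) (\<phi> j) = (if i = j then 1 else 0))"

lemma ip_eigenfun:
  assumes f: "sq_int M f" and h: "sq_int M h"
    and ev: "AE x in M. lim_op f x = complex_of_real l * f x"
  shows "complex_of_real c * ip N (fourier M f) (fourier M h) = complex_of_real l * ip M f h"
proof -
  have "ip M (lim_op f) h = ip M (\<lambda>x. complex_of_real l * f x) h"
    using ev f h lim_op_sq_int[OF f] by (intro ip_cong_AE) (auto simp: sq_int_def)
  then show ?thesis using lim_op_form[OF f h] by (simp add: ip_cmult_left)
qed

context
  fixes eps :: real and n :: nat and \<phi> :: "nat \<Rightarrow> r2 \<Rightarrow> complex" and lam :: "nat \<Rightarrow> real"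
  assumes fam: "eig_family eps n \<phi> lam" and eps: "eps > 0"
begin

lemma fam_sq_int: "i < n \<Longrightarrow> sq_int M (\<phi> i)"
  and fam_eps: "i < n \<Longrightarrow> eps \<le> lam i"
  and fam_pos: "i < n \<Longrightarrow> 0 < lam i"
  and fam_eig: "i < n \<Longrightarrow> AE x in M. lim_op (\<phi> i) x = complex_of_real (lam i) * \<phi> i x"
  and fam_on: "i < n \<Longrightarrow> j < n \<Longrightarrow> ip M (\<phi> i) (\<phi> j) = (if i = j then 1 else 0)"
  using fam eps by (auto simp: eig_family_def intro: less_le_trans)

text \<open>The eigenvalue equation is tested against the eigenfunction itself: the eigenvalue
  measures how much of the transform lies on \<open>N\<close>.\<close>

lemma fam_nsq_fourier:
  assumes "i < n"
  shows "lam i = c * nsq N (fourier M (\<phi> i))"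
proof -
  have "complex_of_real (c * nsq N (fourier M (\<phi> i))) = complex_of_real (lam i)"
    using ip_eigenfun[OF fam_sq_int fam_sq_int fam_eig, of i i] assms fam_on[of i i] by (simp add: ip_self)
  then show ?thesis using of_real_eq_iff by metis
qed

text \<open>The coefficients of a plane wave along the family are the conjugated transforms of its
  members at \<open>u\<close>. Integrated over \<open>N\<close>, this bounds the eigenvalue sum by
  the trace.\<close>

lemma fam_bessel_wave: "(\<Sum>i<n. (cmod (fourier M (\<phi> i) u))\<^sup>2) \<le> mM"
  using bessel[OF wave_sq_int(1)[of u] fam_sq_int fam_on]
  by (simp add: nsq_wave fourier_eq_ip ip_commute[of M "wave u"])

lemma fam_trace: "(\<Sum>i<n. lam i) \<le> c * mM * mN"
proof -
  have i: "integrable N (\<lambda>u. (cmod (fourier M (\<phi> i) u))\<^sup>2)" if "i < n" for i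
    using fourier_sq_int[OF fam_sq_int[OF that]] by (simp add: sq_int_def)
  have "(\<Sum>i<n. lam i) = (\<Sum>i<n. c * nsq N (fourier M (\<phi> i)))"
    using fam_nsq_fourier by simp
  also have "\<dots> = c * (\<integral>u. (\<Sum>i<n. (cmod (fourier M (\<phi> i) u))\<^sup>2) \<partial>N)"
    using i by (simp add: nsq_def sum_distrib_left Bochner_Integration.integral_sum)
  also have "(\<integral>u. (\<Sum>i<n. (cmod (fourier M (\<phi> i) u))\<^sup>2) \<partial>N) \<le> (\<integral>u. mM \<partial>N)"
    using i fam_bessel_wave by (intro integral_mono) auto
  finally show ?thesis using c_pos by (simp add: mN_def mult_ac)
qed

text \<open>The transforms of the eigenfunctions are orthogonal in \<open>L2\<close> of
  \<open>N\<close> with squared norms \<open>lam i / c\<close>; the factor normalises them. In other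
  words these are the left singular functions of the transform from \<open>M\<close> to
  \<open>N\<close>.\<close>

definition dual_fam :: "nat \<Rightarrow> r2 \<Rightarrow> complex" where
  "dual_fam i u = complex_of_real (sqrt (c / lam i)) * fourier M (\<phi> i) u"

lemma dual_fam_sq_int: "i < n \<Longrightarrow> sq_int N (dual_fam i)"
  unfolding dual_fam_def[abs_def] by (intro sq_int_cmult fourier_sq_int fam_sq_int)

lemma dual_fam_on:
  assumes "i < n" "j < n"
  shows "ip N (dual_fam i) (dual_fam j) = (if i = j then 1 else 0)"
proof -
  have "ip N (fourier M (\<phi> i)) (fourier M (\<phi> j)) = complex_of_real (lam i / c) * (if i = j then 1 else 0)"
    using ip_eigenfun[OF fam_sq_int fam_sq_int fam_eig, of i j] assms fam_on[of i j] c_pos by (auto simp: field_simps)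
  moreover have "sqrt (c / lam i) * (sqrt (c / lam i) * (lam i / c)) = 1"
    using c_pos fam_pos[OF assms(1)] by (simp flip: mult.assoc)
  from arg_cong[OF this, of complex_of_real]
  have "complex_of_real (sqrt (c / lam i)) * (complex_of_real (sqrt (c / lam i)) * complex_of_real (lam i / c)) = 1"
    by (simp only: of_real_mult of_real_1)
  ultimately show ?thesis
    unfolding dual_fam_def[abs_def] ip_cmult_left ip_cmult_right
    by (cases "i = j") (simp_all only: complex_cnj_complex_of_real if_True if_False mult_1_right mult_zero_right refl)
qed

lemma fam_fourier_wave:
  assumes "i < n"
  shows "complex_of_real c * ip N (fourier M (\<phi> i)) (fourier M (wave u)) = complex_of_real (lam i) * fourier M (\<phi> i) u"
  unfolding fourier_eq_ip[of M "\<phi> i" u]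
  using assms by (intro ip_eigenfun fam_sq_int wave_sq_int fam_eig)

lemma ip_wave_dual_fam:
  assumes "i < n"
  shows "ip N (fourier M (wave u)) (dual_fam i) = complex_of_real (sqrt (c / lam i) * (lam i / c)) * cnj (fourier M (\<phi> i) u)"
proof -
  have "ip N (fourier M (\<phi> i)) (fourier M (wave u)) = complex_of_real (lam i / c) * fourier M (\<phi> i) u"
    using fam_fourier_wave[OF assms, of u] c_pos by (simp add: field_simps)
  then show ?thesis
    unfolding dual_fam_def[abs_def] ip_cmult_right by (subst ip_commute) simp
qed

lemma norm_ip_wave_dual_fam:
  assumes "i < n"
  shows "(cmod (ip N (fourier M (wave u)) (dual_fam i)))\<^sup>2 = lam i * (cmod (fourier M (\<phi> i) u))\<^sup>2 / c"
  unfolding ip_wave_dual_fam[OF assms] using c_pos fam_pos[OF assms]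
  by (simp add: norm_mult power_mult_distrib norm_divide power_divide) (simp add: field_simps power2_eq_square)

text \<open>Bessel's inequality on the frequency side, for the transform of a plane wave and
  \<open>dual_fam\<close>. It holds for every \<open>u\<close>, which \<open>fam_upper\<close>
  exploits outside \<open>Q\<close>.\<close>

lemma fam_bessel_dual: "(\<Sum>i<n. lam i * (cmod (fourier M (\<phi> i) u))\<^sup>2) \<le> c * nsq N (fourier M (wave u))"
proof -
  have "(\<Sum>i<n. lam i * (cmod (fourier M (\<phi> i) u))\<^sup>2 / c) \<le> nsq N (fourier M (wave u))"
    using bessel[OF fourier_sq_int[OF wave_sq_int(1)[of u]] dual_fam_sq_int dual_fam_on]
    by (simp add: norm_ip_wave_dual_fam)
  then show ?thesis using c_pos by (simp add: field_simps flip: sum_divide_distrib)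
qed

text \<open>The hypothesis \<open>max\<close> bounds the quadratic form by \<open>eps\<close> on the
  orthogonal complement of the family. It is applied to the part of the plane wave that is
  orthogonal to the family.\<close>

lemma fam_wave_estimate:
  assumes max: "\<And>f. sq_int M f \<Longrightarrow> (\<And>i. i < n \<Longrightarrow> ip M f (\<phi> i) = 0) \<Longrightarrow> c * nsq N (fourier M f) \<le> eps * nsq M f"
  shows "c * nsq N (fourier M (wave u)) \<le>
    (\<Sum>i<n. lam i * (cmod (fourier M (\<phi> i) u))\<^sup>2) + eps * (mM - (\<Sum>i<n. (cmod (fourier M (\<phi> i) u))\<^sup>2))"
proof -
  let ?e = "wave u"
  let ?r = "\<lambda>x. ?e x - (\<Sum>i<n. ip M ?e (\<phi> i) * \<phi> i x)"
  note res = nsq_residual[OF wave_sq_int(1)[of u] fam_sq_int fam_on]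
  have sq: "sq_int M (\<lambda>x. \<Sum>i<n. ip M ?e (\<phi> i) * \<phi> i x)"
    by (intro sq_int_sum sq_int_cmult fam_sq_int) auto
  have ipe: "ip M ?e (\<phi> i) = cnj (fourier M (\<phi> i) u)" for i
    by (simp add: fourier_eq_ip ip_commute[of M ?e])
  \<comment> \<open>The transform maps the residual of the wave to the residual of the transformed
    wave with respect to \<open>dual_fam\<close>. Both squared norms are therefore given by
    \<open>nsq_residual\<close>.\<close>
  have "fourier M ?r v = fourier M ?e v - (\<Sum>i<n. ip N (fourier M ?e) (dual_fam i) * dual_fam i v)" for v
  proof -
    have "fourier M ?r v = fourier M ?e v - (\<Sum>i<n. ip M ?e (\<phi> i) * fourier M (\<phi> i) v)"
    proof -
      have "fourier M (\<lambda>x. \<Sum>i<n. ip M ?e (\<phi> i) * \<phi> i x) v = (\<Sum>i<n. fourier M (\<lambda>x. ip M ?e (\<phi> i) * \<phi> i x) v)"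
        by (intro fourier_sum sq_int_cmult fam_sq_int) auto
      also have "\<dots> = (\<Sum>i<n. ip M ?e (\<phi> i) * fourier M (\<phi> i) v)"
        by (intro sum.cong refl fourier_cmult)
      finally show ?thesis by (simp only: fourier_diff[OF wave_sq_int(1) sq])
    qed
    also have "(\<Sum>i<n. ip M ?e (\<phi> i) * fourier M (\<phi> i) v) = (\<Sum>i<n. ip N (fourier M ?e) (dual_fam i) * dual_fam i v)"
    proof (rule sum.cong[OF refl])
      fix i assume i: "i \<in> {..<n}"
      have "sqrt (c / lam i) * (lam i / c) * sqrt (c / lam i) = 1"
        using c_pos fam_pos[of i] i by (simp add: field_simps)
      from arg_cong[OF this, of complex_of_real]
      have "complex_of_real (sqrt (c / lam i) * (lam i / c)) * complex_of_real (sqrt (c / lam i)) = 1"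
        by (simp only: of_real_mult of_real_1)
      then have "complex_of_real (sqrt (c / lam i) * (lam i / c)) * a * (complex_of_real (sqrt (c / lam i)) * b) = a * b" for a b
        by (simp only: mult.assoc mult.left_commute[of a]) (simp only: mult.assoc[symmetric] mult_1_left)
      then show "ip M ?e (\<phi> i) * fourier M (\<phi> i) v = ip N (fourier M ?e) (dual_fam i) * dual_fam i v"
        using i by (simp only: ip_wave_dual_fam lessThan_iff ipe dual_fam_def)
    qed
    finally show ?thesis .
  qed
  then have "fourier M ?r = (\<lambda>v. fourier M ?e v - (\<Sum>i<n. ip N (fourier M ?e) (dual_fam i) * dual_fam i v))"
    by (rule ext)
  then have "nsq N (fourier M ?r) = nsq N (fourier M ?e) - (\<Sum>i<n. (cmod (ip N (fourier M ?e) (dual_fam i)))\<^sup>2)"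
    using nsq_residual(1)[OF fourier_sq_int[OF wave_sq_int(1)[of u]] dual_fam_sq_int dual_fam_on]
    by presburger
  then have "c * nsq N (fourier M ?r) = c * nsq N (fourier M ?e) - (\<Sum>i<n. lam i * (cmod (fourier M (\<phi> i) u))\<^sup>2)"
    using c_pos by (simp add: norm_ip_wave_dual_fam right_diff_distrib flip: sum_divide_distrib)
  moreover have "c * nsq N (fourier M ?r) \<le> eps * nsq M ?r"
    using res(2) sq wave_sq_int(1) by (intro max sq_int_diff) auto
  moreover have "nsq M ?r = mM - (\<Sum>i<n. (cmod (fourier M (\<phi> i) u))\<^sup>2)"
    using res(1) by (simp add: nsq_wave ipe)
  ultimately show ?thesis by simp
qed

text \<open>Integrating the previous estimate over \<open>N\<close> gives the sum of
  \<open>lam i * (lam i - eps)\<close> plus \<open>eps\<close> times the trace; each summand is at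
  most \<open>1 - eps\<close>. The left side is tr A^2. The bound \<open>le1\<close> is assumed
  because it rests on Plancherel and is supplied later for Lebesgue measure.\<close>

lemma fam_hs_estimate:
  assumes max: "\<And>f. sq_int M f \<Longrightarrow> (\<And>i. i < n \<Longrightarrow> ip M f (\<phi> i) = 0) \<Longrightarrow> c * nsq N (fourier M f) \<le> eps * nsq M f"
    and le1: "\<And>i. i < n \<Longrightarrow> lam i \<le> 1" and "eps < 1"
  shows "c\<^sup>2 * (\<integral>u. nsq N (fourier M (wave u)) \<partial>N) \<le> (1 - eps) * real n + eps * (c * mM * mN)"
proof -
  have i: "integrable N (\<lambda>u. (cmod (fourier M (\<phi> i) u))\<^sup>2)" if "i < n" for i
    using fourier_sq_int[OF fam_sq_int[OF that]] by (simp add: sq_int_def)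
  have "c * (\<integral>u. nsq N (fourier M (wave u)) \<partial>N) = (\<integral>u. c * nsq N (fourier M (wave u)) \<partial>N)" by simp
  also have "\<dots> \<le> (\<integral>u. (\<Sum>i<n. lam i * (cmod (fourier M (\<phi> i) u))\<^sup>2)
      + eps * (mM - (\<Sum>i<n. (cmod (fourier M (\<phi> i) u))\<^sup>2)) \<partial>N)"
    using i nsq_fourier_wave_integrable fam_wave_estimate[OF max]
    by (intro integral_mono Bochner_Integration.integrable_add integrable_mult_right
        Bochner_Integration.integrable_diff Bochner_Integration.integrable_sum) simp_all
  also have "\<dots> = (\<Sum>i<n. lam i * nsq N (fourier M (\<phi> i))) + eps * (mM * mN - (\<Sum>i<n. nsq N (fourier M (\<phi> i))))"
  proof -
    have s1: "integrable N (\<lambda>u. \<Sum>i<n. lam i * (cmod (fourier M (\<phi> i) u))\<^sup>2)"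
      and s2: "integrable N (\<lambda>u. \<Sum>i<n. (cmod (fourier M (\<phi> i) u))\<^sup>2)"
      using i by (auto intro!: Bochner_Integration.integrable_sum integrable_mult_right)
    have "(\<integral>u. (\<Sum>i<n. lam i * (cmod (fourier M (\<phi> i) u))\<^sup>2) \<partial>N) = (\<Sum>i<n. lam i * nsq N (fourier M (\<phi> i)))"
      and "(\<integral>u. (\<Sum>i<n. (cmod (fourier M (\<phi> i) u))\<^sup>2) \<partial>N) = (\<Sum>i<n. nsq N (fourier M (\<phi> i)))"
      using i by (auto simp: nsq_def Bochner_Integration.integral_sum intro!: sum.cong)
    with s1 s2 show ?thesis by (simp add: mN_def mult.commute)
  qed
  finally have "c * (c * (\<integral>u. nsq N (fourier M (wave u)) \<partial>N)) \<le> c * ((\<Sum>i<n. lam i * nsq N (fourier M (\<phi> i))) + eps * (mM * mN - (\<Sum>i<n. nsq N (fourier M (\<phi> i)))))"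
    using c_pos by (intro mult_left_mono) auto
  also have "\<dots> = (\<Sum>i<n. lam i * (c * nsq N (fourier M (\<phi> i)))) + eps * (c * mM * mN - (\<Sum>i<n. c * nsq N (fourier M (\<phi> i))))"
    by (simp add: algebra_simps sum_distrib_left)
  also have "\<dots> = (\<Sum>i<n. lam i * lam i) + eps * (c * mM * mN - (\<Sum>i<n. lam i))"
    using fam_nsq_fourier by simp
  also have "\<dots> = (\<Sum>i<n. lam i * lam i - eps * lam i) + eps * (c * mM * mN)"
    by (simp add: algebra_simps sum_subtractf sum_distrib_left)
  also have "(\<Sum>i<n. lam i * lam i - eps * lam i) \<le> (\<Sum>i<n. 1 - eps)"
  proof (rule sum_mono)
    fix j assume "j \<in> {..<n}"
    then have l: "0 \<le> lam j" "lam j \<le> 1" using le1 fam_pos[of j] by auto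
    have "lam j * lam j - eps * lam j \<le> lam j - eps * lam j" using mult_left_mono[OF l(2) l(1)] by simp
    also have "\<dots> = lam j * (1 - eps)" by (simp add: algebra_simps)
    also have "\<dots> \<le> 1 * (1 - eps)" using l \<open>eps < 1\<close> by (intro mult_right_mono) auto
    finally show "lam j * lam j - eps * lam j \<le> 1 - eps" by simp
  qed
  finally show ?thesis by (simp add: power2_eq_square mult_ac)
qed

text \<open>The supremum \<open>\<mu>\<close> of the Rayleigh quotient on the orthogonal complement is attained: along a
  maximising sequence \<open>f\<^sub>k\<close> one has \<open>A f\<^sub>k - \<mu> f\<^sub>k \<longlongrightarrow> 0\<close>, while the functions \<open>A f\<^sub>k\<close> are uniformly bounded and
  equicontinuous, so a subsequence converges pointwise and hence in \<open>L2\<close>.\<close>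

lemma fam_extend:
  assumes f0: "sq_int M f0" "\<And>i. i < n \<Longrightarrow> ip M f0 (\<phi> i) = 0"
    and gt: "c * nsq N (fourier M f0) > eps * nsq M f0"
  obtains \<psi> \<mu> where "eig_family eps (Suc n) (\<phi>(n := \<psi>)) (lam(n := \<mu>))"
proof -
  define R where "R f = c * nsq N (fourier M f)" for f
  define S where "S = {f. sq_int M f \<and> (\<forall>i<n. ip M f (\<phi> i) = 0) \<and> nsq M f = 1}"
  define \<mu> where "\<mu> = Sup (R ` S)"
  have R_cmult: "R (\<lambda>x. a * f x) = (cmod a)\<^sup>2 * R f" for a f
  proof -
    have "fourier M (\<lambda>x. a * f x) = (\<lambda>u. a * fourier M f u)" by (rule ext) (rule fourier_cmult)
    then show ?thesis by (simp add: R_def nsq_cmult)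
  qed
  have R_le: "R f \<le> c * (mN * mM * nsq M f)" if "sq_int M f" for f
    unfolding R_def using nsq_fourier_le[OF that] c_pos by (intro mult_left_mono) auto
  have bdd: "bdd_above (R ` S)"
    by (rule bdd_aboveI2[where M="c * (mN * mM)"]) (use R_le in \<open>force simp: S_def\<close>)
  have normalise: "(\<lambda>x. complex_of_real (1 / sqrt (nsq M f)) * f x) \<in> S"
    "R (\<lambda>x. complex_of_real (1 / sqrt (nsq M f)) * f x) = R f / nsq M f"
    if "sq_int M f" "\<And>i. i < n \<Longrightarrow> ip M f (\<phi> i) = 0" "nsq M f \<noteq> 0" for f
  proof -
    define a where "a = complex_of_real (1 / sqrt (nsq M f))"
    have "(cmod a)\<^sup>2 = 1 / nsq M f"
      unfolding a_def norm_of_real power2_abs using nsq_nonneg[of M f] by (simp add: power_divide)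
    then show "(\<lambda>x. complex_of_real (1 / sqrt (nsq M f)) * f x) \<in> S"
      "R (\<lambda>x. complex_of_real (1 / sqrt (nsq M f)) * f x) = R f / nsq M f"
      unfolding a_def[symmetric] using that by (auto simp: S_def sq_int_cmult ip_cmult_left nsq_cmult R_cmult)
  qed
  have R_mu: "R f \<le> \<mu> * nsq M f" if f: "sq_int M f" "\<And>i. i < n \<Longrightarrow> ip M f (\<phi> i) = 0" for f
  proof (cases "nsq M f = 0")
    case True
    then show ?thesis using R_le[OF f(1)] by simp
  next
    case False
    have "R f / nsq M f \<le> \<mu>"
      unfolding \<mu>_def using normalise[OF f False] bdd by (metis cSUP_upper)
    then show ?thesis using False nsq_nonneg[of M f] by (simp add: field_simps)
  qed
  have nz: "nsq M f0 \<noteq> 0" using gt R_le[OF f0(1)] by (auto simp: R_def)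
  have mu_gt: "eps < \<mu>"
  proof -
    have "eps < R f0 / nsq M f0" using gt nz nsq_nonneg[of M f0] by (simp add: R_def field_simps)
    also have "\<dots> \<le> \<mu>" using R_mu[OF f0] nz nsq_nonneg[of M f0] by (simp add: field_simps)
    finally show ?thesis .
  qed
  then have mu_pos: "\<mu> > 0" using eps by simp
  have "S \<noteq> {}" using normalise(1)[OF f0 nz] by blast
  then have "\<exists>f\<in>S. \<mu> - 1 / real (Suc k) < R f" for k
    using less_cSUP_iff[OF _ bdd, of "\<mu> - 1 / real (Suc k)"] by (simp add: \<mu>_def)
  then obtain f where fS: "\<And>k. f k \<in> S" and fR: "\<And>k. \<mu> - 1 / real (Suc k) < R (f k)"
    by metis
  have f: "sq_int M (f k)" "i < n \<Longrightarrow> ip M (f k) (\<phi> i) = 0" "nsq M (f k) = 1" for k i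
    using fS[of k] by (auto simp: S_def)
  define h where "h k = lim_op (f k)" for k
  have h: "sq_int M (h k)" for k unfolding h_def by (rule lim_op_sq_int[OF f(1)])
  have hf: "ip M (h k) (f k) = complex_of_real (R (f k))" for k
    unfolding h_def lim_op_form[OF f(1) f(1)] ip_self R_def by simp
  \<comment> \<open>The operator is symmetric, so it preserves the orthogonal complement of
    eigenfunctions.\<close>
  have h_orth: "ip M (h k) (\<phi> i) = 0" if "i < n" for k i
  proof -
    have "complex_of_real c * ip N (fourier M (\<phi> i)) (fourier M (f k)) = 0"
      using ip_eigenfun[OF fam_sq_int[OF that] f(1) fam_eig[OF that]] f(2)[OF that, of k]
      by (subst (asm) (2) ip_commute) simp
    then have "ip N (fourier M (f k)) (fourier M (\<phi> i)) = 0"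
      using c_pos by (subst ip_commute) simp
    then show ?thesis unfolding h_def lim_op_form[OF f(1) fam_sq_int[OF that]] by simp
  qed
  \<comment> \<open>Cauchy-Schwarz for the form of the operator: the square of
    \<open>nsq M (h k)\<close> is at most \<open>R (f k) * R (h k)\<close>. Since \<open>h k\<close>
    lies in the complement, \<open>R (h k)\<close> is at most \<open>\<mu> * nsq M (h k)\<close>,
    and one factor cancels.\<close>
  have h_le: "nsq M (h k) \<le> \<mu> * R (f k)" for k
  proof -
    have "complex_of_real (nsq M (h k)) = complex_of_real c * ip N (fourier M (f k)) (fourier M (h k))"
      using lim_op_form[OF f(1) h, of k k] by (simp add: ip_self flip: h_def)
    then have "nsq M (h k) = c * cmod (ip N (fourier M (f k)) (fourier M (h k)))"
      using c_pos nsq_nonneg[of M "h k"] by (metis abs_of_nonneg abs_of_pos norm_mult norm_of_real)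
    then have "(nsq M (h k))\<^sup>2 = c\<^sup>2 * (cmod (ip N (fourier M (f k)) (fourier M (h k))))\<^sup>2"
      by (simp add: power_mult_distrib)
    also have "\<dots> \<le> c\<^sup>2 * (nsq N (fourier M (f k)) * nsq N (fourier M (h k)))"
      by (intro mult_left_mono ip_Cauchy_Schwarz fourier_sq_int f h) simp
    also have "\<dots> = R (f k) * R (h k)" by (simp add: R_def power2_eq_square)
    also have "\<dots> \<le> R (f k) * (\<mu> * nsq M (h k))"
      using c_pos by (intro mult_left_mono R_mu h h_orth) (auto simp: R_def nsq_nonneg)
    finally have "nsq M (h k) * nsq M (h k) \<le> (\<mu> * R (f k)) * nsq M (h k)"
      by (simp add: power2_eq_square mult_ac)
    moreover have "0 \<le> \<mu> * R (f k)" using mu_pos c_pos by (simp add: R_def nsq_nonneg)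
    ultimately show ?thesis
      using nsq_nonneg[of M "h k"] by (cases "nsq M (h k) = 0") auto
  qed
  \<comment> \<open>Expanding the square and inserting \<open>h_le\<close> leaves
    \<open>\<mu> * (\<mu> - R (f k))\<close>, which is small by the choice of the maximising
    sequence.\<close>
  have h_mu: "nsq M (\<lambda>x. h k x - complex_of_real \<mu> * f k x) \<le> \<mu> * (1 / real (Suc k))" for k
  proof -
    have "nsq M (\<lambda>x. h k x - complex_of_real \<mu> * f k x) = nsq M (h k) - 2 * (\<mu> * R (f k)) + \<mu>\<^sup>2"
      by (subst nsq_diff[OF h sq_int_cmult[OF f(1)]]) (simp add: ip_cmult_right hf nsq_cmult f)
    also have "\<dots> \<le> \<mu> * (\<mu> - R (f k))" using h_le[of k] by (simp add: algebra_simps power2_eq_square)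
    also have "\<dots> \<le> \<mu> * (1 / real (Suc k))" using fR[of k] mu_pos by (intro mult_left_mono) auto
    finally show ?thesis .
  qed
  define K where "K = c * mN * sqrt mM"
  have h_bd: "cmod (h k x) \<le> K" for k x
    using norm_lim_op_le[OF f(1), of k x] by (simp add: f h_def K_def)
  \<comment> \<open>A modulus of continuity that depends on \<open>N\<close> alone, hence is common
    to all \<open>h k\<close>.\<close>
  define \<omega> where "\<omega> x y = (\<integral>u. cmod (cis (u \<bullet> x) - cis (u \<bullet> y)) \<partial>N)" for x y :: r2
  have \<omega>_meas: "(\<lambda>u. cmod (cis (u \<bullet> x) - cis (u \<bullet> y))) \<in> borel_measurable N" for x y
    by (rule borel_measurable_id_comp) measurable
  have \<omega>_int: "integrable N (\<lambda>u. cmod (cis (u \<bullet> x) - cis (u \<bullet> y)))" for x y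
    by (rule N.integrable_const_bound[where B=2])
       (use \<omega>_meas norm_triangle_ineq4 in \<open>fastforce intro!: AE_I2 intro: order_trans\<close>)+
  have h_equi: "cmod (h k x - h k y) \<le> c * sqrt mM * \<omega> x y" for k x y
  proof -
    let ?F = "fourier M (f k)"
    have F: "integrable N (\<lambda>u. ?F u * cis (u \<bullet> z))" for z
      using sq_int_integrable_mult[OF fourier_sq_int[OF f(1)] wave_sq_int(2), of k "- z"]
      by (simp add: wave_def cis_cnj)
    have Fb: "cmod (?F u) \<le> sqrt mM" for u using norm_fourier_le[OF f(1), of k u] by (simp add: f)
    have "h k x - h k y = complex_of_real c * (\<integral>u. ?F u * cis (u \<bullet> x) - ?F u * cis (u \<bullet> y) \<partial>N)"
      using F by (simp add: h_def lim_op_def fourier_def[of N] right_diff_distrib)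
    then have "cmod (h k x - h k y) = c * cmod (\<integral>u. ?F u * cis (u \<bullet> x) - ?F u * cis (u \<bullet> y) \<partial>N)"
      using c_pos by (simp add: norm_mult)
    also have "cmod (\<integral>u. ?F u * cis (u \<bullet> x) - ?F u * cis (u \<bullet> y) \<partial>N)
        \<le> (\<integral>u. cmod (?F u * cis (u \<bullet> x) - ?F u * cis (u \<bullet> y)) \<partial>N)"
      by (rule integral_norm_bound)
    also have "\<dots> \<le> (\<integral>u. sqrt mM * cmod (cis (u \<bullet> x) - cis (u \<bullet> y)) \<partial>N)"
    proof (rule integral_mono)
      show "integrable N (\<lambda>u. cmod (?F u * cis (u \<bullet> x) - ?F u * cis (u \<bullet> y)))"
        using F by (intro integrable_norm Bochner_Integration.integrable_diff)
      show "integrable N (\<lambda>u. sqrt mM * cmod (cis (u \<bullet> x) - cis (u \<bullet> y)))"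
        by (intro integrable_mult_right \<omega>_int)
      fix u
      have "cmod (?F u * cis (u \<bullet> x) - ?F u * cis (u \<bullet> y)) = cmod (?F u) * cmod (cis (u \<bullet> x) - cis (u \<bullet> y))"
        by (simp only: norm_mult flip: right_diff_distrib)
      also have "\<dots> \<le> sqrt mM * cmod (cis (u \<bullet> x) - cis (u \<bullet> y))"
        by (intro mult_right_mono Fb) simp
      finally show "cmod (?F u * cis (u \<bullet> x) - ?F u * cis (u \<bullet> y)) \<le> sqrt mM * cmod (cis (u \<bullet> x) - cis (u \<bullet> y))" .
    qed
    finally show ?thesis using c_pos by (simp add: \<omega>_def mult.assoc)
  qed
  have \<omega>_lim: "(\<lambda>j. \<omega> x (y j)) \<longlonglongrightarrow> 0" if y: "y \<longlonglongrightarrow> x" for x y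
  proof -
    have "(\<lambda>j. \<omega> x (y j)) \<longlonglongrightarrow> (\<integral>u. 0 \<partial>N)"
      unfolding \<omega>_def
    proof (rule integral_dominated_convergence[where w="\<lambda>_. 2"])
      show "AE u in N. (\<lambda>j. cmod (cis (u \<bullet> x) - cis (u \<bullet> y j))) \<longlonglongrightarrow> 0"
      proof (rule AE_I2)
        fix u
        have "(\<lambda>j. cmod (cis (u \<bullet> x) - cis (u \<bullet> y j))) \<longlonglongrightarrow> cmod (cis (u \<bullet> x) - cis (u \<bullet> x))"
          using y by (intro tendsto_intros isCont_tendsto_compose[of _ cis]) (auto intro!: continuous_intros)
        then show "(\<lambda>j. cmod (cis (u \<bullet> x) - cis (u \<bullet> y j))) \<longlonglongrightarrow> 0" by simp
      qed
      show "AE u in N. norm (cmod (cis (u \<bullet> x) - cis (u \<bullet> y j))) \<le> 2" for j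
        using norm_triangle_ineq4[of "cis (_ \<bullet> x)" "cis (_ \<bullet> y j)"] by (intro AE_I2) simp
    qed (auto intro: \<omega>_meas)
    then show ?thesis by simp
  qed
  \<comment> \<open>Arzela-Ascoli by hand: a diagonal subsequence converges on a countable dense
    set, and the common modulus extends convergence to every point.\<close>
  obtain D :: "r2 set" where D: "countable D" "\<And>X. open X \<Longrightarrow> X \<noteq> {} \<Longrightarrow> \<exists>d\<in>D. d \<in> X"
    using countable_dense_exists by metis
  obtain r where r: "strict_mono r" and rD: "\<And>x. x \<in> D \<Longrightarrow> \<exists>l. (\<lambda>k. h (r k) x) \<longlonglongrightarrow> l"
    using function_convergent_subsequence[OF D(1), of h K] h_bd by blast
  have "Cauchy (\<lambda>k. h (r k) x)" for x
  proof (rule metric_CauchyI)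
    fix e :: real assume e: "e > 0"
    have "x \<in> closure D"
      unfolding closure_approachable
    proof (intro allI impI)
      fix d :: real assume "d > 0"
      then show "\<exists>y\<in>D. dist y x < d" using D(2)[of "ball x d"] by (auto simp: dist_commute)
    qed
    then obtain y where y: "\<And>j. y j \<in> D" "y \<longlonglongrightarrow> x" unfolding closure_sequential by blast
    have "(\<lambda>j. c * sqrt mM * \<omega> x (y j)) \<longlonglongrightarrow> c * sqrt mM * 0"
      by (intro tendsto_mult tendsto_const \<omega>_lim y)
    then have "eventually (\<lambda>j. c * sqrt mM * \<omega> x (y j) < e / 3) sequentially"
      using e by (intro order_tendstoD) auto
    then obtain j where j: "c * sqrt mM * \<omega> x (y j) < e / 3" by (auto simp: eventually_sequentially)
    have "Cauchy (\<lambda>k. h (r k) (y j))" using rD[OF y(1)] by (auto intro: LIMSEQ_imp_Cauchy)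
    then obtain k0 where k0: "\<And>k l. k \<ge> k0 \<Longrightarrow> l \<ge> k0 \<Longrightarrow> dist (h (r k) (y j)) (h (r l) (y j)) < e / 3"
      using e by (metis metric_CauchyD zero_less_divide_iff zero_less_numeral)
    have close: "dist (h k x) (h k (y j)) < e / 3" for k
      using h_equi[of k x "y j"] j by (simp add: dist_norm)
    show "\<exists>M. \<forall>m\<ge>M. \<forall>n\<ge>M. dist (h (r m) x) (h (r n) x) < e"
    proof (intro exI[of _ k0] allI impI)
      fix k l assume kl: "k \<ge> k0" "l \<ge> k0"
      have "dist (h (r k) x) (h (r l) x) \<le> dist (h (r k) x) (h (r k) (y j))
         + dist (h (r k) (y j)) (h (r l) (y j)) + dist (h (r l) (y j)) (h (r l) x)"
        by metric
      also have "\<dots> < e / 3 + e / 3 + e / 3"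
        using close[of "r k"] close[of "r l"] k0[OF kl] by (simp add: dist_commute)
      finally show "dist (h (r k) x) (h (r l) x) < e" by simp
    qed
  qed
  then have "\<exists>l. (\<lambda>k. h (r k) x) \<longlonglongrightarrow> l" for x by (simp add: Cauchy_convergent_iff convergent_def)
  then obtain H where H: "\<And>x. (\<lambda>k. h (r k) x) \<longlonglongrightarrow> H x" by metis
  have h_borel: "h k \<in> borel_measurable M" for k using h[of k] by (simp add: sq_int_def)
  have H_meas: "H \<in> borel_measurable M" by (rule borel_measurable_LIMSEQ_metric[OF h_borel H])
  have H_bd: "cmod (H x) \<le> K" for x
    by (rule Lim_bounded[OF tendsto_norm[OF H]]) (use h_bd in auto)
  have H_sq: "sq_int M H" by (rule M.sq_int_bounded[OF H_meas H_bd])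
  have hH: "(\<lambda>k. nsq M (\<lambda>x. h (r k) x - H x)) \<longlonglongrightarrow> 0"
  proof -
    have "(\<lambda>k. nsq M (\<lambda>x. h (r k) x - H x)) \<longlonglongrightarrow> (\<integral>x. 0 \<partial>M)"
      unfolding nsq_def
    proof (rule integral_dominated_convergence[where w="\<lambda>_. (2 * K)\<^sup>2"])
      show "AE x in M. (\<lambda>k. (cmod (h (r k) x - H x))\<^sup>2) \<longlonglongrightarrow> 0"
      proof (rule AE_I2)
        fix x
        have "(\<lambda>k. (cmod (h (r k) x - H x))\<^sup>2) \<longlonglongrightarrow> (cmod (H x - H x))\<^sup>2" by (intro tendsto_intros H)
        then show "(\<lambda>k. (cmod (h (r k) x - H x))\<^sup>2) \<longlonglongrightarrow> 0" by simp
      qed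
      show "AE x in M. norm ((cmod (h (r k) x - H x))\<^sup>2) \<le> (2 * K)\<^sup>2" for k
      proof (rule AE_I2)
        fix x
        have "cmod (h (r k) x - H x) \<le> 2 * K"
          using norm_triangle_ineq4[of "h (r k) x" "H x"] h_bd[of "r k" x] H_bd[of x] by simp
        from power_mono[OF this, of 2] show "norm ((cmod (h (r k) x - H x))\<^sup>2) \<le> (2 * K)\<^sup>2" by simp
      qed
    qed (use h_borel H_meas in auto)
    then show ?thesis by simp
  qed
  \<comment> \<open>As \<open>h k - \<mu> * f k\<close> tends to 0 and \<open>h (r k)\<close> tends
    to \<open>H\<close>, the functions \<open>f (r k)\<close> must tend to \<open>H / \<mu>\<close>;
    here \<open>\<mu> > eps > 0\<close> is essential.\<close>
  define \<psi> where "\<psi> x = complex_of_real (1 / \<mu>) * H x" for x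
  have psi: "sq_int M \<psi>" unfolding \<psi>_def[abs_def] by (rule sq_int_cmult[OF H_sq])
  have diff: "sq_int M (\<lambda>x. f (r k) x - \<psi> x)" for k by (intro sq_int_diff f psi)
  have f_psi: "(\<lambda>k. nsq M (\<lambda>x. f (r k) x - \<psi> x)) \<longlonglongrightarrow> 0"
  proof (rule tendsto_sandwich[OF _ _ tendsto_const])
    have "nsq M (\<lambda>x. f (r k) x - \<psi> x)
        \<le> (1 / \<mu>)\<^sup>2 * (2 * (\<mu> * (1 / real (Suc (r k)))) + 2 * nsq M (\<lambda>x. h (r k) x - H x))" for k
    proof -
      have "f (r k) x - \<psi> x = complex_of_real (1 / \<mu>) *
          ((complex_of_real \<mu> * f (r k) x - h (r k) x) + (h (r k) x - H x))" for x
        using mu_pos by (simp add: \<psi>_def field_simps)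
      then have "nsq M (\<lambda>x. f (r k) x - \<psi> x) = (1 / \<mu>)\<^sup>2 *
          nsq M (\<lambda>x. (complex_of_real \<mu> * f (r k) x - h (r k) x) + (h (r k) x - H x))"
        by (simp only: nsq_cmult norm_of_real power2_abs)
      also have "nsq M (\<lambda>x. (complex_of_real \<mu> * f (r k) x - h (r k) x) + (h (r k) x - H x))
          \<le> 2 * nsq M (\<lambda>x. complex_of_real \<mu> * f (r k) x - h (r k) x) + 2 * nsq M (\<lambda>x. h (r k) x - H x)"
        by (intro nsq_add_le sq_int_diff sq_int_cmult f h H_sq)
      also have "nsq M (\<lambda>x. complex_of_real \<mu> * f (r k) x - h (r k) x) \<le> \<mu> * (1 / real (Suc (r k)))"
        using h_mu[of "r k"] by (subst nsq_diff_commute)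
      finally show ?thesis by (simp add: mult_left_mono)
    qed
    then show "\<forall>\<^sub>F k in sequentially. nsq M (\<lambda>x. f (r k) x - \<psi> x)
        \<le> (1 / \<mu>)\<^sup>2 * (2 * (\<mu> * (1 / real (Suc (r k)))) + 2 * nsq M (\<lambda>x. h (r k) x - H x))" by simp
    have "(\<lambda>k. 1 / real (Suc (r k))) \<longlonglongrightarrow> 0"
      using LIMSEQ_subseq_LIMSEQ[OF LIMSEQ_Suc[OF lim_1_over_n[where ?'a=real]] r] by (simp add: o_def)
    then have "(\<lambda>k. (1 / \<mu>)\<^sup>2 * (2 * (\<mu> * (1 / real (Suc (r k)))) + 2 * nsq M (\<lambda>x. h (r k) x - H x)))
        \<longlonglongrightarrow> (1 / \<mu>)\<^sup>2 * (2 * (\<mu> * 0) + 2 * 0)"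
      by (intro tendsto_mult tendsto_add tendsto_const hH)
    then show "(\<lambda>k. (1 / \<mu>)\<^sup>2 * (2 * (\<mu> * (1 / real (Suc (r k)))) + 2 * nsq M (\<lambda>x. h (r k) x - H x))) \<longlonglongrightarrow> 0"
      by simp
  qed (simp add: nsq_nonneg)
  have ip_lim: "(\<lambda>k. ip M (f (r k)) g) \<longlonglongrightarrow> ip M \<psi> g" if g: "sq_int M g" for g
  proof (rule LIM_zero_cancel, rule tendsto_norm_zero_cancel, rule tendsto_sandwich[OF _ _ tendsto_const])
    have "norm (ip M (f (r k)) g - ip M \<psi> g) \<le> sqrt (nsq M (\<lambda>x. f (r k) x - \<psi> x) * nsq M g)" for k
      using ip_Cauchy_Schwarz[OF diff g, of k]
      by (intro real_le_rsqrt) (simp add: ip_diff_left[OF f(1) psi g])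
    then show "\<forall>\<^sub>F k in sequentially. norm (ip M (f (r k)) g - ip M \<psi> g)
        \<le> sqrt (nsq M (\<lambda>x. f (r k) x - \<psi> x) * nsq M g)" by simp
    have "(\<lambda>k. sqrt (nsq M (\<lambda>x. f (r k) x - \<psi> x) * nsq M g)) \<longlonglongrightarrow> sqrt (0 * nsq M g)"
      by (intro tendsto_intros f_psi)
    then show "(\<lambda>k. sqrt (nsq M (\<lambda>x. f (r k) x - \<psi> x) * nsq M g)) \<longlonglongrightarrow> 0" by simp
  qed simp
  have orth: "ip M \<psi> (\<phi> i) = 0" if "i < n" for i
    using ip_lim[OF fam_sq_int[OF that]] f(2)[OF that] by (simp add: LIMSEQ_const_iff)
  have unit: "nsq M \<psi> = 1"
  proof -
    have "(\<lambda>k. nsq M (\<lambda>x. f (r k) x - \<psi> x)) \<longlonglongrightarrow> 1 - 2 * Re (ip M \<psi> \<psi>) + nsq M \<psi>"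
      unfolding nsq_diff[OF f(1) psi] f(3) by (intro tendsto_intros ip_lim psi)
    from LIMSEQ_unique[OF this f_psi] show ?thesis by (simp add: ip_self)
  qed
  \<comment> \<open>The pointwise bound on \<open>lim_op\<close> turns norm convergence of
    \<open>f (r k)\<close> into pointwise convergence of the images, so \<open>lim_op \<psi>\<close>
    is \<open>H\<close> at every point.\<close>
  have eig: "lim_op \<psi> x = complex_of_real \<mu> * \<psi> x" for x
  proof -
    have "(\<lambda>k. h (r k) x - lim_op \<psi> x) \<longlonglongrightarrow> 0"
    proof (rule tendsto_norm_zero_cancel, rule tendsto_sandwich[OF _ _ tendsto_const])
      have "norm (h (r k) x - lim_op \<psi> x) \<le> K * sqrt (nsq M (\<lambda>x. f (r k) x - \<psi> x))" for k
        using norm_lim_op_le[OF diff, of k x] by (simp add: lim_op_diff[OF f(1) psi] h_def K_def)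
      then show "\<forall>\<^sub>F k in sequentially. norm (h (r k) x - lim_op \<psi> x) \<le> K * sqrt (nsq M (\<lambda>x. f (r k) x - \<psi> x))"
        by simp
      have "(\<lambda>k. K * sqrt (nsq M (\<lambda>x. f (r k) x - \<psi> x))) \<longlonglongrightarrow> K * sqrt 0"
        by (intro tendsto_intros f_psi)
      then show "(\<lambda>k. K * sqrt (nsq M (\<lambda>x. f (r k) x - \<psi> x))) \<longlonglongrightarrow> 0" by simp
    qed simp
    then have "(\<lambda>k. h (r k) x) \<longlonglongrightarrow> lim_op \<psi> x" by (rule LIM_zero_cancel)
    then have "lim_op \<psi> x = H x" by (rule LIMSEQ_unique) (rule H)
    then show ?thesis using mu_pos by (simp add: \<psi>_def)
  qed
  have orth': "ip M (\<phi> i) \<psi> = 0" if "i < n" for i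
    using orth[OF that] ip_commute[of M "\<phi> i" \<psi>] by simp
  show thesis
  proof (rule that[of \<psi> \<mu>])
    show "eig_family eps (Suc n) (\<phi>(n := \<psi>)) (lam(n := \<mu>))"
      unfolding eig_family_def
      using mu_gt psi eig unit orth orth' fam_sq_int fam_eps fam_eig fam_on
      by (auto simp: less_Suc_eq ip_self)
  qed
qed

end

end

subsection \<open>Functions supported on a set of finite measure\<close>

abbreviation restr :: "r2 set \<Rightarrow> (r2 \<Rightarrow> complex) \<Rightarrow> r2 \<Rightarrow> complex" where
  "restr P f \<equiv> (\<lambda>x. indicator P x * f x)"

lemma indicator_mult_eq_scaleR: "indicator P x * (z :: complex) = indicator P x *\<^sub>R z"
  by (simp split: split_indicator)

text \<open>Fubini and translation arguments live over \<open>lborel\<close>, the theorem over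
  \<open>lebesgue\<close>; Borel representatives carry Plancherel across.\<close>

lemma ex_borel_version:
  fixes f :: "r2 \<Rightarrow> complex"
  assumes f: "f \<in> borel_measurable lebesgue"
  obtains f' where "f' \<in> borel_measurable borel" "AE x in lebesgue. f x = f' x"
proof -
  have "(\<lambda>x. Re (f x)) \<in> borel_measurable lebesgue" "(\<lambda>x. Im (f x)) \<in> borel_measurable lebesgue"
    using f by measurable
  from this[THEN completion_ex_borel_measurable_real]
  obtain g h where g: "g \<in> borel_measurable lborel" "AE x in lborel. Re (f x) = g x"
    and h: "h \<in> borel_measurable lborel" "AE x in lborel. Im (f x) = h x" by blast
  show thesis
  proof (rule that[of "\<lambda>x. Complex (g x) (h x)"])
    have [measurable]: "g \<in> borel_measurable borel" "h \<in> borel_measurable borel" using g h by auto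
    have "(\<lambda>x. complex_of_real (g x) + \<i> * complex_of_real (h x)) \<in> borel_measurable borel" by measurable
    then show "(\<lambda>x. Complex (g x) (h x)) \<in> borel_measurable borel" by (simp add: Complex_eq)
    have "AE x in lborel. f x = Complex (g x) (h x)"
      using g(2) h(2) by eventually_elim (simp add: complex_eq_iff)
    then show "AE x in lebesgue. f x = Complex (g x) (h x)" by (rule AE_completion)
  qed
qed

lemma borel_measurable_lebesgueI: "f \<in> borel_measurable borel \<Longrightarrow> f \<in> borel_measurable lebesgue"
  by (rule measurable_completion) simp

theorem plancherel_lebesgue:
  assumes f1: "integrable lebesgue f" and f2: "sq_int lebesgue f"
  shows "(\<integral>\<^sup>+u. ennreal ((cmod (fourier lebesgue f u))\<^sup>2) \<partial>lebesgue) = ennreal ((2 * pi)\<^sup>2 * nsq lebesgue f)"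
proof -
  have fm: "f \<in> borel_measurable lebesgue" using f1 by auto
  obtain f' where f': "f' \<in> borel_measurable borel" "AE x in lebesgue. f x = f' x"
    using ex_borel_version[OF fm] .
  note [measurable] = f'(1) fm borel_measurable_lebesgueI[OF f'(1)]
  have kern: "(\<lambda>x. cis (- (x \<bullet> u))) \<in> borel_measurable lebesgue" for u :: r2
    by (rule borel_measurable_lebesgueI) measurable
  have "fourier lebesgue f u = ft f' u" for u
  proof -
    have "fourier lebesgue f u = fourier lebesgue f' u"
      unfolding fourier_def by (rule integral_cong_AE) (use f'(2) kern in auto)
    also have "\<dots> = ft f' u" unfolding fourier_def by (rule integral_completion) auto
    finally show ?thesis .
  qed
  moreover have "integrable lborel f'"
  proof -
    have "integrable lebesgue f'"
      using integrable_cong_AE[OF _ _ f'(2)] f1 by (simp add: borel_measurable_lebesgueI f')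
    then show ?thesis by (subst (asm) integrable_completion) auto
  qed
  moreover have s: "sq_int lebesgue f'"
    using f'(2) f2 by (rule sq_int_cong_AE) simp
  have "sq_int lborel f'"
    using s integrable_completion[of "\<lambda>x. (cmod (f' x))\<^sup>2" lborel] by (simp add: sq_int_def)
  moreover have "nsq lebesgue f = nsq lborel f'"
  proof -
    have "nsq lebesgue f = nsq lebesgue f'"
      unfolding nsq_def by (rule integral_cong_AE) (use f'(2) in auto)
    also have "\<dots> = nsq lborel f'" unfolding nsq_def by (rule integral_completion) auto
    finally show ?thesis .
  qed
  ultimately show ?thesis
    using plancherel_lborel[of f'] by (simp add: nn_integral_completion)
qed

context
  fixes P :: "r2 set"
  assumes P: "P \<in> lmeasurable"
begin

lemma sets_lebesgue_Int_space: "P \<inter> space lebesgue \<in> sets lebesgue"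
  using P by (simp add: fmeasurableD)

lemma fourier_lebesgue_on: "fourier (lebesgue_on P) f u = fourier lebesgue (restr P f) u"
  unfolding fourier_def integral_restrict_space[OF sets_lebesgue_Int_space]
  by (simp add: indicator_mult_eq_scaleR)

lemma ip_lebesgue_on: "ip (lebesgue_on P) f g = ip lebesgue (restr P f) (restr P g)"
  unfolding ip_def integral_restrict_space[OF sets_lebesgue_Int_space]
  by (intro Bochner_Integration.integral_cong refl) (simp split: split_indicator)

lemma nsq_lebesgue_on: "nsq (lebesgue_on P) f = nsq lebesgue (restr P f)"
  unfolding nsq_def integral_restrict_space[OF sets_lebesgue_Int_space]
  by (intro Bochner_Integration.integral_cong refl) (simp split: split_indicator)

lemma sq_int_lebesgue_on: "sq_int (lebesgue_on P) f \<longleftrightarrow> sq_int lebesgue (restr P f)"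
proof -
  have "(\<lambda>x. indicator P x *\<^sub>R (cmod (f x))\<^sup>2) = (\<lambda>x. (cmod (indicator P x * f x))\<^sup>2)"
    by (auto split: split_indicator)
  then show ?thesis
    unfolding sq_int_def integrable_restrict_space[OF sets_lebesgue_Int_space] borel_measurable_restrict_space_iff[OF sets_lebesgue_Int_space]
    by (simp add: indicator_mult_eq_scaleR)
qed

lemma finite_measure_lmeasurable: "finite_measure (lebesgue_on P)"
  by (rule finite_measure_lebesgue_on[OF P])

lemma integrable_restr: "sq_int (lebesgue_on P) f \<Longrightarrow> integrable lebesgue (restr P f)"
  using finite_measure.sq_int_integrable[OF finite_measure_lmeasurable, of f]
  unfolding integrable_restrict_space[OF sets_lebesgue_Int_space] by (simp add: indicator_mult_eq_scaleR)

lemma plancherel_on: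
  assumes "sq_int (lebesgue_on P) f"
  shows "(\<integral>\<^sup>+u. ennreal ((cmod (fourier (lebesgue_on P) f u))\<^sup>2) \<partial>lebesgue) = ennreal ((2 * pi)\<^sup>2 * nsq (lebesgue_on P) f)"
  unfolding fourier_lebesgue_on nsq_lebesgue_on
  by (intro plancherel_lebesgue integrable_restr assms sq_int_lebesgue_on[THEN iffD1])

lemma id_lebesgue_on: "(\<lambda>x. x) \<in> borel_measurable (lebesgue_on P)"
  using id_borel_measurable_lebesgue_on[of P] by (simp add: id_def)

text \<open>Makes the linearity and measurability of the transform available for one set
  alone.\<close>

lemma fourier_pair_on: "fourier_pair (lebesgue_on P) (lebesgue_on P) 1"
  using finite_measure_lmeasurable id_lebesgue_on by (simp add: fourier_pair_def fourier_pair_axioms_def)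

lemma fourier_on_measurable:
  assumes "sq_int (lebesgue_on P) f"
  shows "fourier (lebesgue_on P) f \<in> borel_measurable borel"
  using fourier_pair.fourier_measurable_borel[OF fourier_pair_on] assms by (simp add: sq_int_def)

lemma fourier_on_L2:
  assumes "sq_int (lebesgue_on P) f"
  shows "sq_int lebesgue (fourier (lebesgue_on P) f)"
    and "nsq lebesgue (fourier (lebesgue_on P) f) = (2 * pi)\<^sup>2 * nsq (lebesgue_on P) f"
proof -
  have [measurable]: "fourier (lebesgue_on P) f \<in> borel_measurable lebesgue"
    by (intro borel_measurable_lebesgueI fourier_on_measurable assms)
  show 1: "sq_int lebesgue (fourier (lebesgue_on P) f)"
    unfolding sq_int_def integrable_iff_bounded using plancherel_on[OF assms] by simp
  have "ennreal (nsq lebesgue (fourier (lebesgue_on P) f)) = ennreal ((2 * pi)\<^sup>2 * nsq (lebesgue_on P) f)"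
    unfolding plancherel_on[OF assms, symmetric] nsq_def[of lebesgue]
    using 1 by (intro nn_integral_eq_integral[symmetric]) (auto simp: sq_int_def)
  then show "nsq lebesgue (fourier (lebesgue_on P) f) = (2 * pi)\<^sup>2 * nsq (lebesgue_on P) f"
    by (subst (asm) ennreal_inj) (auto simp: nsq_nonneg)
qed

section \<open>The Fourier transform on \<open>L2\<close> as a limit of truncated integrals\<close>

lemma cutoff_sq_int:
  assumes "sq_int (lebesgue_on P) f"
  shows "sq_int (lebesgue_on P) (\<lambda>x. indicator (cball 0 R) x * f x)"
proof -
  have [measurable]: "f \<in> borel_measurable (lebesgue_on P)" using assms by (simp add: sq_int_def)
  have "indicator (cball 0 R) \<in> borel_measurable borel" by (rule borel_measurable_indicator) simp
  from measurable_compose[OF id_lebesgue_on this]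
  have [measurable]: "(indicator (cball 0 R) :: r2 \<Rightarrow> complex) \<in> borel_measurable (lebesgue_on P)" .
  show ?thesis
    unfolding sq_int_def
  proof (intro conjI)
    show "integrable (lebesgue_on P) (\<lambda>x. (cmod (indicator (cball 0 R) x * f x))\<^sup>2)"
      by (rule Bochner_Integration.integrable_bound[of _ "\<lambda>x. (cmod (f x))\<^sup>2"])
         (use assms in \<open>auto simp: sq_int_def norm_mult power_mult_distrib split: split_indicator\<close>)
  qed measurable
qed

lemma nsq_cutoff_tendsto:
  assumes f: "sq_int (lebesgue_on P) f"
  shows "((\<lambda>R. nsq (lebesgue_on P) (\<lambda>x. indicator (cball 0 R) x * f x - f x)) \<longlongrightarrow> 0) at_top"
proof -
  have "((\<lambda>R. nsq (lebesgue_on P) (\<lambda>x. indicator (cball 0 R) x * f x - f x)) \<longlongrightarrow> (\<integral>x. 0 \<partial>(lebesgue_on P))) at_top"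
    unfolding nsq_def
  proof (rule integral_dominated_convergence_at_top[where w="\<lambda>x. (cmod (f x))\<^sup>2"])
    show "\<forall>\<^sub>F R in at_top. AE x in lebesgue_on P. norm ((cmod (indicator (cball 0 R) x * f x - f x))\<^sup>2) \<le> (cmod (f x))\<^sup>2"
      by (intro always_eventually allI AE_I2) (simp split: split_indicator)
    show "AE x in lebesgue_on P. ((\<lambda>R. (cmod (indicator (cball 0 R) x * f x - f x))\<^sup>2) \<longlongrightarrow> 0) at_top"
    proof (rule AE_I2)
      fix x
      have "\<forall>\<^sub>F R in at_top. (cmod (indicator (cball 0 R) x * f x - f x))\<^sup>2 = 0"
        using eventually_ge_at_top[of "norm x"] by eventually_elim simp
      then show "((\<lambda>R. (cmod (indicator (cball 0 R) x * f x - f x))\<^sup>2) \<longlongrightarrow> 0) at_top"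
        by (rule tendsto_eventually)
    qed
    show "(\<lambda>x. (cmod (indicator (cball 0 R) x * f x - f x))\<^sup>2) \<in> borel_measurable (lebesgue_on P)" for R
      using sq_int_diff[OF cutoff_sq_int[OF f] f, of R] unfolding sq_int_def by (blast intro: borel_measurable_integrable)
  qed (use f in \<open>auto simp: sq_int_def\<close>)
  then show ?thesis by simp
qed

lemma fourier_int_cutoff:
  "fourier_int (\<lambda>x. indicator (cball 0 R) x * restr P f x) u = fourier (lebesgue_on P) (\<lambda>x. indicator (cball 0 R) x * f x) u"
proof -
  have "cis (- (x \<bullet> u)) = exp (- \<i> * complex_of_real (x \<bullet> u))" for x :: r2
    by (simp add: cis_conv_exp)
  then show ?thesis
    unfolding fourier_lebesgue_on unfolding fourier_int_def fourier_def
    by (simp add: mult_ac)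
qed

text \<open>By Plancherel the distance of the transforms is a constant times the norm of the
  truncated tail, which vanishes by dominated convergence.\<close>

lemma fourier_cutoff_tendsto:
  assumes f: "sq_int (lebesgue_on P) f"
  shows "((\<lambda>R. \<integral>\<^sup>+u. ennreal ((cmod (fourier_int (\<lambda>x. indicator (cball 0 R) x * restr P f x) u
     - fourier (lebesgue_on P) f u))\<^sup>2) \<partial>lebesgue) \<longlongrightarrow> 0) at_top"
proof -
  interpret fourier_pair "lebesgue_on P" "lebesgue_on P" 1 by (rule fourier_pair_on)
  have "((\<lambda>R. ennreal ((2 * pi)\<^sup>2 * nsq (lebesgue_on P) (\<lambda>x. indicator (cball 0 R) x * f x - f x))) \<longlongrightarrow> ennreal ((2 * pi)\<^sup>2 * 0)) at_top"
    by (intro tendsto_ennrealI tendsto_mult tendsto_const nsq_cutoff_tendsto f)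
  then show ?thesis
    using plancherel_on[OF sq_int_diff[OF cutoff_sq_int[OF f] f]]
    by (simp add: fourier_int_cutoff fourier_diff[OF cutoff_sq_int[OF f] f])
qed

end

text \<open>Needed because \<open>is_eigenfun\<close> only asserts that some limits \<open>g\<close>
  and \<open>h\<close> exist; this pins them down almost everywhere.\<close>

lemma L2_limit_unique:
  assumes meas: "\<And>R. A R \<in> borel_measurable lebesgue" "g \<in> borel_measurable lebesgue" "g' \<in> borel_measurable lebesgue"
    and lim: "((\<lambda>R::real. \<integral>\<^sup>+u. ennreal ((cmod (A R u - g u))\<^sup>2) \<partial>lebesgue) \<longlongrightarrow> 0) at_top"
    and lim': "((\<lambda>R. \<integral>\<^sup>+u. ennreal ((cmod (A R u - g' u))\<^sup>2) \<partial>lebesgue) \<longlongrightarrow> 0) at_top"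
  shows "AE u in (lebesgue :: r2 measure). g u = g' u"
proof -
  note [measurable] = meas
  have le: "(\<integral>\<^sup>+u. ennreal ((cmod (g u - g' u))\<^sup>2) \<partial>lebesgue)
      \<le> 2 * (\<integral>\<^sup>+u. ennreal ((cmod (A R u - g u))\<^sup>2) \<partial>lebesgue) + 2 * (\<integral>\<^sup>+u. ennreal ((cmod (A R u - g' u))\<^sup>2) \<partial>lebesgue)" for R
  proof -
    have "(\<integral>\<^sup>+u. ennreal ((cmod (g u - g' u))\<^sup>2) \<partial>lebesgue)
       \<le> (\<integral>\<^sup>+u. 2 * ennreal ((cmod (A R u - g u))\<^sup>2) + 2 * ennreal ((cmod (A R u - g' u))\<^sup>2) \<partial>lebesgue)"
    proof (rule nn_integral_mono)
      fix u
      have "(cmod (g u - g' u))\<^sup>2 \<le> 2 * (cmod (A R u - g u))\<^sup>2 + 2 * (cmod (A R u - g' u))\<^sup>2"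
        using norm_add_sq_le[of "g u - A R u" "A R u - g' u"] by (simp add: norm_minus_commute)
      then have "ennreal ((cmod (g u - g' u))\<^sup>2) \<le> ennreal (2 * (cmod (A R u - g u))\<^sup>2 + 2 * (cmod (A R u - g' u))\<^sup>2)"
        by (rule ennreal_leI)
      then show "ennreal ((cmod (g u - g' u))\<^sup>2) \<le> 2 * ennreal ((cmod (A R u - g u))\<^sup>2) + 2 * ennreal ((cmod (A R u - g' u))\<^sup>2)"
        by (simp add: ennreal_mult)
    qed
    then show ?thesis by (simp add: nn_integral_add nn_integral_cmult)
  qed
  have "((\<lambda>R. 2 * (\<integral>\<^sup>+u. ennreal ((cmod (A R u - g u))\<^sup>2) \<partial>lebesgue) + 2 * (\<integral>\<^sup>+u. ennreal ((cmod (A R u - g' u))\<^sup>2) \<partial>lebesgue)) \<longlongrightarrow> 2 * 0 + 2 * 0) at_top"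
    by (intro tendsto_add ennreal_tendsto_cmult lim lim') auto
  then have "(\<integral>\<^sup>+u. ennreal ((cmod (g u - g' u))\<^sup>2) \<partial>lebesgue) \<le> 2 * 0 + 2 * 0"
    by (rule tendsto_lowerbound) (use le in auto)
  then have "AE u in lebesgue. ennreal ((cmod (g u - g' u))\<^sup>2) = 0"
    by (subst nn_integral_0_iff_AE[symmetric]) auto
  then show ?thesis by eventually_elim simp
qed

subsection \<open>Eigenfunctions of the limiting operator\<close>

lemma nn_integral_lebesgue_uminus:
  fixes f :: "r2 \<Rightarrow> ennreal"
  assumes [measurable]: "f \<in> borel_measurable borel"
  shows "(\<integral>\<^sup>+x. f (- x) \<partial>lebesgue) = (\<integral>\<^sup>+x. f x \<partial>lebesgue)"
proof -
  have "(lborel :: r2 measure) = distr lborel borel uminus"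
    using lborel_affine[of "-1" "0 :: r2"] by (simp add: density_1)
  then have "(\<integral>\<^sup>+x. f x \<partial>lborel) = (\<integral>\<^sup>+x. f x \<partial>distr lborel borel uminus)" by simp
  also have "\<dots> = (\<integral>\<^sup>+x. f (- x) \<partial>lborel)" by (rule nn_integral_distr) auto
  finally show ?thesis by (simp add: nn_integral_completion)
qed

lemma sq_int_lebesgue_uminus:
  assumes [measurable]: "f \<in> borel_measurable borel" and f: "sq_int lebesgue f"
  shows "sq_int lebesgue (\<lambda>x :: r2. f (- x))"
proof -
  have [measurable]: "(\<lambda>x. f (- x)) \<in> borel_measurable lebesgue"
    by (rule borel_measurable_lebesgueI) measurable
  have "(\<integral>\<^sup>+x. ennreal ((cmod (f (- x)))\<^sup>2) \<partial>lebesgue) = (\<integral>\<^sup>+x. ennreal ((cmod (f x))\<^sup>2) \<partial>lebesgue)"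
    by (rule nn_integral_lebesgue_uminus) measurable
  then show ?thesis using f by (simp add: sq_int_def integrable_iff_bounded)
qed

lemma L2_iff_sq_int: "L2 f \<longleftrightarrow> sq_int lebesgue f"
  by (simp add: L2_def sq_int_def)

lemma sq_int_restr:
  fixes P :: "r2 set"
  assumes f: "sq_int lebesgue f" and P: "P \<in> lmeasurable"
  shows "sq_int (lebesgue_on P) f"
proof -
  have [measurable]: "P \<in> sets lebesgue" using P by (simp add: fmeasurableD)
  have [measurable]: "f \<in> borel_measurable lebesgue" using f by (simp add: sq_int_def)
  have "integrable lebesgue (\<lambda>x. (cmod (restr P f x))\<^sup>2)"
    by (rule Bochner_Integration.integrable_bound[of _ "\<lambda>x. (cmod (f x))\<^sup>2"])
       (use f in \<open>auto simp: sq_int_def split: split_indicator\<close>)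
  then show ?thesis unfolding sq_int_lebesgue_on[OF P] by (simp add: sq_int_def)
qed

lemma L2_fourier_on:
  assumes P: "P \<in> lmeasurable" and f: "sq_int (lebesgue_on P) f"
  shows "L2_fourier (restr P f) (fourier (lebesgue_on P) f)"
  unfolding L2_fourier_def L2_iff_sq_int
  by (intro conjI sq_int_lebesgue_on[OF P, THEN iffD1] fourier_on_L2(1) fourier_cutoff_tendsto P f)

lemma L2_fourier_on_unique:
  assumes P: "P \<in> lmeasurable" and f: "sq_int (lebesgue_on P) f" and g: "L2_fourier (restr P f) g"
  shows "AE u in lebesgue. g u = fourier (lebesgue_on P) f u"
proof (rule L2_limit_unique)
  show "fourier_int (\<lambda>x. indicator (cball 0 R) x * restr P f x) \<in> borel_measurable lebesgue" for R
    using fourier_on_measurable[OF P cutoff_sq_int[OF P f]]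
    by (intro borel_measurable_lebesgueI) (simp add: fourier_int_cutoff[OF P, abs_def])
  show "fourier (lebesgue_on P) f \<in> borel_measurable lebesgue"
    by (intro borel_measurable_lebesgueI fourier_on_measurable[OF P] f)
qed (use g fourier_cutoff_tendsto[OF P f] in \<open>auto simp: L2_fourier_def L2_def\<close>)

lemma inv_fourier_int_cutoff:
  assumes Q: "Q \<in> lmeasurable"
  shows "inv_fourier_int (\<lambda>x. indicator (cball 0 R) x * restr Q g x) x
     = complex_of_real ((2 * pi) powr (-2)) * fourier (lebesgue_on Q) (\<lambda>x. indicator (cball 0 R) x * g x) (- x)"
proof -
  have "cis (- (u \<bullet> - x)) = exp (\<i> * complex_of_real (x \<bullet> u))" for u :: r2
    by (simp add: cis_conv_exp inner_commute)
  then show ?thesis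
    unfolding fourier_lebesgue_on[OF Q] unfolding inv_fourier_int_def fourier_def
    by (simp add: mult_ac)
qed

text \<open>Reflection preserves Lebesgue measure, so the claim is the forward statement multiplied
  by the squared normalising constant.\<close>

lemma inv_fourier_cutoff_tendsto:
  assumes Q: "Q \<in> lmeasurable" and g: "sq_int (lebesgue_on Q) g"
  shows "((\<lambda>R. \<integral>\<^sup>+x. ennreal ((cmod (inv_fourier_int (\<lambda>u. indicator (cball 0 R) u * restr Q g u) x
     - complex_of_real ((2 * pi) powr (-2)) * fourier (lebesgue_on Q) g (- x)))\<^sup>2) \<partial>lebesgue) \<longlongrightarrow> 0) at_top"
proof -
  let ?c = "(2 * pi) powr (-2)"
  let ?F = "fourier (lebesgue_on Q)"
  let ?g = "\<lambda>R x. indicator (cball 0 R) x * g x"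
  have eq: "(\<integral>\<^sup>+x. ennreal ((cmod (inv_fourier_int (\<lambda>u. indicator (cball 0 R) u * restr Q g u) x
      - complex_of_real ?c * ?F g (- x)))\<^sup>2) \<partial>lebesgue)
    = ennreal (?c\<^sup>2) * (\<integral>\<^sup>+u. ennreal ((cmod (fourier_int (\<lambda>u. indicator (cball 0 R) u * restr Q g u) u - ?F g u))\<^sup>2) \<partial>lebesgue)" for R
  proof -
    have [measurable]: "?F (?g R) \<in> borel_measurable borel" "?F g \<in> borel_measurable borel"
      by (intro fourier_on_measurable[OF Q] g cutoff_sq_int[OF Q])+
    have "(\<integral>\<^sup>+x. ennreal ((cmod (inv_fourier_int (\<lambda>u. indicator (cball 0 R) u * restr Q g u) x
        - complex_of_real ?c * ?F g (- x)))\<^sup>2) \<partial>lebesgue)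
      = (\<integral>\<^sup>+x. ennreal ((cmod (complex_of_real ?c * (?F (?g R) (- x) - ?F g (- x))))\<^sup>2) \<partial>lebesgue)"
      by (simp only: inv_fourier_int_cutoff[OF Q] right_diff_distrib)
    also have "\<dots> = (\<integral>\<^sup>+x. ennreal ((cmod (complex_of_real ?c * (?F (?g R) x - ?F g x)))\<^sup>2) \<partial>lebesgue)"
      by (rule nn_integral_lebesgue_uminus[of "\<lambda>x. ennreal ((cmod (complex_of_real ?c * (?F (?g R) x - ?F g x)))\<^sup>2)"]) measurable
    also have "\<dots> = (\<integral>\<^sup>+x. ennreal (?c\<^sup>2) * ennreal ((cmod (?F (?g R) x - ?F g x))\<^sup>2) \<partial>lebesgue)"
      by (simp only: norm_mult norm_of_real power_mult_distrib power2_abs) (simp add: ennreal_mult)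
    also have "\<dots> = ennreal (?c\<^sup>2) * (\<integral>\<^sup>+x. ennreal ((cmod (?F (?g R) x - ?F g x))\<^sup>2) \<partial>lebesgue)"
      by (rule nn_integral_cmult) (rule measurable_completion, measurable)
    finally show ?thesis by (simp only: fourier_int_cutoff[OF Q])
  qed
  have "((\<lambda>R. ennreal (?c\<^sup>2) * (\<integral>\<^sup>+u. ennreal ((cmod (fourier_int (\<lambda>u. indicator (cball 0 R) u * restr Q g u) u - ?F g u))\<^sup>2) \<partial>lebesgue))
    \<longlongrightarrow> ennreal (?c\<^sup>2) * 0) at_top"
    by (intro ennreal_tendsto_cmult fourier_cutoff_tendsto Q g) auto
  then show ?thesis unfolding eq by simp
qed

lemma L2_inv_fourier_on:
  assumes Q: "Q \<in> lmeasurable" and g: "sq_int (lebesgue_on Q) g"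
  shows "L2_inv_fourier (restr Q g) (\<lambda>x. complex_of_real ((2 * pi) powr (-2)) * fourier (lebesgue_on Q) g (- x))"
  unfolding L2_inv_fourier_def L2_iff_sq_int
  by (intro conjI sq_int_lebesgue_on[OF Q, THEN iffD1] sq_int_cmult sq_int_lebesgue_uminus fourier_on_measurable
      fourier_on_L2(1) inv_fourier_cutoff_tendsto Q g)

lemma L2_inv_fourier_on_unique:
  assumes Q: "Q \<in> lmeasurable" and g: "sq_int (lebesgue_on Q) g" and h: "L2_inv_fourier (restr Q g) h"
  shows "AE x in lebesgue. h x = complex_of_real ((2 * pi) powr (-2)) * fourier (lebesgue_on Q) g (- x)"
proof (rule L2_limit_unique)
  show "inv_fourier_int (\<lambda>x. indicator (cball 0 R) x * restr Q g x) \<in> borel_measurable lebesgue" for R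
  proof -
    have [measurable]: "fourier (lebesgue_on Q) (\<lambda>x. indicator (cball 0 R) x * g x) \<in> borel_measurable borel"
      by (intro fourier_on_measurable[OF Q] cutoff_sq_int[OF Q] g)
    show ?thesis
      by (intro borel_measurable_lebesgueI) (simp add: inv_fourier_int_cutoff[OF Q, abs_def])
  qed
  have [measurable]: "fourier (lebesgue_on Q) g \<in> borel_measurable borel" by (intro fourier_on_measurable[OF Q] g)
  show "(\<lambda>x. complex_of_real ((2 * pi) powr (-2)) * fourier (lebesgue_on Q) g (- x)) \<in> borel_measurable lebesgue"
    by (intro borel_measurable_lebesgueI) measurable
qed (use h inv_fourier_cutoff_tendsto[OF Q g] in \<open>auto simp: L2_inv_fourier_def L2_def\<close>)

text \<open>The function \<open>g\<close> in \<open>is_eigenfun\<close> agrees with the integral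
  transform only almost everywhere; the inverse integrals do not see the difference.\<close>

lemma inv_fourier_int_cong_AE:
  assumes "AE u in lebesgue. g u = g' u" "g \<in> borel_measurable lebesgue" "g' \<in> borel_measurable lebesgue"
  shows "inv_fourier_int (\<lambda>u. indicator (cball 0 R) u * g u) x = inv_fourier_int (\<lambda>u. indicator (cball 0 R) u * g' u) x"
proof -
  have [measurable]: "(\<lambda>u. exp (\<i> * complex_of_real (x \<bullet> u))) \<in> borel_measurable lebesgue"
    by (rule borel_measurable_lebesgueI) measurable
  have [measurable]: "indicator (cball 0 R) \<in> borel_measurable (lebesgue :: r2 measure)"
    by (rule borel_measurable_lebesgueI) (rule borel_measurable_indicator, simp)
  note [measurable] = assms(2,3)
  have "(\<integral>u. indicator (cball 0 R) u * g u * exp (\<i> * complex_of_real (x \<bullet> u)) \<partial>lebesgue)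
      = (\<integral>u. indicator (cball 0 R) u * g' u * exp (\<i> * complex_of_real (x \<bullet> u)) \<partial>lebesgue)"
    by (rule integral_cong_AE) (use assms(1) in auto)
  then show ?thesis by (simp only: inv_fourier_int_def)
qed

locale limiting_sets =
  fixes P Q :: "r2 set"
  assumes P: "P \<in> lmeasurable" and Q: "Q \<in> lmeasurable"
begin

sublocale fourier_pair "lebesgue_on P" "lebesgue_on Q" "(2 * pi) powr (-2)"
  using finite_measure_lmeasurable[OF P] finite_measure_lmeasurable[OF Q] id_lebesgue_on[OF P] id_lebesgue_on[OF Q]
  by (simp add: fourier_pair_def fourier_pair_axioms_def)

lemma AE_on_iff: "(AE x in lebesgue_on P. R x) \<longleftrightarrow> (AE x in lebesgue. x \<in> P \<longrightarrow> R x)"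
  using AE_restrict_space_iff[OF sets_lebesgue_Int_space[OF P]] by simp

text \<open>For a nonzero eigenvalue the equation expresses \<open>f\<close> through a function cut
  off to \<open>P\<close>, so \<open>f\<close> vanishes almost everywhere outside \<open>P\<close>.
  The problem thereby moves from the plane to \<open>P\<close>.\<close>

lemma eigenfun_imp:
  assumes ef: "is_eigenfun P Q l f" and l: "l > 0"
  shows "sq_int (lebesgue_on P) f"
    and "AE x in lebesgue_on P. lim_op f x = complex_of_real l * f x"
    and "AE x in lebesgue. f x = restr P f x"
proof -
  obtain g h where f: "L2 f" and g: "L2_fourier (restr P f) g" and h: "L2_inv_fourier (restr Q g) h"
    and e: "AE x in lebesgue. indicator P x * h x = complex_of_real l * f x"
    using ef unfolding is_eigenfun_def by blast
  show f': "sq_int (lebesgue_on P) f"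
    using f P by (intro sq_int_restr) (auto simp: L2_iff_sq_int)
  let ?F = "fourier (lebesgue_on P) f"
  have gF: "AE u in lebesgue. g u = ?F u" by (rule L2_fourier_on_unique[OF P f' g])
  have gm: "g \<in> borel_measurable lebesgue" using g by (simp add: L2_fourier_def L2_def)
  have Fm: "?F \<in> borel_measurable lebesgue" by (intro borel_measurable_lebesgueI fourier_on_measurable[OF P] f')
  have Qs[measurable]: "Q \<in> sets lebesgue" using Q by (simp add: fmeasurableD)
  have FQ: "sq_int (lebesgue_on Q) ?F" by (rule fourier_sq_int[OF f'])
  have "L2_inv_fourier (restr Q ?F) h"
  proof -
    have "AE u in lebesgue. restr Q g u = restr Q ?F u" using gF by eventually_elim simp
    from inv_fourier_int_cong_AE[OF this] gm Fm
    have "inv_fourier_int (\<lambda>u. indicator (cball 0 R) u * restr Q g u) x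
        = inv_fourier_int (\<lambda>u. indicator (cball 0 R) u * restr Q ?F u) x" for R x
      by measurable
    then show ?thesis
      using h FQ by (simp add: L2_inv_fourier_def L2_iff_sq_int sq_int_lebesgue_on[OF Q])
  qed
  from L2_inv_fourier_on_unique[OF Q FQ this]
  have hl: "AE x in lebesgue. h x = lim_op f x" by (simp add: lim_op_def)
  show "AE x in lebesgue_on P. lim_op f x = complex_of_real l * f x"
    unfolding AE_on_iff using hl e by eventually_elim auto
  show "AE x in lebesgue. f x = restr P f x"
    using e by eventually_elim (use l in \<open>auto split: split_indicator\<close>)
qed

lemma eigenfun_restr:
  assumes f: "sq_int (lebesgue_on P) f" and e: "AE x in lebesgue_on P. lim_op f x = complex_of_real l * f x"
  shows "is_eigenfun P Q l (restr P f)"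
  unfolding is_eigenfun_def
proof (intro conjI exI)
  show "L2 (restr P f)" using f by (simp add: L2_iff_sq_int sq_int_lebesgue_on[OF P])
  show "L2_fourier (\<lambda>x. indicator P x * restr P f x) (fourier (lebesgue_on P) f)"
    using L2_fourier_on[OF P f] by (simp add: indicator_inter_arith[symmetric] flip: mult.assoc)
  show "L2_inv_fourier (\<lambda>u. indicator Q u * fourier (lebesgue_on P) f u) (lim_op f)"
    unfolding lim_op_def[abs_def] by (rule L2_inv_fourier_on[OF Q fourier_sq_int[OF f]])
  show "AE x in lebesgue. indicator P x * lim_op f x = complex_of_real l * restr P f x"
    using e unfolding AE_on_iff by eventually_elim (simp split: split_indicator)
qed

text \<open>As \<open>eps\<close> is positive, every counted eigenfunction is supported on
  \<open>P\<close>, so inner products over the plane and over \<open>P\<close> agree; conversely,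
  functions on \<open>P\<close> are extended by zero.\<close>

lemma eig_count_eq:
  assumes eps: "eps > 0"
  shows "eig_count P Q eps = Sup {n. \<exists>\<phi> lam. eig_family eps n \<phi> lam}"
proof -
  have 1: "eig_family eps n fs lams"
    if a: "\<forall>i<n. eps \<le> lams i \<and> is_eigenfun P Q (lams i) (fs i)"
      and b: "\<forall>i<n. \<forall>j<n. L2_inner (fs i) (fs j) = (if i = j then 1 else 0)" for n fs lams
  proof -
    have pos: "lams i > 0" if "i < n" for i using a eps that less_le_trans by blast
    note ev = eigenfun_imp[OF a[rule_format, THEN conjunct2] pos]
    have "ip (lebesgue_on P) (fs i) (fs j) = L2_inner (fs i) (fs j)" if "i < n" "j < n" for i j
    proof -
      have m: "sq_int lebesgue (fs k)" "sq_int lebesgue (restr P (fs k))" if "k < n" for k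
        using a that ev(1)[OF that that] by (auto simp: is_eigenfun_def L2_iff_sq_int sq_int_lebesgue_on[OF P])
      have "ip lebesgue (restr P (fs i)) (restr P (fs j)) = ip lebesgue (fs i) (fs j)"
        using ev(3)[of i] ev(3)[of j] m[of i] m[of j] that
        by (intro ip_cong_AE) (auto simp: sq_int_def elim: eventually_mono)
      then show ?thesis unfolding ip_lebesgue_on[OF P] L2_inner_def by (simp only: ip_def)
    qed
    then show ?thesis unfolding eig_family_def using a b ev by auto
  qed
  have 2: "\<exists>fs lams. (\<forall>i<n. eps \<le> lams i \<and> is_eigenfun P Q (lams i) (fs i)) \<and>
      (\<forall>i<n. \<forall>j<n. L2_inner (fs i) (fs j) = (if i = j then 1 else 0))"
    if "eig_family eps n \<phi> lam" for n \<phi> lam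
  proof (intro exI[of _ "\<lambda>i. restr P (\<phi> i)"] exI[of _ lam] conjI allI impI)
    fix i assume "i < n"
    then show "eps \<le> lam i" "is_eigenfun P Q (lam i) (restr P (\<phi> i))"
      using that by (auto simp: eig_family_def intro!: eigenfun_restr)
    fix j assume "j < n"
    with \<open>i < n\<close> have "ip (lebesgue_on P) (\<phi> i) (\<phi> j) = (if i = j then 1 else 0)"
      using that by (auto simp: eig_family_def)
    then show "L2_inner (restr P (\<phi> i)) (restr P (\<phi> j)) = (if i = j then 1 else 0)"
      unfolding ip_lebesgue_on[OF P] by (simp only: L2_inner_def ip_def)
  qed
  have "{n. \<exists>fs lams. (\<forall>i<n. eps \<le> lams i \<and> is_eigenfun P Q (lams i) (fs i)) \<and>
      (\<forall>i<n. \<forall>j<n. L2_inner (fs i) (fs j) = (if i = j then 1 else 0))} = {n. \<exists>\<phi> lam. eig_family eps n \<phi> lam}"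
    using 1 2 by (intro Collect_cong iffI) blast+
  then show ?thesis unfolding eig_count_def by (rule arg_cong)
qed

end

subsection \<open>Counting eigenvalues\<close>

lemma two_pi_powr: "(2 * pi) powr (-2) * (2 * pi)\<^sup>2 = 1"
  by (simp add: powr_minus powr_realpow)

lemma nn_integral_lborel_reflect:
  fixes f :: "r2 \<Rightarrow> ennreal"
  assumes [measurable]: "f \<in> borel_measurable borel"
  shows "(\<integral>\<^sup>+u. f (v - u) \<partial>lborel) = (\<integral>\<^sup>+u. f u \<partial>lborel)"
proof -
  have "(\<integral>\<^sup>+u. f (v - u) \<partial>lborel) = (\<integral>\<^sup>+u. f (- u + v) \<partial>lborel)" by simp
  also have "\<dots> = (\<integral>\<^sup>+u. f (u + v) \<partial>lborel)"
    using nn_integral_lebesgue_uminus[of "\<lambda>u. f (u + v)"] by (simp add: nn_integral_completion)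
  also have "\<dots> = (\<integral>\<^sup>+u. f u \<partial>lborel)" by (rule nn_integral_lborel_shift) fact
  finally show ?thesis .
qed

context limiting_sets
begin

lemma mM_eq: "mM = measure lebesgue P" and mN_eq: "mN = measure lebesgue Q"
  using P Q by (auto simp: mM_def mN_def measure_restrict_space fmeasurableD)

lemma nn_integral_fourier_1:
  "(\<integral>\<^sup>+w. ennreal ((cmod (fourier (lebesgue_on P) (\<lambda>_. 1) w))\<^sup>2) \<partial>lborel) = ennreal ((2 * pi)\<^sup>2 * mM)"
proof -
  have "sq_int (lebesgue_on P) (\<lambda>_. 1)" by (rule M.sq_int_bounded[where B=1]) auto
  from plancherel_on[OF P this] show ?thesis
    by (simp add: nn_integral_completion nsq_def mM_def)
qed

lemma ennreal_nsq_fourier_wave: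
  "ennreal (nsq (lebesgue_on Q) (fourier (lebesgue_on P) (wave u)))
    = (\<integral>\<^sup>+v. ennreal ((cmod (fourier (lebesgue_on P) (\<lambda>_. 1) (v - u)))\<^sup>2) \<partial>lebesgue_on Q)"
  unfolding nsq_def fourier_wave[symmetric]
  using fourier_sq_int[OF wave_sq_int(1)]
  by (intro nn_integral_eq_integral[symmetric]) (auto simp: sq_int_def)

text \<open>By Tonelli the frequency \<open>u\<close> is integrated first; after the reflection
  \<open>v - u\<close> this inner integral is Plancherel for the indicator of \<open>P\<close>,
  independent of \<open>v\<close>.\<close>

lemma
  shows wave_integrable: "integrable lebesgue (\<lambda>u. nsq (lebesgue_on Q) (fourier (lebesgue_on P) (wave u)))"
    and wave_integral: "(\<integral>u. nsq (lebesgue_on Q) (fourier (lebesgue_on P) (wave u)) \<partial>lebesgue) = (2 * pi)\<^sup>2 * mM * mN"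
proof -
  let ?W = "\<lambda>u. nsq (lebesgue_on Q) (fourier (lebesgue_on P) (wave u))"
  let ?D = "\<lambda>w. ennreal ((cmod (fourier (lebesgue_on P) (\<lambda>_. 1) w))\<^sup>2)"
  have Dm: "?D \<in> borel_measurable borel" using fourier_1_measurable by measurable
  interpret LN: pair_sigma_finite lborel "lebesgue_on Q" ..
  have "(\<integral>\<^sup>+u. ennreal (?W u) \<partial>lebesgue) = (\<integral>\<^sup>+u. \<integral>\<^sup>+v. ?D (v - u) \<partial>lebesgue_on Q \<partial>lborel)"
    by (simp add: nn_integral_completion ennreal_nsq_fourier_wave)
  also have "\<dots> = (\<integral>\<^sup>+v. \<integral>\<^sup>+u. ?D (v - u) \<partial>lborel \<partial>lebesgue_on Q)"
  proof (rule LN.Fubini'[symmetric])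
    show "(\<lambda>(u, v). ?D (v - u)) \<in> borel_measurable (lborel \<Otimes>\<^sub>M lebesgue_on Q)"
      unfolding split_beta'
      by (rule measurable_compose[OF borel_measurable_diff[OF measurable_compose[OF measurable_snd idN]] Dm])
         (use measurable_fst[of lborel "lebesgue_on Q"] in \<open>simp cong: measurable_cong_sets\<close>)
  qed
  also have "\<dots> = (\<integral>\<^sup>+v. ennreal ((2 * pi)\<^sup>2 * mM) \<partial>lebesgue_on Q)"
    by (simp only: nn_integral_lborel_reflect[OF Dm] nn_integral_fourier_1)
  also have "\<dots> = ennreal ((2 * pi)\<^sup>2 * mM * mN)"
    using mM_nonneg mN_nonneg by (simp add: N.emeasure_eq_measure ennreal_mult mN_def del: space_lebesgue_on)
  finally have *: "(\<integral>\<^sup>+u. ennreal (?W u) \<partial>lebesgue) = ennreal ((2 * pi)\<^sup>2 * mM * mN)" .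
  have Wm: "?W \<in> borel_measurable lebesgue" by (rule borel_measurable_lebesgueI[OF nsq_fourier_wave_measurable])
  then show i: "integrable lebesgue ?W"
    using * by (simp add: integrable_iff_bounded nsq_nonneg)
  have "ennreal (\<integral>u. ?W u \<partial>lebesgue) = ennreal ((2 * pi)\<^sup>2 * mM * mN)"
    unfolding *[symmetric] by (rule nn_integral_eq_integral[symmetric, OF i]) (simp add: nsq_nonneg)
  then show "(\<integral>u. ?W u \<partial>lebesgue) = (2 * pi)\<^sup>2 * mM * mN"
    using mM_nonneg mN_nonneg by (subst (asm) ennreal_inj) (auto simp: nsq_nonneg)
qed

text \<open>This is \<open>tr (A - A\<^sup>2)\<close> for the limiting operator \<open>A\<close>.\<close>

definition trace_defect :: real where
  "trace_defect = (2 * pi) powr (-2) * mM * mN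
     - ((2 * pi) powr (-2))\<^sup>2 * (\<integral>u. nsq (lebesgue_on Q) (fourier (lebesgue_on P) (wave u)) \<partial>lebesgue_on Q)"

lemma integral_compl:
  fixes f :: "r2 \<Rightarrow> real"
  assumes f: "integrable lebesgue f"
  shows "integrable lebesgue (\<lambda>u. indicator (- Q) u * f u)"
    and "(\<integral>u. indicator (- Q) u * f u \<partial>lebesgue) = (\<integral>u. f u \<partial>lebesgue) - (\<integral>u. f u \<partial>lebesgue_on Q)"
proof -
  have Qs[measurable]: "Q \<in> sets lebesgue" using Q by (simp add: fmeasurableD)
  have 1: "integrable lebesgue (\<lambda>u. indicator Q u * f u)"
    using f Qs by (simp add: integrable_mult_indicator[of Q lebesgue f, simplified])
  have 2: "indicator (- Q) u * f u = f u - indicator Q u * f u" for u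
    by (simp split: split_indicator)
  show "integrable lebesgue (\<lambda>u. indicator (- Q) u * f u)" unfolding 2 using f 1 by simp
  show "(\<integral>u. indicator (- Q) u * f u \<partial>lebesgue) = (\<integral>u. f u \<partial>lebesgue) - (\<integral>u. f u \<partial>lebesgue_on Q)"
    unfolding 2 using f 1 by (simp add: integral_restrict_space[OF sets_lebesgue_Int_space[OF Q]])
qed

text \<open>By \<open>wave_integral\<close> the trace is the integral over the whole plane of what
  gives tr A^2 when integrated over \<open>Q\<close>. This form shows that the defect is
  nonnegative.\<close>

lemma trace_defect_eq: "trace_defect = ((2 * pi) powr (-2))\<^sup>2 *
    (\<integral>u. indicator (- Q) u * nsq (lebesgue_on Q) (fourier (lebesgue_on P) (wave u)) \<partial>lebesgue)"
proof -
  have "a\<^sup>2 * (b * mM * mN) = a * (a * b) * mM * mN" for a b :: real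
    by (simp add: power2_eq_square)
  from this[of "(2 * pi) powr (-2)" "(2 * pi)\<^sup>2"]
  have "((2 * pi) powr (-2))\<^sup>2 * ((2 * pi)\<^sup>2 * mM * mN) = (2 * pi) powr (-2) * ((2 * pi) powr (-2) * (2 * pi)\<^sup>2) * mM * mN" .
  then show ?thesis
    unfolding trace_defect_def integral_compl(2)[OF wave_integrable] wave_integral right_diff_distrib
    by (simp only: two_pi_powr mult_1_right)
qed

text \<open>By Plancherel the transform of a unit function has total energy
  \<open>(2 * pi)\<^sup>2\<close>. The share on \<open>Q\<close> is the eigenvalue, so the share off
  \<open>Q\<close> is its distance to 1.\<close>

lemma fam_compl:
  assumes fam: "eig_family eps n \<phi> lam" and eps: "eps > 0" and i: "i < n"
  shows "integrable lebesgue (\<lambda>u. (cmod (fourier (lebesgue_on P) (\<phi> i) u))\<^sup>2)"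
    and "1 - lam i = (2 * pi) powr (-2) * (\<integral>u. indicator (- Q) u * (cmod (fourier (lebesgue_on P) (\<phi> i) u))\<^sup>2 \<partial>lebesgue)"
    and "lam i \<le> 1"
proof -
  note f = fam_sq_int[OF fam eps i]
  have "nsq (lebesgue_on P) (\<phi> i) = 1"
    using fam_on[OF fam eps i i] unfolding ip_self by (simp add: of_real_eq_1_iff)
  then have 1: "(\<integral>u. (cmod (fourier (lebesgue_on P) (\<phi> i) u))\<^sup>2 \<partial>lebesgue) = (2 * pi)\<^sup>2"
    using fourier_on_L2(2)[OF P f] by (simp add: nsq_def[of lebesgue])
  show int: "integrable lebesgue (\<lambda>u. (cmod (fourier (lebesgue_on P) (\<phi> i) u))\<^sup>2)"
    using fourier_on_L2(1)[OF P f] by (simp add: sq_int_def)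
  show eq: "1 - lam i = (2 * pi) powr (-2) * (\<integral>u. indicator (- Q) u * (cmod (fourier (lebesgue_on P) (\<phi> i) u))\<^sup>2 \<partial>lebesgue)"
    unfolding integral_compl(2)[OF int] 1 right_diff_distrib two_pi_powr fam_nsq_fourier[OF fam eps i] nsq_def ..
  have "0 \<le> (\<integral>u. indicator (- Q) u * (cmod (fourier (lebesgue_on P) (\<phi> i) u))\<^sup>2 \<partial>lebesgue)"
    by (rule integral_nonneg_AE) simp
  then have "0 \<le> 1 - lam i" unfolding eq by simp
  then show "lam i \<le> 1" by simp
qed

text \<open>Weighting \<open>fam_compl\<close> by \<open>lam i\<close> and applying
  \<open>fam_bessel_dual\<close> at the frequencies outside \<open>Q\<close> bounds the sum of
  \<open>lam i * (1 - lam i)\<close> by \<open>trace_defect\<close>.\<close>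

lemma fam_upper:
  assumes fam: "eig_family eps n \<phi> lam" and eps: "eps > 0"
  shows "real n \<le> (2 * pi) powr (-2) * mM * mN + trace_defect / eps"
proof -
  let ?c = "(2 * pi) powr (-2)"
  let ?F = "\<lambda>i u. (cmod (fourier (lebesgue_on P) (\<phi> i) u))\<^sup>2"
  let ?W = "\<lambda>u. nsq (lebesgue_on Q) (fourier (lebesgue_on P) (wave u))"
  note int = integral_compl(1)[OF fam_compl(1)[OF fam eps]]
  have "(\<Sum>i<n. lam i * (1 - lam i)) = (\<Sum>i<n. ?c * (lam i * (\<integral>u. indicator (- Q) u * ?F i u \<partial>lebesgue)))"
    by (intro sum.cong refl) (simp add: fam_compl(2)[OF fam eps])
  also have "\<dots> = ?c * (\<Sum>i<n. \<integral>u. lam i * (indicator (- Q) u * ?F i u) \<partial>lebesgue)"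
    by (simp add: sum_distrib_left)
  also have "(\<Sum>i<n. \<integral>u. lam i * (indicator (- Q) u * ?F i u) \<partial>lebesgue)
      = (\<integral>u. (\<Sum>i<n. lam i * (indicator (- Q) u * ?F i u)) \<partial>lebesgue)"
    using int by (intro Bochner_Integration.integral_sum[symmetric]) simp
  also have "\<dots> \<le> (\<integral>u. ?c * (indicator (- Q) u * ?W u) \<partial>lebesgue)"
  proof (rule integral_mono)
    show "integrable lebesgue (\<lambda>u. \<Sum>i<n. lam i * (indicator (- Q) u * ?F i u))"
      using int by (intro Bochner_Integration.integrable_sum integrable_mult_right) simp
    show "integrable lebesgue (\<lambda>u. ?c * (indicator (- Q) u * ?W u))"
      by (intro integrable_mult_right integral_compl(1) wave_integrable)
    fix u
    have "(\<Sum>i<n. lam i * (indicator (- Q) u * ?F i u)) = indicator (- Q) u * (\<Sum>i<n. lam i * ?F i u)"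
      by (simp add: sum_distrib_left mult_ac)
    also have "\<dots> \<le> indicator (- Q) u * (?c * ?W u)"
      by (intro mult_left_mono fam_bessel_dual[OF fam eps]) simp
    finally show "(\<Sum>i<n. lam i * (indicator (- Q) u * ?F i u)) \<le> ?c * (indicator (- Q) u * ?W u)"
      by (simp add: mult_ac)
  qed
  also have "\<dots> = ?c * (\<integral>u. indicator (- Q) u * ?W u \<partial>lebesgue)"
    by (rule integral_mult_right_zero)
  finally have "(\<Sum>i<n. lam i * (1 - lam i)) \<le> ?c * (?c * (\<integral>u. indicator (- Q) u * ?W u \<partial>lebesgue))"
    by (simp add: mult_left_mono)
  then have def: "(\<Sum>i<n. lam i * (1 - lam i)) \<le> trace_defect"
    unfolding trace_defect_eq power2_eq_square mult.assoc .
  have "real n = (\<Sum>i<n. lam i + (1 - lam i))" by simp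
  also have "\<dots> \<le> (\<Sum>i<n. lam i + lam i * (1 - lam i) / eps)"
  proof (intro sum_mono add_left_mono)
    fix i assume "i \<in> {..<n}"
    then have l: "eps \<le> lam i" "lam i \<le> 1" using fam_eps[OF fam eps] fam_compl(3)[OF fam eps] by auto
    have "eps * (1 - lam i) \<le> lam i * (1 - lam i)" using l by (intro mult_right_mono) auto
    then show "1 - lam i \<le> lam i * (1 - lam i) / eps" using eps by (simp add: field_simps)
  qed
  also have "\<dots> = (\<Sum>i<n. lam i) + (\<Sum>i<n. lam i * (1 - lam i)) / eps"
    by (simp only: sum.distrib sum_divide_distrib)
  also have "\<dots> \<le> ?c * mM * mN + trace_defect / eps"
    using fam_trace[OF fam eps] def eps by (intro add_mono divide_right_mono) auto
  finally show ?thesis .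
qed

theorem eig_count_estimate:
  assumes eps: "0 < eps" "eps < 1"
  shows "\<bar>real (eig_count P Q eps) - (2 * pi) powr (-2) * mM * mN\<bar> \<le> trace_defect * (1 / eps + 1 / (1 - eps))"
proof -
  define X where "X = {n. \<exists>\<phi> lam. eig_family eps n \<phi> lam}"
  let ?m = "(2 * pi) powr (-2) * mM * mN"
  have bound: "real n \<le> ?m + trace_defect / eps" if "n \<in> X" for n
    using that fam_upper[OF _ eps(1)] by (auto simp: X_def)
  have fin: "finite X"
  proof (rule finite_subset)
    show "X \<subseteq> {.. nat \<lfloor>?m + trace_defect / eps\<rfloor>}" using bound by (auto simp: le_nat_floor)
  qed simp
  \<comment> \<open>The empty family. With finiteness it turns the supremum into an attained
    maximum.\<close>
  have "0 \<in> X" by (auto simp: X_def eig_family_def)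
  then have ne: "X \<noteq> {}" by blast
  have N: "eig_count P Q eps = Max X"
    using ne fin unfolding eig_count_eq[OF eps(1)] X_def[symmetric] by (simp add: Sup_nat_def)
  define n where "n = Max X"
  obtain \<phi> lam where fam: "eig_family eps n \<phi> lam" using Max_in[OF fin ne] by (auto simp: X_def n_def)
  have "Suc n \<notin> X" using Max_ge[OF fin, of "Suc n"] by (auto simp: n_def)
  then have "\<not> eig_family eps (Suc n) \<phi>' lam'" for \<phi>' lam' by (auto simp: X_def)
  \<comment> \<open>A violating \<open>f\<close> would let \<open>fam_extend\<close> produce a
    family of size \<open>Suc n\<close>.\<close>
  then have max: "(2 * pi) powr (-2) * nsq (lebesgue_on Q) (fourier (lebesgue_on P) f) \<le> eps * nsq (lebesgue_on P) f"
    if "sq_int (lebesgue_on P) f" "\<And>i. i < n \<Longrightarrow> ip (lebesgue_on P) f (\<phi> i) = 0" for f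
    using fam_extend[OF fam eps(1) that] by force
  have "((2 * pi) powr (-2))\<^sup>2 * (\<integral>u. nsq (lebesgue_on Q) (fourier (lebesgue_on P) (wave u)) \<partial>lebesgue_on Q)
      \<le> (1 - eps) * real n + eps * ?m"
    by (rule fam_hs_estimate[OF fam eps(1) max fam_compl(3)[OF fam eps(1)] eps(2)])
  then have "?m - trace_defect \<le> (1 - eps) * real n + eps * ?m" by (simp add: trace_defect_def)
  then have "(1 - eps) * (?m - real n) \<le> trace_defect" by (simp add: algebra_simps)
  then have lower: "?m - real n \<le> trace_defect / (1 - eps)" using eps by (simp add: field_simps)
  have upper: "real n - ?m \<le> trace_defect / eps" using bound[OF Max_in[OF fin ne]] by (simp add: n_def)
  have "0 \<le> trace_defect"
    unfolding trace_defect_eq by (intro mult_nonneg_nonneg integral_nonneg_AE) (auto simp: nsq_nonneg)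
  then have "0 \<le> trace_defect / eps" "0 \<le> trace_defect / (1 - eps)" using eps by auto
  with lower upper show ?thesis
    unfolding N n_def[symmetric] distrib_left by (simp add: abs_le_iff)
qed

end

subsection \<open>Dilations\<close>

text \<open>One two-parameter family covers \<open>dil1\<close>, \<open>dil2\<close>, their inverses
  and the joint scaling of frequencies; being diagonal, it is symmetric for the inner
  product.\<close>

definition dilate :: "real \<Rightarrow> real \<Rightarrow> r2 \<Rightarrow> r2" where
  "dilate a b x = (a * fst x, b * snd x)"

lemma dilate_dilate: "dilate a b (dilate a' b' x) = dilate (a * a') (b * b') x"
  by (simp add: dilate_def)

lemma dilate_1: "dilate 1 1 x = x"
  by (simp add: dilate_def)

lemma dilate_diff: "dilate a b (x - y) = dilate a b x - dilate a b y"
  by (simp add: dilate_def algebra_simps)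

lemma dilate_inner: "dilate a b x \<bullet> w = x \<bullet> dilate a b w"
  by (simp add: dilate_def inner_prod_def mult_ac)

lemma dilate_measurable [measurable]: "dilate a b \<in> borel_measurable borel"
  unfolding dilate_def[abs_def] by (intro borel_measurable_continuous_onI continuous_intros)

lemma dil1_eq: "dil1 t P = dilate t 1 ` P" and dil2_eq: "dil2 r Q = dilate 1 r ` Q"
  unfolding dil1_def dil2_def dilate_def[abs_def] by (auto simp: split_beta' image_iff)

context
  fixes a b :: real
  assumes ab: "a > 0" "b > 0"
begin

lemma
  shows lebesgue_dilate: "lebesgue = density (distr lebesgue lebesgue (dilate a b)) (\<lambda>_. ennreal (a * b))"
    and dilate_lebesgue: "dilate a b \<in> lebesgue \<rightarrow>\<^sub>M lebesgue"
proof -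
  define c :: "r2 \<Rightarrow> real" where "c j = (if j = (1, 0) then a else b)" for j
  have B: "(Basis :: r2 set) = {(1, 0), (0, 1)}" by (auto simp: Basis_prod_def)
  have T: "(\<lambda>x. 0 + (\<Sum>j\<in>Basis. (c j * (x \<bullet> j)) *\<^sub>R j)) = dilate a b"
    unfolding B by (auto simp: c_def dilate_def fun_eq_iff)
  have p: "(\<Prod>j\<in>Basis. \<bar>c j\<bar>) = a * b" unfolding B using ab by (simp add: c_def)
  have c0: "c j \<noteq> 0" for j using ab by (simp add: c_def)
  show "lebesgue = density (distr lebesgue lebesgue (dilate a b)) (\<lambda>_. ennreal (a * b))"
    using lebesgue_affine_euclidean[of c 0] c0 unfolding T p by simp
  show "dilate a b \<in> lebesgue \<rightarrow>\<^sub>M lebesgue"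
    using lebesgue_affine_measurable[of c 0] c0 unfolding T by simp
qed

lemma nn_integral_dilate:
  assumes [measurable]: "f \<in> borel_measurable lebesgue"
  shows "(\<integral>\<^sup>+x. f x \<partial>lebesgue) = ennreal (a * b) * (\<integral>\<^sup>+x. f (dilate a b x) \<partial>lebesgue)"
proof -
  note [measurable] = dilate_lebesgue
  have "(\<integral>\<^sup>+x. f x \<partial>lebesgue) = (\<integral>\<^sup>+x. f x \<partial>density (distr lebesgue lebesgue (dilate a b)) (\<lambda>_. ennreal (a * b)))"
    using lebesgue_dilate by simp
  also have "\<dots> = (\<integral>\<^sup>+x. ennreal (a * b) * f x \<partial>distr lebesgue lebesgue (dilate a b))"
    by (rule nn_integral_density) auto
  also have "\<dots> = (\<integral>\<^sup>+x. ennreal (a * b) * f (dilate a b x) \<partial>lebesgue)"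
    by (rule nn_integral_distr) auto
  also have "\<dots> = ennreal (a * b) * (\<integral>\<^sup>+x. f (dilate a b x) \<partial>lebesgue)"
    by (rule nn_integral_cmult) auto
  finally show ?thesis .
qed

lemma integral_dilate:
  fixes f :: "r2 \<Rightarrow> complex"
  assumes [measurable]: "f \<in> borel_measurable lebesgue"
  shows "(\<integral>x. f x \<partial>lebesgue) = (a * b) *\<^sub>R (\<integral>x. f (dilate a b x) \<partial>lebesgue)"
proof -
  note [measurable] = dilate_lebesgue
  have "(\<integral>x. f x \<partial>lebesgue) = (\<integral>x. f x \<partial>density (distr lebesgue lebesgue (dilate a b)) (\<lambda>_. ennreal (a * b)))"
    using lebesgue_dilate by simp
  also have "\<dots> = (\<integral>x. (a * b) *\<^sub>R f x \<partial>distr lebesgue lebesgue (dilate a b))"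
    using ab by (intro integral_density) auto
  also have "\<dots> = (\<integral>x. (a * b) *\<^sub>R f (dilate a b x) \<partial>lebesgue)"
    by (rule integral_distr) auto
  finally show ?thesis by simp
qed

lemma dilate_image_iff: "x \<in> dilate a b ` S \<longleftrightarrow> dilate (1 / a) (1 / b) x \<in> S"
proof
  assume "dilate (1 / a) (1 / b) x \<in> S"
  then show "x \<in> dilate a b ` S" using ab by (intro image_eqI[of _ _ "dilate (1 / a) (1 / b) x"]) (auto simp: dilate_dilate dilate_1)
qed (use ab in \<open>auto simp: dilate_dilate dilate_1\<close>)

lemma dilate_mem_image: "dilate a b x \<in> dilate a b ` S \<longleftrightarrow> x \<in> S"
  unfolding dilate_image_iff using ab by (simp add: dilate_dilate dilate_1)

end

lemma
  assumes ab: "a > 0" "b > 0" and S: "S \<in> lmeasurable"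
  shows dilate_lmeasurable: "dilate a b ` S \<in> lmeasurable"
    and measure_dilate: "measure lebesgue (dilate a b ` S) = a * b * measure lebesgue S"
proof -
  have sets[measurable]: "dilate a b ` S \<in> sets lebesgue"
  proof -
    have "dilate (1 / a) (1 / b) -` S \<inter> space lebesgue \<in> sets lebesgue"
      using ab S by (intro measurable_sets[OF dilate_lebesgue]) (auto simp: fmeasurableD)
    also have "dilate (1 / a) (1 / b) -` S \<inter> space lebesgue = dilate a b ` S"
      by (intro set_eqI) (simp add: dilate_image_iff[OF ab])
    finally show ?thesis .
  qed
  have "emeasure lebesgue (dilate a b ` S) = (\<integral>\<^sup>+x. indicator (dilate a b ` S) x \<partial>lebesgue)" by simp
  also have "\<dots> = ennreal (a * b) * (\<integral>\<^sup>+x. indicator (dilate a b ` S) (dilate a b x) \<partial>lebesgue)"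
    by (rule nn_integral_dilate[OF ab]) simp
  also have "(\<lambda>x. indicator (dilate a b ` S) (dilate a b x) :: ennreal) = indicator S"
    by (auto simp: indicator_def dilate_mem_image[OF ab] fun_eq_iff)
  also have "(\<integral>\<^sup>+x. indicator S x \<partial>lebesgue) = emeasure lebesgue S"
    using S by (simp add: fmeasurableD)
  also have "ennreal (a * b) * emeasure lebesgue S = ennreal (a * b * measure lebesgue S)"
    using ab S by (simp add: emeasure_eq_measure2 ennreal_mult)
  finally have *: "emeasure lebesgue (dilate a b ` S) = ennreal (a * b * measure lebesgue S)" .
  then show "dilate a b ` S \<in> lmeasurable" using sets by (auto intro: fmeasurableI)
  show "measure lebesgue (dilate a b ` S) = a * b * measure lebesgue S"
    using ab by (simp add: measure_def[of _ "dilate a b ` S"] *)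
qed

text \<open>The measure of the symmetric difference of \<open>B\<close> and its translate by
  \<open>- w\<close>.\<close>

definition translation_defect :: "r2 set \<Rightarrow> r2 \<Rightarrow> real" where
  "translation_defect B w = (\<integral>x. \<bar>indicator B (x + w) - indicator B x\<bar> \<partial>lborel)"

lemma ex_borel_set_version:
  fixes Q :: "r2 set"
  assumes Q: "Q \<in> lmeasurable"
  obtains B where "B \<in> sets borel" "AE x in lebesgue. x \<in> Q \<longleftrightarrow> x \<in> B" "emeasure lborel B < \<infinity>"
proof -
  have Qs[measurable]: "Q \<in> sets lebesgue" using Q by (simp add: fmeasurableD)
  have "(indicator Q :: r2 \<Rightarrow> real) \<in> borel_measurable lebesgue" by simp
  from completion_ex_borel_measurable_real[OF this]
  obtain g where g: "g \<in> borel_measurable lborel" "AE x in lborel. indicator Q x = (g x :: real)" by blast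
  have [measurable]: "g \<in> borel_measurable borel" using g by simp
  define B where "B = {x. g x = 1}"
  have B: "B \<in> sets borel" unfolding B_def by measurable
  have "AE x in lborel. x \<in> Q \<longleftrightarrow> x \<in> B"
    using g(2) by eventually_elim (auto simp: B_def indicator_def split: if_splits)
  then have AE: "AE x in lebesgue. x \<in> Q \<longleftrightarrow> x \<in> B" by (rule AE_completion)
  have "emeasure lebesgue Q = emeasure lebesgue B"
    by (rule emeasure_eq_AE[OF AE]) (use B in auto)
  then have "emeasure lborel B < \<infinity>" using Q B by (auto simp: fmeasurable_def)
  with B AE show thesis by (rule that)
qed

text \<open>Change of variables with Jacobian \<open>t\<close>; the dilation moves onto the
  frequency by symmetry.\<close>

lemma fourier_dilate:
  assumes P: "P \<in> lmeasurable" and t: "t > 0"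
  shows "fourier (lebesgue_on (dil1 t P)) (\<lambda>_. 1) w = complex_of_real t * fourier (lebesgue_on P) (\<lambda>_. 1) (dilate t 1 w)"
proof -
  have Pt: "dil1 t P \<in> lmeasurable" unfolding dil1_eq using t P by (intro dilate_lmeasurable) auto
  have [measurable]: "dil1 t P \<in> sets lebesgue" using Pt by (simp add: fmeasurableD)
  have k: "(\<lambda>x. cis (- (x \<bullet> w))) \<in> borel_measurable lebesgue"
    by (rule borel_measurable_lebesgueI) measurable
  have "fourier (lebesgue_on (dil1 t P)) (\<lambda>_. 1) w = (\<integral>x. indicator (dil1 t P) x * cis (- (x \<bullet> w)) \<partial>lebesgue)"
    unfolding fourier_lebesgue_on[OF Pt] by (simp add: fourier_def)
  also have "\<dots> = t *\<^sub>R (\<integral>x. indicator (dil1 t P) (dilate t 1 x) * cis (- (dilate t 1 x \<bullet> w)) \<partial>lebesgue)"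
    using t k by (subst integral_dilate[of t 1]) auto
  also have "(\<integral>x. indicator (dil1 t P) (dilate t 1 x) * cis (- (dilate t 1 x \<bullet> w)) \<partial>lebesgue)
      = (\<integral>x. indicator P x * cis (- (x \<bullet> dilate t 1 w)) \<partial>lebesgue)"
    using t by (simp add: dil1_eq indicator_def dilate_mem_image dilate_inner)
  also have "\<dots> = fourier (lebesgue_on P) (\<lambda>_. 1) (dilate t 1 w)"
    unfolding fourier_lebesgue_on[OF P] by (simp add: fourier_def)
  finally show ?thesis by (simp add: scaleR_conv_of_real)
qed

lemma translation_defect_measurable [measurable]:
  assumes [measurable]: "B \<in> sets borel"
  shows "translation_defect B \<in> borel_measurable borel"
  unfolding translation_defect_def[abs_def] by measurable

lemma translation_defect_bounds:
  assumes B: "B \<in> sets borel" "emeasure lborel B < \<infinity>"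
  shows "0 \<le> translation_defect B w" "translation_defect B w \<le> 2 * measure lborel B"
    and "integrable lborel (\<lambda>x. \<bar>indicator B (x + w) - indicator B x :: real\<bar>)"
proof -
  have i: "integrable lborel (indicator B :: r2 \<Rightarrow> real)" using B by (intro integrable_real_indicator) auto
  note i' = integrable_lborel_shift[OF i, of w]
  show int: "integrable lborel (\<lambda>x. \<bar>indicator B (x + w) - indicator B x :: real\<bar>)" using i i' by auto
  show "0 \<le> translation_defect B w" by (simp add: translation_defect_def)
  have "translation_defect B w \<le> (\<integral>x. indicator B (x + w) + indicator B x \<partial>lborel)"
    unfolding translation_defect_def using i i' int by (intro integral_mono) (auto split: split_indicator)
  also have "\<dots> = (\<integral>x. indicator B (x + w) \<partial>lborel) + (\<integral>x. indicator B x \<partial>lborel)"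
    using i i' by simp
  also have "\<dots> = 2 * measure lborel B"
    using integral_lborel_shift[of "indicator B :: r2 \<Rightarrow> real" w] B by simp
  finally show "translation_defect B w \<le> 2 * measure lborel B" .
qed

text \<open>Count of factors: the squared transform of \<open>dil1 t P\<close> gives
  \<open>t\<^sup>2\<close>, undoing \<open>dil2 r\<close> in each of the two frequency variables
  gives \<open>r\<close> twice, and the final rescaling of their difference gives
  \<open>1 / (t * r)\<close>. The product is \<open>t * r\<close>.\<close>

lemma trace_defect_dil_le:
  assumes P: "P \<in> lmeasurable" and Q: "Q \<in> lmeasurable" and t: "t > 0" and r: "r > 0"
    and B: "B \<in> sets borel" "AE x in lebesgue. x \<in> Q \<longleftrightarrow> x \<in> B" "emeasure lborel B < \<infinity>"
  shows "limiting_sets.trace_defect (dil1 t P) (dil2 r Q) \<le> ((2 * pi) powr (-2))\<^sup>2 * (t * r *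
    (\<integral>w. (cmod (fourier (lebesgue_on P) (\<lambda>_. 1) w))\<^sup>2 * translation_defect B (dilate (1 / t) (1 / r) w) \<partial>lborel))"
proof -
  have Pt: "dil1 t P \<in> lmeasurable" unfolding dil1_eq using t P by (intro dilate_lmeasurable) auto
  have Qr: "dil2 r Q \<in> lmeasurable" unfolding dil2_eq using r Q by (intro dilate_lmeasurable) auto
  interpret S: limiting_sets "dil1 t P" "dil2 r Q" using Pt Qr by unfold_locales
  interpret PQ: limiting_sets P Q using P Q by unfold_locales
  note [measurable] = B(1)
  have [measurable]: "dil2 r Q \<in> sets lebesgue" using Qr by (simp add: fmeasurableD)
  define D where "D w = (cmod (fourier (lebesgue_on P) (\<lambda>_. 1) w))\<^sup>2" for w
  have Dm[measurable]: "D \<in> borel_measurable borel"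
    unfolding D_def using PQ.fourier_1_measurable by measurable
  have D0: "0 \<le> D w" for w by (simp add: D_def)
  have Di: "integrable lborel D"
    using PQ.nn_integral_fourier_1 by (simp add: integrable_iff_bounded D_def[symmetric] D0)
  define W where "W u = nsq (lebesgue_on (dil2 r Q)) (fourier (lebesgue_on (dil1 t P)) (S.wave u))" for u
  have Wm: "W \<in> borel_measurable lebesgue"
    unfolding W_def by (rule borel_measurable_lebesgueI[OF S.nsq_fourier_wave_measurable])
  \<comment> \<open>Both frequencies are written as \<open>dilate 1 r\<close> of new variables
    \<open>a\<close>, \<open>b\<close>, so that \<open>dil2 r Q\<close> becomes \<open>Q\<close>,
    which may be replaced by the Borel set \<open>B\<close> almost everywhere.\<close>
  have W_dilate: "ennreal (W (dilate 1 r a)) = ennreal r * (ennreal (t\<^sup>2) * (\<integral>\<^sup>+b. indicator B b * ennreal (D (dilate t r (b - a))) \<partial>lborel))" for a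
  proof -
    have "ennreal (W (dilate 1 r a)) = (\<integral>\<^sup>+v. ennreal (t\<^sup>2 * D (dilate t 1 (v - dilate 1 r a))) \<partial>lebesgue_on (dil2 r Q))"
      unfolding W_def S.ennreal_nsq_fourier_wave D_def fourier_dilate[OF P t]
      using t by (simp add: norm_mult power_mult_distrib)
    also have "\<dots> = (\<integral>\<^sup>+v. ennreal (t\<^sup>2 * D (dilate t 1 (v - dilate 1 r a))) * indicator (dil2 r Q) v \<partial>lebesgue)"
      using sets_lebesgue_Int_space[OF Qr] by (rule nn_integral_restrict_space)
    also have "\<dots> = ennreal (1 * r) * (\<integral>\<^sup>+b. ennreal (t\<^sup>2 * D (dilate t 1 (dilate 1 r b - dilate 1 r a))) * indicator (dil2 r Q) (dilate 1 r b) \<partial>lebesgue)"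
    proof (rule nn_integral_dilate)
      have "(\<lambda>v. ennreal (t\<^sup>2 * D (dilate t 1 (v - dilate 1 r a)))) \<in> borel_measurable lebesgue"
        by (rule measurable_completion) simp
      then show "(\<lambda>v. ennreal (t\<^sup>2 * D (dilate t 1 (v - dilate 1 r a))) * indicator (dil2 r Q) v) \<in> borel_measurable lebesgue"
        by measurable
    qed (use r in auto)
    also have "(\<integral>\<^sup>+b. ennreal (t\<^sup>2 * D (dilate t 1 (dilate 1 r b - dilate 1 r a))) * indicator (dil2 r Q) (dilate 1 r b) \<partial>lebesgue)
        = (\<integral>\<^sup>+b. ennreal (t\<^sup>2) * (indicator B b * ennreal (D (dilate t r (b - a)))) \<partial>lebesgue)"
    proof (rule nn_integral_cong_AE)
      have eq: "dilate t 1 (dilate 1 r b - dilate 1 r a) = dilate t r (b - a)" for b by (simp add: dilate_dilate flip: dilate_diff)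
      show "AE b in lebesgue. ennreal (t\<^sup>2 * D (dilate t 1 (dilate 1 r b - dilate 1 r a))) * indicator (dil2 r Q) (dilate 1 r b)
          = ennreal (t\<^sup>2) * (indicator B b * ennreal (D (dilate t r (b - a))))"
        using B(2) by eventually_elim (use r in \<open>auto simp: eq dil2_eq dilate_mem_image indicator_def ennreal_mult D0\<close>)
    qed
    also have "\<dots> = ennreal (t\<^sup>2) * (\<integral>\<^sup>+b. indicator B b * ennreal (D (dilate t r (b - a))) \<partial>lborel)"
      unfolding nn_integral_completion by (rule nn_integral_cmult) measurable
    finally show ?thesis by simp
  qed
  define I where "I = (\<integral>u. indicator (- dil2 r Q) u * W u \<partial>lebesgue)"
  have "ennreal I = (\<integral>\<^sup>+u. ennreal (indicator (- dil2 r Q) u * W u) \<partial>lebesgue)"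
    unfolding I_def W_def
    by (rule nn_integral_eq_integral[symmetric, OF S.integral_compl(1)[OF S.wave_integrable]]) (simp add: nsq_nonneg)
  also have "\<dots> = ennreal (1 * r) * (\<integral>\<^sup>+a. ennreal (indicator (- dil2 r Q) (dilate 1 r a) * W (dilate 1 r a)) \<partial>lebesgue)"
    using r Wm by (intro nn_integral_dilate) auto
  also have "(\<integral>\<^sup>+a. ennreal (indicator (- dil2 r Q) (dilate 1 r a) * W (dilate 1 r a)) \<partial>lebesgue)
      = (\<integral>\<^sup>+a. (ennreal r * ennreal (t\<^sup>2)) * (\<integral>\<^sup>+b. indicator (- B) a * (indicator B b * ennreal (D (dilate t r (b - a)))) \<partial>lborel) \<partial>lebesgue)"
  proof (rule nn_integral_cong_AE)
    show "AE a in lebesgue. ennreal (indicator (- dil2 r Q) (dilate 1 r a) * W (dilate 1 r a)) =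
        (ennreal r * ennreal (t\<^sup>2)) * (\<integral>\<^sup>+b. indicator (- B) a * (indicator B b * ennreal (D (dilate t r (b - a)))) \<partial>lborel)"
      using B(2) by eventually_elim
        (use r in \<open>auto simp: dil2_eq dilate_mem_image indicator_def W_dilate[unfolded indicator_def] mult.assoc\<close>)
  qed
  also have "\<dots> = (ennreal r * ennreal (t\<^sup>2)) * (\<integral>\<^sup>+a. \<integral>\<^sup>+b. indicator (- B) a * (indicator B b * ennreal (D (dilate t r (b - a)))) \<partial>lborel \<partial>lborel)"
    unfolding nn_integral_completion by (rule nn_integral_cmult) measurable
  also have "(\<integral>\<^sup>+a. \<integral>\<^sup>+b. indicator (- B) a * (indicator B b * ennreal (D (dilate t r (b - a)))) \<partial>lborel \<partial>lborel)
      = (\<integral>\<^sup>+a. \<integral>\<^sup>+w. indicator (- B) a * (indicator B (w + a) * ennreal (D (dilate t r w))) \<partial>lborel \<partial>lborel)"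
  proof (rule nn_integral_cong)
    fix a
    show "(\<integral>\<^sup>+b. indicator (- B) a * (indicator B b * ennreal (D (dilate t r (b - a)))) \<partial>lborel)
        = (\<integral>\<^sup>+w. indicator (- B) a * (indicator B (w + a) * ennreal (D (dilate t r w))) \<partial>lborel)"
      using nn_integral_lborel_shift[of "\<lambda>b. indicator (- B) a * (indicator B b * ennreal (D (dilate t r (b - a))))" a]
      by simp
  qed
  also have "\<dots> = (\<integral>\<^sup>+w. \<integral>\<^sup>+a. indicator (- B) a * (indicator B (w + a) * ennreal (D (dilate t r w))) \<partial>lborel \<partial>lborel)"
    by (rule lborel_pair.Fubini'[symmetric]) measurable
  \<comment> \<open>The points \<open>a\<close> outside \<open>B\<close> with \<open>a + w\<close>
    in \<open>B\<close> form only one half of the symmetric difference; enlarging it to the whole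
    costs a constant factor.\<close>
  also have "\<dots> \<le> (\<integral>\<^sup>+w. ennreal (D (dilate t r w) * translation_defect B w) \<partial>lborel)"
  proof (rule nn_integral_mono)
    fix w
    have "(\<integral>\<^sup>+a. indicator (- B) a * (indicator B (w + a) * ennreal (D (dilate t r w))) \<partial>lborel)
        \<le> (\<integral>\<^sup>+a. ennreal (D (dilate t r w)) * ennreal \<bar>indicator B (a + w) - indicator B a\<bar> \<partial>lborel)"
      by (rule nn_integral_mono) (auto simp: add.commute split: split_indicator)
    also have "\<dots> = ennreal (D (dilate t r w)) * (\<integral>\<^sup>+a. ennreal \<bar>indicator B (a + w) - indicator B a\<bar> \<partial>lborel)"
      by (rule nn_integral_cmult) measurable
    also have "(\<integral>\<^sup>+a. ennreal \<bar>indicator B (a + w) - indicator B a\<bar> \<partial>lborel) = ennreal (translation_defect B w)"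
      unfolding translation_defect_def by (rule nn_integral_eq_integral[OF translation_defect_bounds(3)[OF B(1,3)]]) simp
    finally show "(\<integral>\<^sup>+a. indicator (- B) a * (indicator B (w + a) * ennreal (D (dilate t r w))) \<partial>lborel)
        \<le> ennreal (D (dilate t r w) * translation_defect B w)"
      using translation_defect_bounds(1)[OF B(1,3)] by (simp add: ennreal_mult D0)
  qed
  also have "\<dots> = (\<integral>\<^sup>+w. ennreal (D (dilate t r w) * translation_defect B w) \<partial>lebesgue)"
    by (simp add: nn_integral_completion)
  also have "\<dots> = ennreal ((1 / t) * (1 / r)) * (\<integral>\<^sup>+w. ennreal (D (dilate t r (dilate (1 / t) (1 / r) w)) * translation_defect B (dilate (1 / t) (1 / r) w)) \<partial>lebesgue)"
    using t r by (intro nn_integral_dilate) (auto intro!: measurable_completion)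
  also have "\<dots> = ennreal ((1 / t) * (1 / r)) * (\<integral>\<^sup>+w. ennreal (D w * translation_defect B (dilate (1 / t) (1 / r) w)) \<partial>lborel)"
    using t r by (simp add: dilate_dilate dilate_1 nn_integral_completion)
  also have "(\<integral>\<^sup>+w. ennreal (D w * translation_defect B (dilate (1 / t) (1 / r) w)) \<partial>lborel)
      = ennreal (\<integral>w. D w * translation_defect B (dilate (1 / t) (1 / r) w) \<partial>lborel)"
  proof (rule nn_integral_eq_integral)
    show "integrable lborel (\<lambda>w. D w * translation_defect B (dilate (1 / t) (1 / r) w))"
      by (rule Bochner_Integration.integrable_bound[OF integrable_mult_left[OF Di, of "2 * measure lborel B"]])
         (simp_all add: abs_mult D0 translation_defect_bounds(1,2)[OF B(1,3)] mult_left_mono)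
  qed (simp add: D0 translation_defect_bounds(1)[OF B(1,3)])
  finally have "ennreal I \<le> ennreal (1 * r) * (ennreal r * ennreal (t\<^sup>2) * (ennreal ((1 / t) * (1 / r)) *
       ennreal (\<integral>w. D w * translation_defect B (dilate (1 / t) (1 / r) w) \<partial>lborel)))"
    by (simp add: mult_left_mono)
  also have "\<dots> = ennreal ((1 * r) * (r * t\<^sup>2 * ((1 / t) * (1 / r) * (\<integral>w. D w * translation_defect B (dilate (1 / t) (1 / r) w) \<partial>lborel))))"
  proof -
    have "ennreal a * (ennreal b * ennreal c * (ennreal d * ennreal e)) = ennreal (a * (b * c * (d * e)))"
      if "0 \<le> a" "0 \<le> b" "0 \<le> c" "0 \<le> d" "0 \<le> e" for a b c d e
      using that by (simp add: ennreal_mult)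
    moreover have "0 \<le> (\<integral>w. D w * translation_defect B (dilate (1 / t) (1 / r) w) \<partial>lborel)"
      by (rule integral_nonneg_AE) (simp add: D0 translation_defect_bounds(1)[OF B(1,3)])
    ultimately show ?thesis using t r by simp
  qed
  also have "(1 * r) * (r * t\<^sup>2 * ((1 / t) * (1 / r) * (\<integral>w. D w * translation_defect B (dilate (1 / t) (1 / r) w) \<partial>lborel)))
      = t * r * (\<integral>w. D w * translation_defect B (dilate (1 / t) (1 / r) w) \<partial>lborel)"
    using t r by (simp add: power2_eq_square field_simps)
  finally have "I \<le> t * r * (\<integral>w. D w * translation_defect B (dilate (1 / t) (1 / r) w) \<partial>lborel)"
    using t r by (subst (asm) ennreal_le_iff) (simp_all add: D0 translation_defect_bounds(1)[OF B(1,3)])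
  then show ?thesis
    unfolding S.trace_defect_eq W_def[symmetric] I_def[symmetric] D_def by (rule mult_left_mono) simp
qed

text \<open>Dominated convergence runs along sequences, the claim along a product filter. If the
  claim failed, one could pick for each \<open>n\<close> a bad pair with both coordinates at least
  \<open>n\<close>; along these pairs the shifts tend to 0.\<close>

lemma translation_defect_integral_tendsto:
  assumes D: "integrable lborel D" and B: "B \<in> sets borel" "emeasure lborel B < \<infinity>"
  shows "((\<lambda>(t, r). \<integral>w. D w * translation_defect B (dilate (1 / t) (1 / r) w) \<partial>lborel) \<longlongrightarrow> (0::real)) (at_top \<times>\<^sub>F at_top)"
proof (rule tendstoI, rule ccontr)
  fix e :: real assume e: "e > 0"
  let ?J = "\<lambda>(t, r). \<integral>w. D w * translation_defect B (dilate (1 / t) (1 / r) w) \<partial>lborel"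
  note [measurable] = B(1)
  have [measurable]: "D \<in> borel_measurable borel" using D by auto
  assume not: "\<not> (\<forall>\<^sub>F x in at_top \<times>\<^sub>F at_top. dist (?J x) 0 < e)"
  have "\<exists>t r. t \<ge> real n \<and> r \<ge> real n \<and> \<not> dist (?J (t, r)) 0 < e" for n
  proof (rule ccontr)
    assume "\<not> (\<exists>t r. t \<ge> real n \<and> r \<ge> real n \<and> \<not> dist (?J (t, r)) 0 < e)"
    then have "\<forall>t\<ge>real n. \<forall>r\<ge>real n. dist (?J (t, r)) 0 < e" by blast
    then have "\<forall>\<^sub>F x in at_top \<times>\<^sub>F at_top. dist (?J x) 0 < e"
      unfolding eventually_prod_filter
      by (intro exI[of _ "\<lambda>t. t \<ge> real n"] conjI eventually_ge_at_top) blast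
    with not show False by contradiction
  qed
  then have "\<forall>n. \<exists>p. fst p \<ge> real n \<and> snd p \<ge> real n \<and> \<not> dist (?J p) 0 < e"
    unfolding split_paired_Ex by simp
  from choice[OF this] obtain p
    where p: "\<forall>n. fst (p n) \<ge> real n \<and> snd (p n) \<ge> real n \<and> \<not> dist (?J (p n)) 0 < e" ..
  define t r where "t n = fst (p n)" and "r n = snd (p n)" for n
  have tr: "t n \<ge> real n" "r n \<ge> real n" "\<not> dist (?J (t n, r n)) 0 < e" for n
    using p[rule_format, of n] by (simp_all add: t_def r_def split_beta)
  have inv: "(\<lambda>n. 1 / s n) \<longlonglongrightarrow> 0" if "\<And>n. s n \<ge> real n" for s :: "nat \<Rightarrow> real"
  proof -
    have "filterlim s at_top sequentially"
      by (rule filterlim_at_top_mono[OF filterlim_real_sequentially]) (use that in auto)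
    then show ?thesis using tendsto_inverse_0_at_top by (simp add: divide_inverse)
  qed
  have "(\<lambda>n. ?J (t n, r n)) \<longlonglongrightarrow> (\<integral>w. 0 \<partial>(lborel :: r2 measure))"
    unfolding prod.case
  proof (rule integral_dominated_convergence)
    show "integrable lborel (\<lambda>w. norm (D w) * (2 * measure lborel B))" using D by simp
    show "AE w in lborel. (\<lambda>n. D w * translation_defect B (dilate (1 / t n) (1 / r n) w)) \<longlonglongrightarrow> 0"
    proof (rule AE_I2)
      fix w :: r2
      have "(\<lambda>n. dilate (1 / t n) (1 / r n) w) \<longlonglongrightarrow> (0 * fst w, 0 * snd w)"
        unfolding dilate_def by (intro tendsto_Pair tendsto_mult tendsto_const inv tr)
      then have "(\<lambda>n. dilate (1 / t n) (1 / r n) w) \<longlonglongrightarrow> 0" by (simp add: zero_prod_def)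
      from indicator_translation_continuous[OF B this]
      have "(\<lambda>n. D w * translation_defect B (dilate (1 / t n) (1 / r n) w)) \<longlonglongrightarrow> D w * 0"
        unfolding translation_defect_def by (intro tendsto_mult tendsto_const)
      then show "(\<lambda>n. D w * translation_defect B (dilate (1 / t n) (1 / r n) w)) \<longlonglongrightarrow> 0" by simp
    qed
    show "AE w in lborel. norm (D w * translation_defect B (dilate (1 / t n) (1 / r n) w)) \<le> norm (D w) * (2 * measure lborel B)" for n
      by (intro AE_I2) (simp add: abs_mult translation_defect_bounds(1,2)[OF B] mult_left_mono)
  qed measurable
  then have "(\<lambda>n. ?J (t n, r n)) \<longlonglongrightarrow> 0" by simp
  then have "\<forall>\<^sub>F n in sequentially. dist (?J (t n, r n)) 0 < e" using e by (rule tendstoD)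
  then show False using tr(3) by (auto simp: eventually_sequentially)
qed

theorem theorem2:
  fixes P Q :: "(real \<times> real) set" and eps :: real
  assumes "P \<in> sets lebesgue" "Q \<in> sets lebesgue"
    and "emeasure lebesgue P < \<infinity>" "emeasure lebesgue Q < \<infinity>"
    and "frontier P \<in> null_sets lebesgue" "frontier Q \<in> null_sets lebesgue"
    and "0 < eps" "eps < 1"
  shows "((\<lambda>(t, r). (real (eig_count (dil1 t P) (dil2 r Q) eps)
            - (2 * pi) powr (-2) * measure lebesgue P * measure lebesgue Q * t * r) / (t * r))
          \<longlongrightarrow> 0) (at_top \<times>\<^sub>F at_top)"
proof -
  have P: "P \<in> lmeasurable" and Q: "Q \<in> lmeasurable" using assms by (auto simp: fmeasurable_def)
  interpret PQ: limiting_sets P Q using P Q by unfold_locales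
  obtain B where B: "B \<in> sets borel" "AE x in lebesgue. x \<in> Q \<longleftrightarrow> x \<in> B" "emeasure lborel B < \<infinity>"
    using ex_borel_set_version[OF Q] .
  let ?c = "(2 * pi) powr (-2)"
  define D where "D w = (cmod (fourier (lebesgue_on P) (\<lambda>_. 1) w))\<^sup>2" for w
  have [measurable]: "D \<in> borel_measurable borel"
    unfolding D_def using PQ.fourier_1_measurable by measurable
  have Di: "integrable lborel D"
    using PQ.nn_integral_fourier_1 by (simp add: integrable_iff_bounded D_def[symmetric]) (simp add: D_def)
  define J where "J = (\<lambda>(t, r). \<integral>w. D w * translation_defect B (dilate (1 / t) (1 / r) w) \<partial>lborel)"
  define K where "K = ?c\<^sup>2 * (1 / eps + 1 / (1 - eps))"
  have J: "(J \<longlongrightarrow> 0) (at_top \<times>\<^sub>F at_top)"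
    unfolding J_def by (rule translation_defect_integral_tendsto[OF Di B(1,3)])
  \<comment> \<open>An explicit bound for all positive \<open>t\<close> and \<open>r\<close>:
    dividing \<open>eig_count_estimate\<close> by \<open>t * r\<close> leaves a fixed constant times
    \<open>J\<close>.\<close>
  have est: "\<bar>(real (eig_count (dil1 t P) (dil2 r Q) eps) - ?c * measure lebesgue P * measure lebesgue Q * t * r) / (t * r)\<bar>
      \<le> K * J (t, r)" if t: "t > 0" and r: "r > 0" for t r
  proof -
    have Pt: "dil1 t P \<in> lmeasurable" "measure lebesgue (dil1 t P) = t * measure lebesgue P"
      using dilate_lmeasurable[of t 1, OF _ _ P] measure_dilate[of t 1, OF _ _ P] t by (auto simp: dil1_eq)
    have Qr: "dil2 r Q \<in> lmeasurable" "measure lebesgue (dil2 r Q) = r * measure lebesgue Q"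
      using dilate_lmeasurable[of 1 r, OF _ _ Q] measure_dilate[of 1 r, OF _ _ Q] r by (auto simp: dil2_eq)
    interpret S: limiting_sets "dil1 t P" "dil2 r Q" using Pt Qr by unfold_locales
    have "\<bar>real (eig_count (dil1 t P) (dil2 r Q) eps) - ?c * measure lebesgue P * measure lebesgue Q * t * r\<bar>
        \<le> S.trace_defect * (1 / eps + 1 / (1 - eps))"
      using S.eig_count_estimate[OF assms(7,8)] unfolding S.mM_eq S.mN_eq Pt(2) Qr(2) by (simp add: mult_ac)
    also have "\<dots> \<le> (?c\<^sup>2 * (t * r * J (t, r))) * (1 / eps + 1 / (1 - eps))"
      using trace_defect_dil_le[OF P Q t r B] assms(7,8) unfolding J_def D_def prod.case
      by (intro mult_right_mono) auto
    also have "\<dots> = K * J (t, r) * (t * r)" by (simp add: K_def mult_ac)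
    finally show ?thesis using t r by (simp add: abs_divide field_simps)
  qed
  have "((\<lambda>x. K * J x) \<longlongrightarrow> K * 0) (at_top \<times>\<^sub>F at_top)" by (intro tendsto_mult tendsto_const J)
  then have KJ: "((\<lambda>x. K * J x) \<longlongrightarrow> 0) (at_top \<times>\<^sub>F at_top)" by simp
  have "\<forall>\<^sub>F x in (at_top :: real filter) \<times>\<^sub>F (at_top :: real filter). fst x > 0 \<and> snd x > 0"
    unfolding eventually_prod_filter
    by (rule exI[of _ "\<lambda>t. t > 0"], rule exI[of _ "\<lambda>t. t > 0"]) (simp add: eventually_gt_at_top)
  then show ?thesis
    by (intro Lim_null_comparison[OF _ KJ]) (erule eventually_mono, use est in auto)
qed

end
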